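(* For each $n$, let $\{X_{ij}=X_{ij}^{(n)}:\ i,j=1,2,\dots\}$ be i.i.d. real random variables with $EX_{11}=\mu$, $EX_{11}^2=1$ and $EX_{11}^4<\infty$. Let $p=p(n)\le n$ with $c_n=p/n\to c\in(0,1)$ as $n\to\infty$. Let ${\bf s}_j=(X_{1j},\dots,X_{pj})^T$, $j=1,\dots,n$, $\bar{\bf s}=n^{-1}\sum_{j=1}^n{\bf s}_j$, $\mathcal S=\frac1n\sum_{j=1}^n({\bf s}_j-\bar{\bf s})({\bf s}_j-\bar{\bf s})^T$, and for $\boldsymbol\mu_0\in\mathbb R^p$ let $T^2=n(\bar{\bf s}-\boldsymbol\mu_0)^T\mathcal S^{-1}(\bar{\bf s}-\boldsymbol\mu_0)$. Then, when $\boldsymbol\mu=\boldsymbol\mu_0=(\mu,\dots,\mu)^T$ (i.e. $\boldsymbol\mu_0$ equals the mean vector of ${\bf s}_j$), $$\frac{\sqrt n}{\sqrt{2c_n\int x^{-2}\,dF_{c_n}(x)}}\Big(\frac{T^2}{n}-c_n\int\frac{dF_{c_n}(x)}{x}\Big)\xrightarrow{D}N(0,1).$$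
   Context: For $y>0$, $F_y$ denotes the Marchenko–Pastur distribution with ratio $y$: it has density $p_y(x)=(2\pi yx)^{-1}\sqrt{(b-x)(x-a)}$ for $a\le x\le b$ (and $0$ otherwise), with $a=(1-\sqrt y)^2$, $b=(1+\sqrt y)^2$, plus a point mass $1-y^{-1}$ at the origin if $y>1$. $F_{c_n}$ is this distribution with $y=c_n=p/n$. *)

theory Defs
  imports "HOL-Probability.Probability"
begin

definition mp_density :: "real \<Rightarrow> real \<Rightarrow> real" where
  "mp_density y x =
     (let a = (1 - sqrt y)^2; b = (1 + sqrt y)^2 in
      if a \<le> x \<and> x \<le> b then sqrt ((b - x) * (x - a)) / (2 * pi * y * x) else 0)"

definition marchenko_pastur :: "real \<Rightarrow> real measure" where
  "marchenko_pastur y = measure_of UNIV (sets borel)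
     (\<lambda>A. emeasure (density lborel (\<lambda>x. ennreal (mp_density y x))) A
          + (if y > 1 then ennreal (1 - 1 / y) * indicator A 0 else 0))"

text \<open>Quadratic form v^T A^{-1} v for a p x p matrix A (entries indexed by i,k < p).
  If A is singular, the value is set to 0 (convention; T^2 is undefined then).\<close>
definition right_inverse_on :: "nat \<Rightarrow> (nat \<Rightarrow> nat \<Rightarrow> real) \<Rightarrow> (nat \<Rightarrow> nat \<Rightarrow> real) \<Rightarrow> bool" where
  "right_inverse_on p A B \<longleftrightarrow>
     (\<forall>i<p. \<forall>k<p. (\<Sum>l<p. A i l * B l k) = (if i = k then 1 else 0))"

definition inv_quad_form :: "nat \<Rightarrow> (nat \<Rightarrow> nat \<Rightarrow> real) \<Rightarrow> (nat \<Rightarrow> real) \<Rightarrow> real" where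
  "inv_quad_form p A v =
     (if \<exists>B. right_inverse_on p A B
      then (let B = (SOME B. right_inverse_on p A B) in
            \<Sum>i<p. \<Sum>k<p. v i * B i k * v k)
      else 0)"

definition sample_mean :: "nat \<Rightarrow> (nat \<Rightarrow> nat \<Rightarrow> real) \<Rightarrow> nat \<Rightarrow> real" where
  "sample_mean n x i = (\<Sum>j<n. x i j) / real n"

definition sample_cov :: "nat \<Rightarrow> (nat \<Rightarrow> nat \<Rightarrow> real) \<Rightarrow> nat \<Rightarrow> nat \<Rightarrow> real" where
  "sample_cov n x i k =
     (\<Sum>j<n. (x i j - sample_mean n x i) * (x k j - sample_mean n x k)) / real n"

definition hotelling_T2 :: "nat \<Rightarrow> nat \<Rightarrow> (nat \<Rightarrow> nat \<Rightarrow> real) \<Rightarrow> (nat \<Rightarrow> real) \<Rightarrow> real" where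
  "hotelling_T2 p n x mu0 =
     real n * inv_quad_form p (sample_cov n x) (\<lambda>i. sample_mean n x i - mu0 i)"

end

theory Submission
  imports Defs "Jordan_Normal_Form.Determinant"
begin

text \<open>Only the normalised rows $x_0, \dots, x_{p-1}$ of the data matrix matter. Let $u$ be the unit vector
  proportional to $(1,\dots,1)$ and let $a_k$ be the squared distance from $u$ to the span of the first $k$ rows;
  then $T^2/n = 1/a_p - 1$. If $P_k$ projects onto the orthogonal complement of the first $k$ rows,
  then $a_{k+1} = a_k - (u \cdot P_k x_k)^2 / (x_k \cdot P_k x_k)$, where $x_k$ is independent of $P_k$ and
  $x_k \cdot P_k x_k$ is close to its mean, the rank $n-k \ge n-p$ of $P_k$. So no bound on the least eigenvalue of the
  sample covariance matrix is needed, and $\ln (n a_k / (n-k))$ is a sum of nearly uncorrelated increments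
  $(1 - \xi_k^2)/(n-k)$, with $\xi_k = v_k \cdot x_k$ and $v_k$ the normalisation of $P_k u$. The conditional variance of $\xi_k^2$ is 2
  up to a multiple of $\sum_i v_{k,i}^4$, which stays small by the same one-step analysis. Fourth moments suffice because
  the squares of normalised quadratic forms in a row are uniformly integrable.\<close>

section \<open>Moments of linear and quadratic forms in independent variables\<close>

text \<open>The number p of steps is of order n, so with m = n - k a one-step error is harmless only
  if it has the form (small) / m. Second moments and Chebyshev give an exceptional probability of
  order 1/m per step, which sums to a constant. A truncated second moment of size
  \<open>d ^ 4\<close> supplies the missing small factor; for this the parameter \<open>d\<close> is
  held fixed while n tends to infinity, and only afterwards tends to 0. Taking logarithms turns the
  product of the factors \<open>1 - xi^2 / pivot\<close> into a sum, and the normalisation by (n -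
  k)/n centres each increment to first order. The characteristic function of the sum is compared
  factor by factor with \<open>charprod\<close>, whose exponent is governed by the sum of n/(n -
  k)^2, with limit c/(1 - c). Hence the scaled logarithm has limiting variance 2c/(1 - c). Passing
  from ln a_p to 1/a_p - 1 multiplies the standard deviation by 1/(1 - c), which gives 2c/(1 - c)^3,
  the value of 2c times the second inverse moment of the Marchenko-Pastur law.\<close>

lemma integral_mono_real:
  fixes f g :: "'a \<Rightarrow> real"
  assumes "integrable M g" "f \<in> borel_measurable M" "\<And>x. x \<in> space M \<Longrightarrow> 0 \<le> f x" "\<And>x. x \<in> space M \<Longrightarrow> f x \<le> g x"
  shows "integrable M f \<and> integral\<^sup>L M f \<le> integral\<^sup>L M g"
proof -
  have i: "integrable M f"
    by (rule Bochner_Integration.integrable_bound[OF assms(1,2)]) (use assms(3,4) in \<open>force intro!: AE_I2\<close>)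
  show ?thesis using i assms by (auto intro!: integral_mono)
qed

lemma two_abs_prod_le: "2 * \<bar>a * b\<bar> \<le> a\<^sup>2 + b\<^sup>2" for a b :: real
proof -
  have "0 \<le> (\<bar>a\<bar> - \<bar>b\<bar>)\<^sup>2" by simp
  then show ?thesis by (simp add: power2_diff abs_mult)
qed

lemma abs_prod_le_sum_squares: "\<bar>a * b\<bar> \<le> a\<^sup>2 + b\<^sup>2" for a b :: real
  using two_abs_prod_le[of a b] abs_ge_zero[of "a * b"] by linarith

lemma integrable_prod_of_squares:
  fixes f g :: "'a \<Rightarrow> real"
  assumes [measurable]: "f \<in> borel_measurable M" "g \<in> borel_measurable M"
    and "integrable M (\<lambda>x. (f x)\<^sup>2)" "integrable M (\<lambda>x. (g x)\<^sup>2)"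
  shows "integrable M (\<lambda>x. f x * g x)"
  by (rule Bochner_Integration.integrable_bound[where f="\<lambda>x. (f x)\<^sup>2 + (g x)\<^sup>2"])
    (use assms in \<open>auto intro!: AE_I2 abs_prod_le_sum_squares simp: real_norm_def\<close>)

lemma integral_Cauchy_Schwarz:
  fixes f g :: "'a \<Rightarrow> real"
  assumes [measurable]: "f \<in> borel_measurable M" "g \<in> borel_measurable M"
    and F: "integrable M (\<lambda>x. (f x)\<^sup>2)" and G: "integrable M (\<lambda>x. (g x)\<^sup>2)"
  shows "(\<integral>x. f x * g x \<partial>M)\<^sup>2 \<le> (\<integral>x. (f x)\<^sup>2 \<partial>M) * (\<integral>x. (g x)\<^sup>2 \<partial>M)"
proof -
  let ?a = "\<integral>x. (f x)\<^sup>2 \<partial>M" and ?b = "\<integral>x. f x * g x \<partial>M" and ?c = "\<integral>x. (g x)\<^sup>2 \<partial>M"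
  have FG: "integrable M (\<lambda>x. f x * g x)" using assms by (rule integrable_prod_of_squares)
  have q: "0 \<le> ?a - 2 * t * ?b + t\<^sup>2 * ?c" for t
  proof -
    have "0 \<le> (\<integral>x. (f x - t * g x)\<^sup>2 \<partial>M)" by simp
    also have "\<dots> = (\<integral>x. (f x)\<^sup>2 - 2 * t * (f x * g x) + t\<^sup>2 * (g x)\<^sup>2 \<partial>M)"
      by (intro Bochner_Integration.integral_cong refl) (simp add: power2_eq_square algebra_simps)
    also have "\<dots> = ?a - 2 * t * ?b + t\<^sup>2 * ?c"
      using F G FG by simp
    finally show ?thesis .
  qed
  show ?thesis
  proof (cases "?c = 0")
    case True
    have "?b = 0"
    proof (rule ccontr)
      assume "?b \<noteq> 0"
      \<comment> \<open>With \<open>?c = 0\<close> the expression is affine in t, and this t gives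
        it the value -1.\<close>
      then show False using q[of "(?a + 1) / (2 * ?b)"] True by simp
    qed
    then show ?thesis using True by simp
  next
    case False
    then have c: "?c > 0" by (simp add: less_le)
    \<comment> \<open>The minimiser of the quadratic in t.\<close>
    from q[of "?b / ?c"] have "0 \<le> ?a - ?b\<^sup>2 / ?c"
      using c by (simp add: field_simps power2_eq_square)
    then show ?thesis using c by (simp add: field_simps)
  qed
qed

lemma power2_le_one_plus_power4: "x\<^sup>2 \<le> 1 + x ^ 4" for x :: real
proof -
  have "0 \<le> (x\<^sup>2 - 1)\<^sup>2 + 1 + (x\<^sup>2)\<^sup>2" by simp
  then show ?thesis by (simp add: power2_eq_square power4_eq_xxxx algebra_simps)
qed

section \<open>Standardised entry law and rows of independent copies\<close>

locale std_law =
  fixes D :: "real measure"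
  assumes prob: "prob_space D" and sets_D [measurable_cong, simp]: "sets D = sets borel"
    and int4: "integrable D (\<lambda>x. x ^ 4)"
    and mean: "(\<integral>x. x \<partial>D) = 0" and var: "(\<integral>x. x\<^sup>2 \<partial>D) = 1"
begin

sublocale D: prob_space D by (rule prob)

definition kurt :: real where "kurt = (\<integral>x. x ^ 4 \<partial>D)"

lemma integrable_D_bound:
  assumes [measurable]: "h \<in> borel_measurable borel" and "\<And>x. \<bar>h x\<bar> \<le> C * (1 + x ^ 4)"
  shows "integrable D h"
  by (rule Bochner_Integration.integrable_bound[where f="\<lambda>x. C * (1 + x ^ 4)"])
    (use int4 assms(2) order_trans[OF assms(2) abs_ge_self] in \<open>auto intro!: AE_I2\<close>)

lemma integrable_D [simp]:
  "integrable D (\<lambda>x. x)" "integrable D (\<lambda>x. x\<^sup>2)" "integrable D (\<lambda>x. x ^ 3)" "integrable D (\<lambda>x. x ^ 4)"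
proof -
  have 1: "\<bar>x\<bar> \<le> 1 + x\<^sup>2" for x :: real
    using abs_prod_le_sum_squares[of 1 x] by simp
  show "integrable D (\<lambda>x. x)"
    by (rule integrable_D_bound[where C=2]) 
      (auto intro!: order_trans[OF 1] intro: order_trans[OF _ add_mono[OF order_refl power2_le_one_plus_power4]] simp: algebra_simps,
       use power2_le_one_plus_power4 in \<open>smt (verit) zero_le_even_power even_numeral\<close>)
  show "integrable D (\<lambda>x. x\<^sup>2)"
    by (rule integrable_D_bound[where C=1]) (auto simp: power2_le_one_plus_power4)
  have "\<bar>x ^ 3\<bar> \<le> 2 * (1 + x ^ 4)" for x :: real
  proof -
    have "\<bar>x * x\<^sup>2\<bar> \<le> x\<^sup>2 + (x\<^sup>2)\<^sup>2" by (rule abs_prod_le_sum_squares)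
    then show ?thesis using power2_le_one_plus_power4[of x]
      by (simp add: power3_eq_cube power4_eq_xxxx power2_eq_square mult.assoc)
  qed
  then show "integrable D (\<lambda>x. x ^ 3)" by (intro integrable_D_bound[where C=2]) auto
  show "integrable D (\<lambda>x. x ^ 4)" by (rule int4)
qed

lemma kurt_ge_1: "1 \<le> kurt"
proof -
  have "0 \<le> (\<integral>x. (x\<^sup>2 - 1)\<^sup>2 \<partial>D)" by simp
  also have "\<dots> = (\<integral>x. x ^ 4 - 2 * x\<^sup>2 + 1 \<partial>D)"
    by (intro Bochner_Integration.integral_cong refl) (simp add: power2_eq_square power4_eq_xxxx algebra_simps)
  also have "\<dots> = kurt - 1" by (simp add: kurt_def var D.prob_space)
  finally show ?thesis by simp
qed

text \<open>Cauchy-Schwarz for x times x^2 gives the square root of \<open>kurt\<close>; since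
  \<open>kurt\<close> is at least 1, all constants can be kept polynomial in
  \<open>kurt\<close>.\<close>

lemma third_moment_le: "\<bar>\<integral>x. x ^ 3 \<partial>D\<bar> \<le> kurt"
proof -
  have "(\<integral>x. x * x\<^sup>2 \<partial>D)\<^sup>2 \<le> (\<integral>x. x\<^sup>2 \<partial>D) * (\<integral>x. (x\<^sup>2)\<^sup>2 \<partial>D)"
    by (rule integral_Cauchy_Schwarz) (auto simp flip: power_mult)
  moreover have "(\<lambda>x::real. x * x\<^sup>2) = (\<lambda>x. x ^ 3)" "(\<lambda>x::real. (x\<^sup>2)\<^sup>2) = (\<lambda>x. x ^ 4)"
    by (simp_all add: fun_eq_iff power3_eq_cube power2_eq_square power4_eq_xxxx mult.assoc)
  ultimately have "(\<integral>x. x ^ 3 \<partial>D)\<^sup>2 \<le> kurt"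
    by (simp add: var kurt_def)
  also have "\<dots> \<le> kurt\<^sup>2" using kurt_ge_1 by (simp add: power2_eq_square mult_left_mono)
  finally show ?thesis using kurt_ge_1 by (auto simp: abs_le_square_iff[symmetric])
qed

end

locale iid_seq = std_law D + prob_space M for D and M :: "'a measure" +
  fixes x :: "nat \<Rightarrow> 'a \<Rightarrow> real"
  assumes indep: "indep_vars (\<lambda>_. borel) x UNIV" and law: "\<And>j. distr M borel (x j) = D"
begin

lemma x_meas [measurable]: "x j \<in> borel_measurable M"
  using indep by (auto simp: indep_vars_def)

text \<open>The sigma-algebra of the first n variables, as the pullback along the restricted tuple.
  Independence from \<open>x n\<close> then becomes independence of two disjoint blocks of
  coordinates.\<close>

definition past :: "nat \<Rightarrow> 'a measure" where
  "past n = vimage_algebra (space M) (\<lambda>\<omega>. \<lambda>j\<in>{..<n}. x j \<omega>) (PiM {..<n} (\<lambda>_. borel))"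

lemma restrict_meas [measurable]: "(\<lambda>\<omega>. \<lambda>j\<in>{..<n}. x j \<omega>) \<in> measurable M (PiM {..<n} (\<lambda>_. borel))"
  by (rule measurable_restrict) auto

lemma x_past: "j < n \<Longrightarrow> x j \<in> borel_measurable (past n)"
proof -
  assume j: "j < n"
  have "(\<lambda>\<omega>. \<lambda>j\<in>{..<n}. x j \<omega>) \<in> measurable (past n) (PiM {..<n} (\<lambda>_. borel))"
    unfolding past_def
    by (rule measurable_vimage_algebra1) (auto simp: space_PiM)
  then have "(\<lambda>\<omega>. (\<lambda>j\<in>{..<n}. x j \<omega>) j) \<in> borel_measurable (past n)"
    by (rule measurable_compose) (use j in \<open>auto intro!: measurable_component_singleton\<close>)
  then show ?thesis using j by (simp cong: measurable_cong)
qed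

lemma past_vimage:
  assumes f: "f \<in> borel_measurable (past n)" and S: "S \<in> sets borel"
  shows "\<exists>B\<in>sets (PiM {..<n} (\<lambda>_. borel :: real measure)). f -` S \<inter> space M = (\<lambda>\<omega>. \<lambda>j\<in>{..<n}. x j \<omega>) -` B \<inter> space M"
proof -
  have "f -` S \<inter> space (past n) \<in> sets (past n)" using f S by (rule measurable_sets)
  then show ?thesis
    unfolding past_def by (subst (asm) sets_vimage_algebra2) (auto simp: space_PiM)
qed

lemma past_meas: "f \<in> borel_measurable (past n) \<Longrightarrow> f \<in> borel_measurable M" for f :: "'a \<Rightarrow> real"
proof (rule measurableI)
  fix S :: "real set" assume f: "f \<in> borel_measurable (past n)" and S: "S \<in> sets borel"
  from past_vimage[OF f S] obtain B where "B \<in> sets (PiM {..<n} (\<lambda>_. borel :: real measure))"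
    "f -` S \<inter> space M = (\<lambda>\<omega>. \<lambda>j\<in>{..<n}. x j \<omega>) -` B \<inter> space M" by blast
  then show "f -` S \<inter> space M \<in> sets M" using measurable_sets[OF restrict_meas] by simp
qed auto

lemma past_indep:
  fixes f h :: "_ \<Rightarrow> real"
  assumes f: "f \<in> borel_measurable (past n)" and h [measurable]: "h \<in> borel_measurable borel"
  shows "indep_var borel f borel (\<lambda>\<omega>. h (x n \<omega>))"
proof -
  let ?T = "\<lambda>\<omega>. \<lambda>j\<in>{..<n}. x j \<omega>"
  have "indep_var (PiM {..<n} (\<lambda>_. borel)) ?T (PiM {n} (\<lambda>_. borel)) (\<lambda>\<omega>. \<lambda>j\<in>{n}. x j \<omega>)"
    by (rule indep_var_restrict[OF indep]) auto
  then have *: "indep_set (sigma_sets (space M) {?T -` A \<inter> space M | A. A \<in> sets (PiM {..<n} (\<lambda>_. borel :: real measure))})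
      (sigma_sets (space M) {(\<lambda>\<omega>. \<lambda>j\<in>{n}. x j \<omega>) -` A \<inter> space M | A. A \<in> sets (PiM {n} (\<lambda>_. borel :: real measure))})"
    by (simp add: indep_var_eq)
  have "indep_set (sigma_sets (space M) {f -` A \<inter> space M | A. A \<in> sets borel})
      (sigma_sets (space M) {(\<lambda>\<omega>. h (x n \<omega>)) -` A \<inter> space M | A. A \<in> sets borel})"
    unfolding indep_set_def
  proof (rule indep_sets_mono_sets[OF *[unfolded indep_set_def]])
    fix i :: bool
    have "{f -` A \<inter> space M | A. A \<in> sets borel} \<subseteq> {?T -` A \<inter> space M | A. A \<in> sets (PiM {..<n} (\<lambda>_. borel :: real measure))}"
      using past_vimage[OF f] by blast
    moreover have "{(\<lambda>\<omega>. h (x n \<omega>)) -` A \<inter> space M | A. A \<in> sets borel} \<subseteq> {(\<lambda>\<omega>. \<lambda>j\<in>{n}. x j \<omega>) -` A \<inter> space M | A. A \<in> sets (PiM {n} (\<lambda>_. borel :: real measure))}"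
    proof safe
      fix A :: "real set" assume A: "A \<in> sets borel"
      have "(\<lambda>y. h (y n)) \<in> measurable (PiM {n} (\<lambda>_. borel)) borel" by measurable
      then have B: "(\<lambda>y. h (y n)) -` A \<inter> space (PiM {n} (\<lambda>_. borel)) \<in> sets (PiM {n} (\<lambda>_. borel :: real measure))"
        using A by (rule measurable_sets)
      have "(\<lambda>\<omega>. h (x n \<omega>)) -` A \<inter> space M = (\<lambda>\<omega>. \<lambda>j\<in>{n}. x j \<omega>) -` ((\<lambda>y. h (y n)) -` A \<inter> space (PiM {n} (\<lambda>_. borel))) \<inter> space M"
        by (auto simp: space_PiM)
      then show "\<exists>Aa. (\<lambda>\<omega>. h (x n \<omega>)) -` A \<inter> space M = (\<lambda>\<omega>. \<lambda>j\<in>{n}. x j \<omega>) -` Aa \<inter> space M \<and> Aa \<in> sets (PiM {n} (\<lambda>_. borel :: real measure))"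
        using B by blast
    qed
    ultimately show "case_bool (sigma_sets (space M) {f -` A \<inter> space M | A. A \<in> sets borel}) (sigma_sets (space M) {(\<lambda>\<omega>. h (x n \<omega>)) -` A \<inter> space M | A. A \<in> sets borel}) i
      \<subseteq> case_bool (sigma_sets (space M) {?T -` A \<inter> space M | A. A \<in> sets (PiM {..<n} (\<lambda>_. borel :: real measure))}) (sigma_sets (space M) {(\<lambda>\<omega>. \<lambda>j\<in>{n}. x j \<omega>) -` A \<inter> space M | A. A \<in> sets (PiM {n} (\<lambda>_. borel :: real measure))}) i"
      by (auto split: bool.split intro: sigma_sets_mono'[THEN subsetD])
  qed
  then show ?thesis
    using past_meas[OF f] by (simp add: indep_var_eq)
qed

lemma integrable_x_iff: "h \<in> borel_measurable borel \<Longrightarrow> integrable M (\<lambda>\<omega>. h (x j \<omega>)) \<longleftrightarrow> integrable D h" for h :: "real \<Rightarrow> real"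
  by (subst law[of j, symmetric]) (simp add: integrable_distr_eq)

lemma integral_x: "h \<in> borel_measurable borel \<Longrightarrow> (\<integral>\<omega>. h (x j \<omega>) \<partial>M) = integral\<^sup>L D h" for h :: "real \<Rightarrow> real"
  by (subst law[of j, symmetric]) (simp add: integral_distr)

text \<open>The moment recursions below peel off the last variable of a row; independence enters
  them through this factorisation.\<close>

lemma past_prod:
  fixes f h :: "_ \<Rightarrow> real"
  assumes f: "f \<in> borel_measurable (past n)" "integrable M f"
    and h: "h \<in> borel_measurable borel" "integrable D h"
  shows "integrable M (\<lambda>\<omega>. f \<omega> * h (x n \<omega>))" "(\<integral>\<omega>. f \<omega> * h (x n \<omega>) \<partial>M) = (\<integral>\<omega>. f \<omega> \<partial>M) * integral\<^sup>L D h"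
proof -
  have hi: "integrable M (\<lambda>\<omega>. h (x n \<omega>))" using h by (simp add: integrable_x_iff)
  show "integrable M (\<lambda>\<omega>. f \<omega> * h (x n \<omega>))"
    by (rule indep_var_integrable[OF past_indep[OF f(1) h(1)] f(2) hi])
  show "(\<integral>\<omega>. f \<omega> * h (x n \<omega>) \<partial>M) = (\<integral>\<omega>. f \<omega> \<partial>M) * integral\<^sup>L D h"
    using indep_var_lebesgue_integral[OF past_indep[OF f(1) h(1)] f(2) hi] integral_x[OF h(1)] by simp
qed

end

context prob_space
begin

lemma integrable_power2_of_power4:
  fixes f :: "'a \<Rightarrow> real"
  assumes [measurable]: "f \<in> borel_measurable M" and "integrable M (\<lambda>x. f x ^ 4)"
  shows "integrable M (\<lambda>x. (f x)\<^sup>2)"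
  by (rule Bochner_Integration.integrable_bound[where f="\<lambda>x. 1 + f x ^ 4"])
    (use assms in \<open>auto intro!: AE_I2 power2_le_one_plus_power4\<close>)

lemma integrable_of_power2:
  fixes f :: "'a \<Rightarrow> real"
  assumes [measurable]: "f \<in> borel_measurable M" and "integrable M (\<lambda>x. (f x)\<^sup>2)"
  shows "integrable M f"
  using integrable_prod_of_squares[of f M "\<lambda>_. 1"] assms by simp

lemma integrable_power3_of_power4:
  fixes f :: "'a \<Rightarrow> real"
  assumes [measurable]: "f \<in> borel_measurable M" and 4: "integrable M (\<lambda>x. f x ^ 4)"
  shows "integrable M (\<lambda>x. f x ^ 3)"
proof -
  have "integrable M (\<lambda>x. f x * (f x)\<^sup>2)"
    using integrable_power2_of_power4[OF assms] 4
    by (intro integrable_prod_of_squares) (simp_all flip: power_mult)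
  then show ?thesis by (simp add: power3_eq_cube power2_eq_square mult.assoc)
qed

lemma integrable_power4_add:
  fixes f g :: "'a \<Rightarrow> real"
  assumes [measurable]: "f \<in> borel_measurable M" "g \<in> borel_measurable M"
    and "integrable M (\<lambda>x. f x ^ 4)" "integrable M (\<lambda>x. g x ^ 4)"
  shows "integrable M (\<lambda>x. (f x + g x) ^ 4)"
proof (rule Bochner_Integration.integrable_bound[where f="\<lambda>x. 8 * (f x ^ 4 + g x ^ 4)"])
  have "(a + b) ^ 4 \<le> 8 * (a ^ 4 + b ^ 4)" for a b :: real
  proof -
    have 2: "(u + v)\<^sup>2 \<le> 2 * (u\<^sup>2 + v\<^sup>2)" for u v :: real
      using zero_le_power2[of "u - v"] by (simp add: power2_eq_square algebra_simps)
    have "((a + b)\<^sup>2)\<^sup>2 \<le> (2 * (a\<^sup>2 + b\<^sup>2))\<^sup>2" by (intro power_mono 2) auto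
    also have "\<dots> = 4 * (a\<^sup>2 + b\<^sup>2)\<^sup>2" by (simp only: power_mult_distrib) simp
    also have "\<dots> \<le> 4 * (2 * ((a\<^sup>2)\<^sup>2 + (b\<^sup>2)\<^sup>2))" by (intro mult_left_mono 2) auto
    finally show ?thesis by (simp flip: power_mult)
  qed
  then show "AE x in M. norm ((f x + g x) ^ 4) \<le> norm (8 * (f x ^ 4 + g x ^ 4))"
    by (auto intro!: AE_I2)
qed (use assms in auto)

lemma power2_integral_le:
  fixes f :: "'a \<Rightarrow> real"
  assumes [measurable]: "f \<in> borel_measurable M" and "integrable M (\<lambda>x. (f x)\<^sup>2)"
  shows "(expectation f)\<^sup>2 \<le> expectation (\<lambda>x. (f x)\<^sup>2)"
  using integral_Cauchy_Schwarz[of f M "\<lambda>_. 1"] assms by (simp add: prob_space)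

end

section \<open>Fourth moments of linear forms and of off-diagonal quadratic forms\<close>

context iid_seq
begin

definition lin :: "(real \<Rightarrow> real) \<Rightarrow> (nat \<Rightarrow> real) \<Rightarrow> nat \<Rightarrow> 'a \<Rightarrow> real" where
  "lin h a n \<omega> = (\<Sum>i<n. a i * h (x i \<omega>))"

lemma lin_past: 
  assumes [measurable]: "h \<in> borel_measurable borel" shows "n \<le> k \<Longrightarrow> lin h a n \<in> borel_measurable (past k)"
  unfolding lin_def by (intro borel_measurable_sum borel_measurable_times measurable_compose[OF x_past assms] borel_measurable_const) auto

lemma lin_meas [measurable]: "h \<in> borel_measurable borel \<Longrightarrow> lin h a n \<in> borel_measurable M"
  by (rule past_meas[OF lin_past]) auto

text \<open>Induction on n. Of the cross terms in the fourth power, the one with \<open>h\<close>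
  vanishes because h has mean 0, and the one with \<open>h ^ 3\<close> because the partial sum has
  mean 0. The factor 3 makes the remaining cross term, at most 6 B S a^2, exactly the mixed term of
  3 B (S + a^2)^2.\<close>

lemma lin_moments:
  assumes h [measurable]: "h \<in> borel_measurable borel"
    and h4: "integrable D (\<lambda>x. h x ^ 4)" and h0: "(\<integral>x. h x \<partial>D) = 0"
  shows "integrable M (\<lambda>\<omega>. lin h a n \<omega> ^ 4)"
    "expectation (lin h a n) = 0"
    "expectation (\<lambda>\<omega>. (lin h a n \<omega>)\<^sup>2) = (\<integral>x. (h x)\<^sup>2 \<partial>D) * (\<Sum>i<n. (a i)\<^sup>2)"
    "expectation (\<lambda>\<omega>. lin h a n \<omega> ^ 4) \<le> 3 * (\<integral>x. h x ^ 4 \<partial>D) * (\<Sum>i<n. (a i)\<^sup>2)\<^sup>2"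
proof -
  let ?L = "\<lambda>n. lin h a n"
  let ?s = "(\<integral>x. (h x)\<^sup>2 \<partial>D)" and ?B = "(\<integral>x. h x ^ 4 \<partial>D)"
  have hD [measurable]: "h \<in> borel_measurable D" by simp
  have h2: "integrable D (\<lambda>x. (h x)\<^sup>2)" using D.integrable_power2_of_power4[OF hD h4] .
  have h1: "integrable D h" using D.integrable_of_power2[OF hD h2] .
  have h3: "integrable D (\<lambda>x. h x ^ 3)" using D.integrable_power3_of_power4[OF hD h4] .
  have sB: "?s\<^sup>2 \<le> ?B"
    using D.power2_integral_le[of "\<lambda>x. (h x)\<^sup>2"] h4 by (simp flip: power_mult)
  have L [measurable]: "?L n \<in> borel_measurable M" for n by simp
  have P: "?L n \<in> borel_measurable (past n)" for n by (rule lin_past[OF h]) simp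
  have "integrable M (\<lambda>\<omega>. ?L n \<omega> ^ 4) \<and> expectation (?L n) = 0
    \<and> expectation (\<lambda>\<omega>. (?L n \<omega>)\<^sup>2) = ?s * (\<Sum>i<n. (a i)\<^sup>2)
    \<and> expectation (\<lambda>\<omega>. ?L n \<omega> ^ 4) \<le> 3 * ?B * (\<Sum>i<n. (a i)\<^sup>2)\<^sup>2"
  proof (induction n)
    case 0 show ?case by (simp add: lin_def)
  next
    case (Suc n)
    let ?S = "\<Sum>i<n. (a i)\<^sup>2"
    have IH: "integrable M (\<lambda>\<omega>. ?L n \<omega> ^ 4)" "expectation (?L n) = 0"
      "expectation (\<lambda>\<omega>. (?L n \<omega>)\<^sup>2) = ?s * ?S" "expectation (\<lambda>\<omega>. ?L n \<omega> ^ 4) \<le> 3 * ?B * ?S\<^sup>2"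
      using Suc by auto
    have e: "lin h a (Suc n) = (\<lambda>\<omega>. lin h a n \<omega> + a n * h (x n \<omega>))" by (auto simp: lin_def fun_eq_iff)
    have i2: "integrable M (\<lambda>\<omega>. (?L n \<omega>)\<^sup>2)" by (rule integrable_power2_of_power4[OF L IH(1)])
    have i1: "integrable M (?L n)" by (rule integrable_of_power2[OF L i2])
    have i3: "integrable M (\<lambda>\<omega>. ?L n \<omega> ^ 3)" by (rule integrable_power3_of_power4[OF L IH(1)])
    have P2: "(\<lambda>\<omega>. (?L n \<omega>)\<^sup>2) \<in> borel_measurable (past n)" "(\<lambda>\<omega>. (?L n \<omega>)^3) \<in> borel_measurable (past n)" using P[of n] by measurable
    have hh: "integrable M (\<lambda>\<omega>. h (x n \<omega>))" "integrable M (\<lambda>\<omega>. (h (x n \<omega>))\<^sup>2)" "integrable M (\<lambda>\<omega>. (h (x n \<omega>)) ^ 4)"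
      using h1 h2 h4 by (auto simp: integrable_x_iff integrable_x_iff[of "\<lambda>y. (h y)\<^sup>2"] integrable_x_iff[of "\<lambda>y. (h y)^4"])
    have ex: "expectation (\<lambda>\<omega>. h (x n \<omega>)) = 0" "expectation (\<lambda>\<omega>. (h (x n \<omega>))\<^sup>2) = ?s" "expectation (\<lambda>\<omega>. (h (x n \<omega>)) ^ 4) = ?B"
      using h0 by (auto simp: integral_x integral_x[of "\<lambda>y. (h y)\<^sup>2"] integral_x[of "\<lambda>y. (h y)^4"])
    note p11 = past_prod[OF P[of n] i1 h h1]
    have h2m: "(\<lambda>x. (h x)\<^sup>2) \<in> borel_measurable borel" "(\<lambda>x. h x ^ 3) \<in> borel_measurable borel" by measurable
    note p13 = past_prod[OF P[of n] i1 h2m(2) h3]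
    note p22 = past_prod[OF P2(1) i2 h2m(1) h2]
    note p31 = past_prod[OF P2(2) i3 h h1]
    have "integrable M (\<lambda>\<omega>. (a n * h (x n \<omega>)) ^ 4)" using hh by (simp add: power_mult_distrib)
    then have A: "integrable M (\<lambda>\<omega>. ?L (Suc n) \<omega> ^ 4)"
      unfolding e using IH(1) by (intro integrable_power4_add) auto
    have B: "expectation (?L (Suc n)) = 0" unfolding e using i1 hh IH ex by simp
    have "expectation (\<lambda>\<omega>. (?L (Suc n) \<omega>)\<^sup>2) = expectation (\<lambda>\<omega>. (?L n \<omega>)\<^sup>2 + 2 * a n * (?L n \<omega> * h (x n \<omega>)) + (a n)\<^sup>2 * (h (x n \<omega>))\<^sup>2)"
      unfolding e by (intro Bochner_Integration.integral_cong refl) (simp add: power2_eq_square algebra_simps)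
    also have "\<dots> = ?s * ?S + (a n)\<^sup>2 * ?s" using i2 p11 hh IH ex h0 by simp
    finally have C: "expectation (\<lambda>\<omega>. (?L (Suc n) \<omega>)\<^sup>2) = ?s * (\<Sum>i<Suc n. (a i)\<^sup>2)" by (simp add: algebra_simps)
    have "expectation (\<lambda>\<omega>. ?L (Suc n) \<omega> ^ 4) = expectation (\<lambda>\<omega>. ?L n \<omega> ^ 4 + 4 * a n * (?L n \<omega> ^ 3 * h (x n \<omega>))
       + 6 * (a n)\<^sup>2 * ((?L n \<omega>)\<^sup>2 * (h (x n \<omega>))\<^sup>2) + 4 * (a n) ^ 3 * (?L n \<omega> * h (x n \<omega>) ^ 3) + (a n) ^ 4 * h (x n \<omega>) ^ 4)"
      unfolding e by (intro Bochner_Integration.integral_cong refl) (simp add: power2_eq_square power3_eq_cube power4_eq_xxxx algebra_simps)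
    also have "\<dots> = expectation (\<lambda>\<omega>. ?L n \<omega> ^ 4) + 6 * (a n)\<^sup>2 * (?s * ?S * ?s) + a n ^ 4 * ?B"
      using IH p11 p13 p22 p31 hh ex h0 by simp
    also have "\<dots> \<le> 3 * ?B * ?S\<^sup>2 + 6 * (a n)\<^sup>2 * (?B * ?S) + 3 * (a n ^ 4 * ?B)"
    proof -
      have "?s * ?S * ?s \<le> ?B * ?S" using mult_right_mono[OF sB, of ?S] by (simp add: power2_eq_square ac_simps sum_nonneg)
      then have "6 * (a n)\<^sup>2 * (?s * ?S * ?s) \<le> 6 * (a n)\<^sup>2 * (?B * ?S)" by (intro mult_left_mono) auto
      moreover have "0 \<le> a n ^ 4 * ?B" by simp
      ultimately show ?thesis using IH(4) by linarith
    qed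
    also have "\<dots> = 3 * ?B * (\<Sum>i<Suc n. (a i)\<^sup>2)\<^sup>2" by (simp add: power2_eq_square power4_eq_xxxx algebra_simps)
    finally show ?case using A B C by blast
  qed
  then show "integrable M (\<lambda>\<omega>. lin h a n \<omega> ^ 4)"
    "expectation (lin h a n) = 0"
    "expectation (\<lambda>\<omega>. (lin h a n \<omega>)\<^sup>2) = (\<integral>x. (h x)\<^sup>2 \<partial>D) * (\<Sum>i<n. (a i)\<^sup>2)"
    "expectation (\<lambda>\<omega>. lin h a n \<omega> ^ 4) \<le> 3 * (\<integral>x. h x ^ 4 \<partial>D) * (\<Sum>i<n. (a i)\<^sup>2)\<^sup>2"
    by auto
qed

abbreviation "lf \<equiv> lin (\<lambda>y. y)"

lemma lf_moments:
  "integrable M (\<lambda>\<omega>. lf a n \<omega> ^ 4)" "integrable M (\<lambda>\<omega>. (lf a n \<omega>)\<^sup>2)" "integrable M (lf a n)"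
  "expectation (lf a n) = 0" "expectation (\<lambda>\<omega>. (lf a n \<omega>)\<^sup>2) = (\<Sum>i<n. (a i)\<^sup>2)"
  "expectation (\<lambda>\<omega>. lf a n \<omega> ^ 4) \<le> 3 * kurt * (\<Sum>i<n. (a i)\<^sup>2)\<^sup>2"
proof -
  note * = lin_moments[of "\<lambda>y. y" a n, OF _ int4 mean]
  show 4: "integrable M (\<lambda>\<omega>. lf a n \<omega> ^ 4)" using * by simp
  show 2: "integrable M (\<lambda>\<omega>. (lf a n \<omega>)\<^sup>2)" by (rule integrable_power2_of_power4[OF _ 4]) simp
  show "integrable M (lf a n)" by (rule integrable_of_power2[OF _ 2]) simp
  show "expectation (lf a n) = 0" "expectation (\<lambda>\<omega>. (lf a n \<omega>)\<^sup>2) = (\<Sum>i<n. (a i)\<^sup>2)"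
    "expectation (\<lambda>\<omega>. lf a n \<omega> ^ 4) \<le> 3 * kurt * (\<Sum>i<n. (a i)\<^sup>2)\<^sup>2"
    using * by (simp_all add: var kurt_def)
qed

text \<open>Polarisation of the variance formula.\<close>

lemma lf_cov:
  "integrable M (\<lambda>\<omega>. lf a n \<omega> * lf b n \<omega>)" "expectation (\<lambda>\<omega>. lf a n \<omega> * lf b n \<omega>) = (\<Sum>i<n. a i * b i)"
proof -
  have e: "lf a n \<omega> * lf b n \<omega> = ((lf (\<lambda>i. a i + b i) n \<omega>)\<^sup>2 - (lf (\<lambda>i. a i - b i) n \<omega>)\<^sup>2) / 4" for \<omega>
  proof -
    have "lf (\<lambda>i. a i + b i) n \<omega> = lf a n \<omega> + lf b n \<omega>" "lf (\<lambda>i. a i - b i) n \<omega> = lf a n \<omega> - lf b n \<omega>"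
      by (simp_all add: lin_def algebra_simps sum.distrib sum_subtractf)
    then show ?thesis by (simp only:) (simp add: power2_eq_square algebra_simps)
  qed
  show "integrable M (\<lambda>\<omega>. lf a n \<omega> * lf b n \<omega>)" unfolding e by (intro integrable_divide Bochner_Integration.integrable_diff lf_moments)
  have "expectation (\<lambda>\<omega>. lf a n \<omega> * lf b n \<omega>) = ((\<Sum>i<n. (a i + b i)\<^sup>2) - (\<Sum>i<n. (a i - b i)\<^sup>2)) / 4"
    unfolding e by (simp add: lf_moments)
  also have "\<dots> = (\<Sum>i<n. a i * b i)"
    by (simp add: sum_subtractf[symmetric] sum_divide_distrib) (simp add: power2_eq_square algebra_simps)
  finally show "expectation (\<lambda>\<omega>. lf a n \<omega> * lf b n \<omega>) = (\<Sum>i<n. a i * b i)" .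
qed

text \<open>The strictly lower triangular part of a quadratic form, grouped by the larger index, so
  that each summand is one new variable times a linear form in the past.\<close>

definition chaos :: "(nat \<Rightarrow> nat \<Rightarrow> real) \<Rightarrow> nat \<Rightarrow> 'a \<Rightarrow> real" where
  "chaos A n \<omega> = (\<Sum>i<n. x i \<omega> * lf (A i) i \<omega>)"

lemma chaos_past: "n \<le> k \<Longrightarrow> chaos A n \<in> borel_measurable (past k)"
  unfolding chaos_def by (intro borel_measurable_sum borel_measurable_times lin_past x_past) auto

lemma chaos_meas [measurable]: "chaos A n \<in> borel_measurable M"
  by (rule past_meas[OF chaos_past]) auto

lemma power4_add_mult:
  "(p + l * y) ^ 4 = p ^ 4 + 4 * ((p\<^sup>2 * (p * l)) * y) + 6 * ((p\<^sup>2 * l\<^sup>2) * y\<^sup>2) + 4 * (((p * l) * l\<^sup>2) * y ^ 3) + l ^ 4 * y ^ 4"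
  for p l y :: real
  by (simp add: power2_eq_square power3_eq_cube power4_eq_xxxx algebra_simps)

text \<open>Adding one variable increases the square root of the fourth moment by at most a constant multiple
  of the variance it contributes, which gives a bound independent of the number of variables.\<close>

lemma chaos_power4:
  "integrable M (\<lambda>\<omega>. chaos A n \<omega> ^ 4)"
  "expectation (\<lambda>\<omega>. chaos A n \<omega> ^ 4) \<le> (24 * kurt\<^sup>2 * (\<Sum>i<n. \<Sum>j<i. (A i j)\<^sup>2))\<^sup>2"
proof -
  let ?c = "24 * kurt\<^sup>2"
  have "integrable M (\<lambda>\<omega>. chaos A n \<omega> ^ 4) \<and> 
    expectation (\<lambda>\<omega>. chaos A n \<omega> ^ 4) \<le> (?c * (\<Sum>i<n. \<Sum>j<i. (A i j)\<^sup>2))\<^sup>2"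
  proof (induction n)
    case 0 show ?case by (simp add: chaos_def)
  next
    case (Suc n)
    let ?O = "chaos A n" and ?l = "lf (A n) n" and ?S = "\<Sum>i<n. \<Sum>j<i. (A i j)\<^sup>2" and ?b = "\<Sum>j<n. (A n j)\<^sup>2"
    have e: "chaos A (Suc n) = (\<lambda>\<omega>. ?O \<omega> + ?l \<omega> * x n \<omega>)" by (auto simp: chaos_def fun_eq_iff ac_simps)
    have i4: "integrable M (\<lambda>\<omega>. ?O \<omega> ^ 4)" and IH: "expectation (\<lambda>\<omega>. ?O \<omega> ^ 4) \<le> (?c * ?S)\<^sup>2" using Suc by auto
    have i2: "integrable M (\<lambda>\<omega>. (?O \<omega>)\<^sup>2)" by (rule integrable_power2_of_power4[OF _ i4]) simp
    have i1: "integrable M ?O" by (rule integrable_of_power2[OF _ i2]) simp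
    have i22: "integrable M (\<lambda>\<omega>. (?O \<omega>)\<^sup>2 * (?l \<omega>)\<^sup>2)"
      using i4 lf_moments(1)[of "A n" n] by (intro integrable_prod_of_squares) (auto simp flip: power_mult)
    then have sq: "integrable M (\<lambda>\<omega>. (?O \<omega> * ?l \<omega>)\<^sup>2)" by (simp add: power_mult_distrib)
    have i13: "integrable M (\<lambda>\<omega>. (?O \<omega> * ?l \<omega>) * (?l \<omega>)\<^sup>2)"
      using sq lf_moments(1)[of "A n" n] by (intro integrable_prod_of_squares) (auto simp flip: power_mult)
    have i31: "integrable M (\<lambda>\<omega>. (?O \<omega>)\<^sup>2 * (?O \<omega> * ?l \<omega>))"
      using sq i4 by (intro integrable_prod_of_squares) (auto simp flip: power_mult)
    have mO [measurable]: "?O \<in> borel_measurable (past n)" by (rule chaos_past) simp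
    have ml [measurable]: "?l \<in> borel_measurable (past n)" by (rule lin_past) auto
    have id: "(\<lambda>y. y) \<in> borel_measurable (borel :: real measure)" "(\<lambda>y. y\<^sup>2) \<in> borel_measurable (borel :: real measure)" 
       "(\<lambda>y. y^3) \<in> borel_measurable (borel :: real measure)" "(\<lambda>y. y^4) \<in> borel_measurable (borel :: real measure)" by measurable
    note p31 = past_prod[OF _ i31 id(1) integrable_D(1)]
    note p22 = past_prod[OF _ i22 id(2) integrable_D(2)]
    note p13 = past_prod[OF _ i13 id(3) integrable_D(3)]
    note p04 = past_prod[OF _ lf_moments(1)[of "A n" n] id(4) integrable_D(4)]
    have A1: "integrable M (\<lambda>\<omega>. chaos A (Suc n) \<omega> ^ 4)"
      unfolding e using i4 p04 by (intro integrable_power4_add) (auto simp: power_mult_distrib)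
    let ?X = "expectation (\<lambda>\<omega>. (?O \<omega>)\<^sup>2 * (?l \<omega>)\<^sup>2)" and ?Y = "expectation (\<lambda>\<omega>. (?O \<omega> * ?l \<omega>) * (?l \<omega>)\<^sup>2)" and ?Z = "expectation (\<lambda>\<omega>. ?l \<omega> ^ 4)"
    have "expectation (\<lambda>\<omega>. chaos A (Suc n) \<omega> ^ 4) = expectation (\<lambda>\<omega>. ?O \<omega> ^ 4 + 4 * (((?O \<omega>)\<^sup>2 * (?O \<omega> * ?l \<omega>)) * x n \<omega>)
       + 6 * (((?O \<omega>)\<^sup>2 * (?l \<omega>)\<^sup>2) * (x n \<omega>)\<^sup>2) + 4 * (((?O \<omega> * ?l \<omega>) * (?l \<omega>)\<^sup>2) * x n \<omega> ^ 3) + ?l \<omega> ^ 4 * x n \<omega> ^ 4)"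
      unfolding e by (intro Bochner_Integration.integral_cong refl power4_add_mult)
    also have "\<dots> = expectation (\<lambda>\<omega>. ?O \<omega> ^ 4) + 6 * ?X + 4 * (?Y * (\<integral>x. x ^ 3 \<partial>D)) + ?Z * kurt"
      using i4 p31 p22 p13 p04 by (simp add: var mean kurt_def)
    also have "\<dots> \<le> (?c * ?S)\<^sup>2 + (6 + 2 * kurt) * ?X + 3 * kurt * ?Z"
    proof -
      \<comment> \<open>The term with the third moment of the law has no definite sign; the
        inequality 2|ab| <= a^2 + b^2 distributes it over \<open>?X\<close> and
        \<open>?Z\<close>.\<close>
      have "\<bar>?Y\<bar> \<le> expectation (\<lambda>\<omega>. \<bar>(?O \<omega> * ?l \<omega>) * (?l \<omega>)\<^sup>2\<bar>)" by (rule integral_abs_bound)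
      also have "\<dots> \<le> expectation (\<lambda>\<omega>. ((?O \<omega>)\<^sup>2 * (?l \<omega>)\<^sup>2 + ?l \<omega> ^ 4) / 2)"
      proof (rule integral_mono)
        fix \<omega>
        show "\<bar>(?O \<omega> * ?l \<omega>) * (?l \<omega>)\<^sup>2\<bar> \<le> ((?O \<omega>)\<^sup>2 * (?l \<omega>)\<^sup>2 + ?l \<omega> ^ 4) / 2"
          using two_abs_prod_le[of "?O \<omega> * ?l \<omega>" "(?l \<omega>)\<^sup>2"] by (simp add: power_mult_distrib flip: power_mult)
      qed (use i13 i22 lf_moments(1)[of "A n" n] in auto)
      also have "\<dots> = (?X + ?Z) / 2" using i22 lf_moments(1)[of "A n" n] by simp
      finally have "\<bar>?Y\<bar> * \<bar>\<integral>x. x ^ 3 \<partial>D\<bar> \<le> (?X + ?Z) / 2 * kurt"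
        using third_moment_le by (intro mult_mono) auto
      then have "4 * (?Y * (\<integral>x. x ^ 3 \<partial>D)) \<le> 2 * kurt * ?X + 2 * kurt * ?Z"
        by (simp add: abs_mult[symmetric] field_simps)
      then show ?thesis using IH by (simp add: algebra_simps)
    qed
    also have "\<dots> \<le> (?c * ?S)\<^sup>2 + (6 + 2 * kurt) * (?c * ?S * (3 * kurt * ?b)) + 3 * kurt * (3 * kurt * ?b\<^sup>2)"
    proof -
      have k: "0 < kurt" "1 \<le> kurt" using kurt_ge_1 by auto
      have "?X\<^sup>2 \<le> expectation (\<lambda>\<omega>. ((?O \<omega>)\<^sup>2)\<^sup>2) * expectation (\<lambda>\<omega>. ((?l \<omega>)\<^sup>2)\<^sup>2)"
        by (rule integral_Cauchy_Schwarz) (use i4 lf_moments(1)[of "A n" n] in \<open>auto simp flip: power_mult\<close>)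
      also have "\<dots> \<le> (?c * ?S)\<^sup>2 * (3 * kurt * ?b\<^sup>2)"
        using IH lf_moments(6)[of "A n" n] by (intro mult_mono) (auto simp flip: power_mult)
      also have "\<dots> \<le> (?c * ?S)\<^sup>2 * (3 * kurt * ?b)\<^sup>2"
      proof -
        have "3 * kurt \<le> (3 * kurt)\<^sup>2" using k by (simp add: power2_eq_square)
        then show ?thesis unfolding power_mult_distrib[of "3 * kurt"] by (intro mult_left_mono mult_right_mono) auto
      qed
      finally have "?X\<^sup>2 \<le> (?c * ?S * (3 * kurt * ?b))\<^sup>2" by (simp only: power_mult_distrib)
      then have X: "?X \<le> ?c * ?S * (3 * kurt * ?b)"
        by (rule power2_le_imp_le) (use k in \<open>auto intro!: mult_nonneg_nonneg sum_nonneg\<close>)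
      show ?thesis using k lf_moments(6)[of "A n" n] X by (intro add_mono mult_left_mono) auto
    qed
    \<comment> \<open>The constant is chosen to complete the square: with \<open>kurt\<close> at
      least 1, (6 + 2 kurt) * 3 kurt is at most 24 kurt^2, within 2 \<open>?c\<close>, and 9 kurt^2
      is at most \<open>?c\<close> squared.\<close>
    also have "\<dots> \<le> (?c * ?S)\<^sup>2 + 2 * ?c * (?c * ?S * ?b) + ?c\<^sup>2 * ?b\<^sup>2"
    proof -
      have k: "1 \<le> kurt" using kurt_ge_1 by auto
      have k2: "1 \<le> kurt\<^sup>2" using k by (rule one_le_power)
      have k3: "kurt \<le> kurt\<^sup>2" "kurt\<^sup>2 \<le> kurt\<^sup>2 * kurt\<^sup>2"
        using mult_left_mono[OF k, of kurt] mult_left_mono[OF k2, of "kurt\<^sup>2"] k by (simp_all add: power2_eq_square[of kurt])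
      have "(6 + 2 * kurt) * (3 * kurt) = 18 * kurt + 6 * kurt\<^sup>2" by (simp add: power2_eq_square algebra_simps)
      then have "(6 + 2 * kurt) * (3 * kurt) \<le> 2 * ?c" using k2 k3 by linarith
      then have "((6 + 2 * kurt) * (3 * kurt)) * (?c * ?S * ?b) \<le> 2 * ?c * (?c * ?S * ?b)"
        by (rule mult_right_mono) (auto intro!: mult_nonneg_nonneg sum_nonneg)
      moreover have "(9 * kurt\<^sup>2) * ?b\<^sup>2 \<le> ?c\<^sup>2 * ?b\<^sup>2"
      proof (rule mult_right_mono)
        have "?c\<^sup>2 = 576 * (kurt\<^sup>2 * kurt\<^sup>2)" by (simp add: power2_eq_square)
        then show "9 * kurt\<^sup>2 \<le> ?c\<^sup>2" using k2 k3(2) by linarith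
      qed simp
      moreover have "(6 + 2 * kurt) * (c * S * (3 * kurt * b)) = ((6 + 2 * kurt) * (3 * kurt)) * (c * S * b)"
        "3 * kurt * (3 * kurt * b\<^sup>2) = (9 * kurt\<^sup>2) * b\<^sup>2" for c S b :: real
        by (simp_all add: power2_eq_square[of kurt])
      ultimately show ?thesis by (simp only: add_mono order_refl)
    qed
    also have "\<dots> = (?c * (\<Sum>i<Suc n. \<Sum>j<i. (A i j)\<^sup>2))\<^sup>2"
    proof -
      have "(c * S)\<^sup>2 + 2 * c * (c * S * b) + c\<^sup>2 * b\<^sup>2 = (c * (S + b))\<^sup>2" for c S b :: real
        by (simp add: power2_eq_square algebra_simps)
      then show ?thesis by (simp only: sum.lessThan_Suc)
    qed
    finally show ?case using A1 by blast
  qed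
  then show "integrable M (\<lambda>\<omega>. chaos A n \<omega> ^ 4)"
    "expectation (\<lambda>\<omega>. chaos A n \<omega> ^ 4) \<le> (24 * kurt\<^sup>2 * (\<Sum>i<n. \<Sum>j<i. (A i j)\<^sup>2))\<^sup>2" by auto
qed

end

lemma sum_symmetric_split:
  fixes F :: "nat \<Rightarrow> nat \<Rightarrow> real"
  assumes "\<And>i j. i < n \<Longrightarrow> j < n \<Longrightarrow> F i j = F j i"
  shows "(\<Sum>i<n. \<Sum>j<n. F i j) = (\<Sum>i<n. F i i) + 2 * (\<Sum>i<n. \<Sum>j<i. F i j)"
  using assms
proof (induction n)
  case (Suc n)
  have "(\<Sum>i<n. F i n) = (\<Sum>i<n. F n i)" using Suc.prems by (intro sum.cong) auto
  moreover have "(\<Sum>i<n. \<Sum>j<n. F i j) = (\<Sum>i<n. F i i) + 2 * (\<Sum>i<n. \<Sum>j<i. F i j)"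
    using Suc by simp
  ultimately show ?case by (simp add: sum.distrib)
qed simp

lemma power2_add_le: "(a + b)\<^sup>2 \<le> 2 * a\<^sup>2 + 2 * b\<^sup>2" for a b :: real
  using zero_le_power2[of "a - b"] by (simp add: power2_eq_square algebra_simps)

section \<open>Centred quadratic forms and their covariances\<close>

context iid_seq
begin

text \<open>The second-moment version is meant for h quadratic in the entry, where the fourth moment
  of the entry controls only the square of h.\<close>

lemma lin_moments2:
  assumes h [measurable]: "h \<in> borel_measurable borel"
    and h2: "integrable D (\<lambda>x. (h x)\<^sup>2)" and h0: "(\<integral>x. h x \<partial>D) = 0"
  shows "integrable M (\<lambda>\<omega>. (lin h a n \<omega>)\<^sup>2)"
    "expectation (\<lambda>\<omega>. (lin h a n \<omega>)\<^sup>2) = (\<integral>x. (h x)\<^sup>2 \<partial>D) * (\<Sum>i<n. (a i)\<^sup>2)"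
proof -
  let ?L = "\<lambda>n. lin h a n"
  let ?s = "(\<integral>x. (h x)\<^sup>2 \<partial>D)"
  have hD [measurable]: "h \<in> borel_measurable D" by simp
  have h1: "integrable D h" using D.integrable_of_power2[OF hD h2] .
  have L [measurable]: "?L n \<in> borel_measurable M" for n by simp
  have P: "?L n \<in> borel_measurable (past n)" for n by (rule lin_past[OF h]) simp
  have "integrable M (\<lambda>\<omega>. (?L n \<omega>)\<^sup>2) \<and> expectation (\<lambda>\<omega>. (?L n \<omega>)\<^sup>2) = ?s * (\<Sum>i<n. (a i)\<^sup>2)"
  proof (induction n)
    case 0 show ?case by (simp add: lin_def)
  next
    case (Suc n)
    have i2: "integrable M (\<lambda>\<omega>. (?L n \<omega>)\<^sup>2)" and IH: "expectation (\<lambda>\<omega>. (?L n \<omega>)\<^sup>2) = ?s * (\<Sum>i<n. (a i)\<^sup>2)" using Suc by auto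
    have i1: "integrable M (?L n)" by (rule integrable_of_power2[OF L i2])
    have hh: "integrable M (\<lambda>\<omega>. (h (x n \<omega>))\<^sup>2)" "expectation (\<lambda>\<omega>. (h (x n \<omega>))\<^sup>2) = ?s"
      using h2 by (auto simp: integrable_x_iff[of "\<lambda>y. (h y)\<^sup>2"] integral_x[of "\<lambda>y. (h y)\<^sup>2"])
    note p11 = past_prod[OF P[of n] i1 h h1]
    have e: "(?L (Suc n) \<omega>)\<^sup>2 = (?L n \<omega>)\<^sup>2 + 2 * a n * (?L n \<omega> * h (x n \<omega>)) + (a n)\<^sup>2 * (h (x n \<omega>))\<^sup>2" for \<omega>
      by (simp add: lin_def power2_eq_square algebra_simps)
    show ?case unfolding e using i2 p11 hh IH h0 by (simp add: algebra_simps)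
  qed
  then show "integrable M (\<lambda>\<omega>. (lin h a n \<omega>)\<^sup>2)"
    "expectation (\<lambda>\<omega>. (lin h a n \<omega>)\<^sup>2) = (\<integral>x. (h x)\<^sup>2 \<partial>D) * (\<Sum>i<n. (a i)\<^sup>2)" by auto
qed

text \<open>For symmetric A this is x^T A x - tr A, see \<open>quad_eq\<close>. Diagonal and
  off-diagonal parts are kept apart because the former has only two moments, the latter
  four.\<close>

definition quad :: "(nat \<Rightarrow> nat \<Rightarrow> real) \<Rightarrow> nat \<Rightarrow> 'a \<Rightarrow> real" where
  "quad A n \<omega> = lin (\<lambda>y. y\<^sup>2 - 1) (\<lambda>i. A i i) n \<omega> + 2 * chaos A n \<omega>"

lemma quad_past: "n \<le> k \<Longrightarrow> quad A n \<in> borel_measurable (past k)"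
  unfolding quad_def by (intro borel_measurable_add borel_measurable_times lin_past chaos_past) auto

lemma quad_meas [measurable]: "quad A n \<in> borel_measurable M"
  by (rule past_meas[OF quad_past]) auto

lemma quad_eq:
  assumes "\<And>i j. i < n \<Longrightarrow> j < n \<Longrightarrow> A i j = A j i"
  shows "quad A n \<omega> = (\<Sum>i<n. \<Sum>j<n. A i j * x i \<omega> * x j \<omega>) - (\<Sum>i<n. A i i)"
proof -
  have "(\<Sum>i<n. \<Sum>j<n. A i j * x i \<omega> * x j \<omega>) = (\<Sum>i<n. A i i * x i \<omega> * x i \<omega>) + 2 * (\<Sum>i<n. \<Sum>j<i. A i j * x i \<omega> * x j \<omega>)"
    by (rule sum_symmetric_split) (simp add: assms)
  then show ?thesis
    by (simp add: quad_def chaos_def lin_def sum_subtractf algebra_simps sum_distrib_left power2_eq_square)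
qed

lemma quad_Suc: "quad A (Suc n) \<omega> = quad A n \<omega> + (A n n * ((x n \<omega>)\<^sup>2 - 1) + 2 * (lf (A n) n \<omega> * x n \<omega>))"
  by (simp add: quad_def lin_def chaos_def algebra_simps)

lemma integrable_sq_sub_1: "integrable D (\<lambda>x. (x\<^sup>2 - 1)\<^sup>2)" "(\<integral>x. (x\<^sup>2 - 1)\<^sup>2 \<partial>D) = kurt - 1" "(\<integral>x. x\<^sup>2 - 1 \<partial>D) = 0"
proof -
  have e: "(x\<^sup>2 - 1)\<^sup>2 = x ^ 4 - 2 * x\<^sup>2 + 1" for x :: real by (simp add: power2_eq_square power4_eq_xxxx algebra_simps)
  show "integrable D (\<lambda>x. (x\<^sup>2 - 1)\<^sup>2)" unfolding e by simp
  show "(\<integral>x. (x\<^sup>2 - 1)\<^sup>2 \<partial>D) = kurt - 1" unfolding e by (simp add: kurt_def var D.prob_space)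
  show "(\<integral>x. x\<^sup>2 - 1 \<partial>D) = 0" by (simp add: var D.prob_space)
qed

lemma quad_square_integrable: "integrable M (\<lambda>\<omega>. (quad A n \<omega>)\<^sup>2)"
proof (rule Bochner_Integration.integrable_bound[where f="\<lambda>\<omega>. 2 * (lin (\<lambda>y. y\<^sup>2 - 1) (\<lambda>i. A i i) n \<omega>)\<^sup>2 + 2 * (2 * chaos A n \<omega>)\<^sup>2"])
  show "integrable M (\<lambda>\<omega>. 2 * (lin (\<lambda>y. y\<^sup>2 - 1) (\<lambda>i. A i i) n \<omega>)\<^sup>2 + 2 * (2 * chaos A n \<omega>)\<^sup>2)"
    using integrable_power2_of_power4[OF _ chaos_power4(1)[of A n]] lin_moments2[OF _ integrable_sq_sub_1(1) integrable_sq_sub_1(3), of "\<lambda>i. A i i" n]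
    by (simp add: power_mult_distrib)
  show "AE \<omega> in M. norm ((quad A n \<omega>)\<^sup>2) \<le> norm (2 * (lin (\<lambda>y. y\<^sup>2 - 1) (\<lambda>i. A i i) n \<omega>)\<^sup>2 + 2 * (2 * chaos A n \<omega>)\<^sup>2)"
    unfolding quad_def real_norm_def by (rule AE_I2) (simp only: abs_of_nonneg add_nonneg_nonneg mult_nonneg_nonneg zero_le_numeral zero_le_power2 power2_add_le)
qed simp

lemma quad_cov:
  "integrable M (\<lambda>\<omega>. quad A n \<omega> * quad B n \<omega>)"
  "expectation (\<lambda>\<omega>. quad A n \<omega> * quad B n \<omega>) = (kurt - 1) * (\<Sum>i<n. A i i * B i i) + 4 * (\<Sum>i<n. \<Sum>j<i. A i j * B i j)"
proof -
  show I: "integrable M (\<lambda>\<omega>. quad A n \<omega> * quad B n \<omega>)" for n A B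
    by (intro integrable_prod_of_squares quad_square_integrable) auto
  show "expectation (\<lambda>\<omega>. quad A n \<omega> * quad B n \<omega>) = (kurt - 1) * (\<Sum>i<n. A i i * B i i) + 4 * (\<Sum>i<n. \<Sum>j<i. A i j * B i j)"
  proof (induction n)
    case 0 show ?case by (simp add: quad_def lin_def chaos_def)
  next
    case (Suc n)
    have h: "(\<lambda>y. y) \<in> borel_measurable (borel :: real measure)" "(\<lambda>y. y\<^sup>2 - 1) \<in> borel_measurable (borel :: real measure)"
      "(\<lambda>y. y ^ 3 - y) \<in> borel_measurable (borel :: real measure)" "(\<lambda>y. y\<^sup>2) \<in> borel_measurable (borel :: real measure)" by measurable
    have hi: "integrable D (\<lambda>y. y\<^sup>2 - 1)" "integrable D (\<lambda>y. y ^ 3 - y)" by auto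
    have q: "quad A n \<in> borel_measurable (past n)" "lf (A n) n \<in> borel_measurable (past n)" for A
      by (auto intro!: quad_past lin_past)
    have qi: "integrable M (quad A n)" for A by (rule integrable_of_power2[OF _ quad_square_integrable]) simp
    have ql: "integrable M (\<lambda>\<omega>. quad A n \<omega> * lf (B n) n \<omega>)" for A B
      by (intro integrable_prod_of_squares quad_square_integrable lf_moments) auto
    have qlm: "(\<lambda>\<omega>. quad A n \<omega> * lf (B n) n \<omega>) \<in> borel_measurable (past n)" for A B using q by measurable
    have llm: "(\<lambda>\<omega>. lf (A n) n \<omega> * lf (B n) n \<omega>) \<in> borel_measurable (past n)" for A B using q by measurable
    have r1: "integrable M (\<lambda>\<omega>. quad A n \<omega> * ((x n \<omega>)\<^sup>2 - 1))" "expectation (\<lambda>\<omega>. quad A n \<omega> * ((x n \<omega>)\<^sup>2 - 1)) = 0" for A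
      using past_prod[OF q(1)[of A] qi[of A] h(2) hi(1)] by (auto simp: integrable_sq_sub_1)
    have r2: "integrable M (\<lambda>\<omega>. (quad A n \<omega> * lf (B n) n \<omega>) * x n \<omega>)" "expectation (\<lambda>\<omega>. (quad A n \<omega> * lf (B n) n \<omega>) * x n \<omega>) = 0" for A B
      using past_prod[OF qlm[of A B] ql[of A B] h(1) integrable_D(1)] by (auto simp: mean)
    \<comment> \<open>Here the past factor has mean 0, so the third moment of the law drops out of
      the covariance.\<close>
    have r3: "integrable M (\<lambda>\<omega>. lf (A n) n \<omega> * (x n \<omega> ^ 3 - x n \<omega>))" "expectation (\<lambda>\<omega>. lf (A n) n \<omega> * (x n \<omega> ^ 3 - x n \<omega>)) = 0" for A
      using past_prod[OF q(2)[of A] lf_moments(3)[of "A n" n] h(3) hi(2)] by (auto simp: lf_moments)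
    have r4: "integrable M (\<lambda>\<omega>. (lf (A n) n \<omega> * lf (B n) n \<omega>) * (x n \<omega>)\<^sup>2)" "expectation (\<lambda>\<omega>. (lf (A n) n \<omega> * lf (B n) n \<omega>) * (x n \<omega>)\<^sup>2) = (\<Sum>j<n. A n j * B n j)" for A B
      using past_prod[OF llm[of A B] lf_cov(1)[of "A n" n "B n"] h(4) integrable_D(2)] by (auto simp: var lf_cov)
    have xx: "integrable M (\<lambda>\<omega>. ((x n \<omega>)\<^sup>2 - 1)\<^sup>2)" "expectation (\<lambda>\<omega>. ((x n \<omega>)\<^sup>2 - 1)\<^sup>2) = kurt - 1"
      using integrable_sq_sub_1 by (auto simp: integrable_x_iff[of "\<lambda>y. (y\<^sup>2 - 1)\<^sup>2"] integral_x[of "\<lambda>y. (y\<^sup>2 - 1)\<^sup>2"])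
    have "(u + (a * (y\<^sup>2 - 1) + 2 * (l * y))) * (v + (b * (y\<^sup>2 - 1) + 2 * (k * y)))
      = u * v + b * (u * (y\<^sup>2 - 1)) + 2 * ((u * k) * y) + a * (v * (y\<^sup>2 - 1)) + 2 * ((v * l) * y)
       + a * b * (y\<^sup>2 - 1)\<^sup>2 + 2 * a * (k * (y ^ 3 - y)) + 2 * b * (l * (y ^ 3 - y)) + 4 * ((l * k) * y\<^sup>2)"
      for u a y l v b k :: real
      by (simp add: power2_eq_square power3_eq_cube algebra_simps)
    then have "expectation (\<lambda>\<omega>. quad A (Suc n) \<omega> * quad B (Suc n) \<omega>) = expectation (\<lambda>\<omega>. quad A n \<omega> * quad B n \<omega>
       + B n n * (quad A n \<omega> * ((x n \<omega>)\<^sup>2 - 1)) + 2 * ((quad A n \<omega> * lf (B n) n \<omega>) * x n \<omega>)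
       + A n n * (quad B n \<omega> * ((x n \<omega>)\<^sup>2 - 1)) + 2 * ((quad B n \<omega> * lf (A n) n \<omega>) * x n \<omega>)
       + A n n * B n n * ((x n \<omega>)\<^sup>2 - 1)\<^sup>2 + 2 * A n n * (lf (B n) n \<omega> * (x n \<omega> ^ 3 - x n \<omega>))
       + 2 * B n n * (lf (A n) n \<omega> * (x n \<omega> ^ 3 - x n \<omega>)) + 4 * ((lf (A n) n \<omega> * lf (B n) n \<omega>) * (x n \<omega>)\<^sup>2))"
      by (simp only: quad_Suc)
    also have "\<dots> = expectation (\<lambda>\<omega>. quad A n \<omega> * quad B n \<omega>) + A n n * B n n * (kurt - 1) + 4 * (\<Sum>j<n. A n j * B n j)"
      using I[of A n B] r1[of A] r1[of B] r2[of A B] r2[of B A] r3[of A] r3[of B] r4[of A B] xx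
      by simp
    finally show ?case using Suc.IH by (simp add: algebra_simps)
  qed
qed

lemma quad_cov_symmetric:
  assumes "\<And>i j. i < n \<Longrightarrow> j < n \<Longrightarrow> A i j = A j i" "\<And>i j. i < n \<Longrightarrow> j < n \<Longrightarrow> B i j = B j i"
  shows "expectation (\<lambda>\<omega>. quad A n \<omega> * quad B n \<omega>) = (kurt - 3) * (\<Sum>i<n. A i i * B i i) + 2 * (\<Sum>i<n. \<Sum>j<n. A i j * B i j)"
proof -
  have "(\<Sum>i<n. \<Sum>j<n. A i j * B i j) = (\<Sum>i<n. A i i * B i i) + 2 * (\<Sum>i<n. \<Sum>j<i. A i j * B i j)"
    by (rule sum_symmetric_split) (simp add: assms)
  then show ?thesis by (simp add: quad_cov algebra_simps)
qed

lemma expectation_quad: "integrable M (quad A n)" "expectation (quad A n) = 0"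
proof -
  show "integrable M (quad A n)" by (rule integrable_of_power2[OF _ quad_square_integrable]) simp
  have h: "(\<lambda>y. y) \<in> borel_measurable (borel :: real measure)" by simp
  have "expectation (\<lambda>\<omega>. lf (A i) i \<omega> * x i \<omega>) = 0" "integrable M (\<lambda>\<omega>. lf (A i) i \<omega> * x i \<omega>)" for i
    using past_prod[OF lin_past[OF h] lf_moments(3) h integrable_D(1), of i i "A i"] by (auto simp: mean)
  moreover have "expectation (\<lambda>\<omega>. (x i \<omega>)\<^sup>2 - 1) = 0" "integrable M (\<lambda>\<omega>. (x i \<omega>)\<^sup>2 - 1)" for i
    by (auto simp: integral_x[of "\<lambda>y. y\<^sup>2 - 1"] integrable_x_iff[of "\<lambda>y. y\<^sup>2 - 1"] integrable_sq_sub_1)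
  ultimately show "expectation (quad A n) = 0"
    unfolding quad_def lin_def[of "\<lambda>y. y\<^sup>2 - 1"] chaos_def mult.commute[of "x _ _" "lf _ _ _"]
    by (simp)
qed

lemma quad_second_moment_le:
  assumes "(\<Sum>i<n. \<Sum>j<n. (A i j)\<^sup>2) \<le> 1" "\<And>i j. i < n \<Longrightarrow> j < n \<Longrightarrow> A i j = A j i"
  shows "expectation (\<lambda>\<omega>. (quad A n \<omega>)\<^sup>2) \<le> kurt + 1"
proof -
  have s: "(\<Sum>i<n. (A i i)\<^sup>2) + 2 * (\<Sum>i<n. \<Sum>j<i. (A i j)\<^sup>2) \<le> 1"
    using sum_symmetric_split[of n "\<lambda>i j. (A i j)\<^sup>2"] assms by simp
  have "expectation (\<lambda>\<omega>. (quad A n \<omega>)\<^sup>2) = (kurt - 1) * (\<Sum>i<n. (A i i)\<^sup>2) + 2 * (2 * (\<Sum>i<n. \<Sum>j<i. (A i j)\<^sup>2))"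
    using quad_cov(2)[of A n A] by (simp add: power2_eq_square)
  also have "\<dots> \<le> (kurt - 1 + 2) * (\<Sum>i<n. (A i i)\<^sup>2) + (kurt - 1 + 2) * (2 * (\<Sum>i<n. \<Sum>j<i. (A i j)\<^sup>2))"
    using kurt_ge_1 by (intro add_mono mult_right_mono) (auto intro!: sum_nonneg)
  also have "\<dots> = (kurt + 1) * ((\<Sum>i<n. (A i i)\<^sup>2) + 2 * (\<Sum>i<n. \<Sum>j<i. (A i j)\<^sup>2))" by (simp add: algebra_simps)
  also have "\<dots> \<le> (kurt + 1) * 1" using s kurt_ge_1 by (intro mult_left_mono) auto
  finally show ?thesis by simp
qed

end

section \<open>Uniform integrability of squared quadratic forms\<close>

context std_law
begin

definition tail :: "nat \<Rightarrow> real" where "tail K = (\<integral>x. (max 0 (x\<^sup>2 - real K))\<^sup>2 \<partial>D)"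

lemma tail_integrable: "integrable D (\<lambda>x. (max 0 (x\<^sup>2 - real K))\<^sup>2)"
proof (rule integrable_D_bound[where C=1])
  show "\<bar>(max 0 (x\<^sup>2 - real K))\<^sup>2\<bar> \<le> 1 * (1 + x ^ 4)" for x
  proof -
    have "(max 0 (x\<^sup>2 - real K))\<^sup>2 \<le> (x\<^sup>2)\<^sup>2" by (rule power_mono) auto
    then show ?thesis by (simp flip: power_mult)
  qed
qed measurable

lemma tail_tendsto_0: "tail \<longlonglongrightarrow> 0"
proof -
  have "(\<lambda>K. \<integral>x. (max 0 (x\<^sup>2 - real K))\<^sup>2 \<partial>D) \<longlonglongrightarrow> (\<integral>x. 0 \<partial>D)"
  proof (rule integral_dominated_convergence[where w="\<lambda>x. x ^ 4"])
    show "AE x in D. (\<lambda>K. (max 0 (x\<^sup>2 - real K))\<^sup>2) \<longlonglongrightarrow> 0"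
    proof (rule AE_I2)
      fix x
      obtain N where "x\<^sup>2 \<le> real N" using real_arch_simple by blast
      then have "\<forall>\<^sub>F K in sequentially. (max 0 (x\<^sup>2 - real K))\<^sup>2 = 0"
        by (intro eventually_sequentiallyI[of N]) (auto simp: max_def)
      then show "(\<lambda>K. (max 0 (x\<^sup>2 - real K))\<^sup>2) \<longlonglongrightarrow> 0" by (rule tendsto_eventually)
    qed
    show "AE x in D. norm ((max 0 (x\<^sup>2 - real K))\<^sup>2) \<le> x ^ 4" for K
    proof (rule AE_I2)
      fix x
      have "(max 0 (x\<^sup>2 - real K))\<^sup>2 \<le> (x\<^sup>2)\<^sup>2" by (rule power_mono) auto
      then show "norm ((max 0 (x\<^sup>2 - real K))\<^sup>2) \<le> x ^ 4" by (simp flip: power_mult)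
    qed
  qed auto
  then show ?thesis by (simp add: tail_def[abs_def])
qed

end

text \<open>Only the large squares on the diagonal lack a fourth moment; cut off at $K$, they are small in $L^2$.
  The free parameters $l$, $T$ and $K$ are then chosen in this order of dependence: $K$, $l$, $T$.\<close>

lemma (in iid_seq) quad_tail_le:
  assumes A: "(\<Sum>i<n. \<Sum>j<n. (A i j)\<^sup>2) \<le> 1" "\<And>i j. i < n \<Longrightarrow> j < n \<Longrightarrow> A i j = A j i"
    and l: "0 < l" "0 < T"
  shows "integrable M (\<lambda>\<omega>. (quad A n \<omega>)\<^sup>2 * indicator {y. T < \<bar>y\<bar>} (quad A n \<omega>))"
    "expectation (\<lambda>\<omega>. (quad A n \<omega>)\<^sup>2 * indicator {y. T < \<bar>y\<bar>} (quad A n \<omega>))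
     \<le> 2 * l * (24 * (real K + 1) ^ 4 + 128 * (24 * kurt\<^sup>2)\<^sup>2) + (kurt + 1) / (2 * l * T\<^sup>2) + 2 * tail K"
proof -
  let ?I = "\<lambda>\<omega>. (quad A n \<omega>)\<^sup>2 * indicator {y. T < \<bar>y\<bar>} (quad A n \<omega>) :: real"
  define e1 where "e1 = (\<integral>x. min (x\<^sup>2) (real K) \<partial>D)"
  define e2 where "e2 = (\<integral>x. max 0 (x\<^sup>2 - real K) \<partial>D)"
  define h1 where "h1 = (\<lambda>x::real. min (x\<^sup>2) (real K) - e1)"
  define h2 where "h2 = (\<lambda>x::real. max 0 (x\<^sup>2 - real K) - e2)"
  define a where "a = (\<lambda>i. A i i)"
  have [measurable]: "h1 \<in> borel_measurable borel" "h2 \<in> borel_measurable borel" unfolding h1_def h2_def by measurable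
  have i1: "integrable D (\<lambda>x. min (x\<^sup>2) (real K))"
    by (rule D.integrable_const_bound[where B="real K"]) (auto intro!: AE_I2 simp: abs_if min_def)
  have i2: "integrable D (\<lambda>x. max 0 (x\<^sup>2 - real K))"
    by (rule D.integrable_of_power2[OF _ tail_integrable]) simp
  have e12: "e1 + e2 = 1"
  proof -
    have "e1 + e2 = (\<integral>x. min (x\<^sup>2) (real K) + max 0 (x\<^sup>2 - real K) \<partial>D)" using i1 i2 by (simp add: e1_def e2_def)
    also have "\<dots> = (\<integral>x. x\<^sup>2 \<partial>D)" by (intro Bochner_Integration.integral_cong) (auto simp: min_def max_def)
    finally show ?thesis by (simp add: var)
  qed
  have e1: "0 \<le> e1" "e1 \<le> 1"
    using e12 by (auto simp: e1_def e2_def intro!: integral_nonneg_AE AE_I2)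
      (smt (verit) Bochner_Integration.integral_nonneg max.cobounded1 e2_def)
  have b1: "\<bar>h1 x\<bar> \<le> real K + 1" for x
    using e1 by (simp add: h1_def abs_if min_def) (smt (verit) zero_le_power2 of_nat_0_le_iff)
  have h1_0: "(\<integral>x. h1 x \<partial>D) = 0" using i1 by (simp add: h1_def e1_def D.prob_space)
  have h2_0: "(\<integral>x. h2 x \<partial>D) = 0" using i2 by (simp add: h2_def e2_def D.prob_space)
  have b14: "h1 x ^ 4 \<le> (real K + 1) ^ 4" for x
    using power_mono[OF b1[of x], where n=4] by simp
  have h14: "integrable D (\<lambda>x. h1 x ^ 4)"
    by (rule D.integrable_const_bound[where B="(real K + 1) ^ 4"]) (use b14 in auto)
  have B1: "(\<integral>x. h1 x ^ 4 \<partial>D) \<le> (real K + 1) ^ 4"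
    using D.integral_le_const[OF h14, of "(real K + 1) ^ 4"] b14 by auto
  have sq: "(h2 x)\<^sup>2 = (max 0 (x\<^sup>2 - real K))\<^sup>2 - 2 * e2 * max 0 (x\<^sup>2 - real K) + e2\<^sup>2" for x
    by (simp add: h2_def power2_eq_square algebra_simps)
  have h22: "integrable D (\<lambda>x. (h2 x)\<^sup>2)" unfolding sq using i2 tail_integrable by simp
  have B2: "(\<integral>x. (h2 x)\<^sup>2 \<partial>D) \<le> tail K"
  proof -
    have "(\<integral>x. (h2 x)\<^sup>2 \<partial>D) = tail K - 2 * e2 * e2 + e2\<^sup>2"
      unfolding sq using i2 tail_integrable by (simp add: tail_def e2_def D.prob_space)
    then show ?thesis by (simp add: power2_eq_square)
  qed
  \<comment> \<open>U consists of the truncated diagonal and the chaos, with a fourth moment bounded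
    in terms of K. W is the excess of the diagonal, of second moment at most
    \<open>tail K\<close>.\<close>
  define U where "U \<omega> = lin h1 a n \<omega> + 2 * chaos A n \<omega>" for \<omega>
  define W where "W = lin h2 a n"
  have [measurable]: "U \<in> borel_measurable M" "W \<in> borel_measurable M" unfolding U_def W_def by measurable
  have Q: "quad A n \<omega> = U \<omega> + W \<omega>" for \<omega>
  proof -
    have "y\<^sup>2 - 1 = h1 y + h2 y" for y :: real using e12 by (auto simp: h1_def h2_def min_def max_def)
    then show ?thesis by (simp add: quad_def U_def W_def lin_def a_def sum.distrib[symmetric] algebra_simps)
  qed
  have sum1: "(\<Sum>i<n. (A i i)\<^sup>2) + 2 * (\<Sum>i<n. \<Sum>j<i. (A i j)\<^sup>2) \<le> 1"
    using sum_symmetric_split[of n "\<lambda>i j. (A i j)\<^sup>2"] A by simp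
  have s0: "0 \<le> (\<Sum>i<n. (A i i)\<^sup>2)" "0 \<le> (\<Sum>i<n. \<Sum>j<i. (A i j)\<^sup>2)" by (auto intro!: sum_nonneg)
  then have s: "(\<Sum>i<n. (a i)\<^sup>2) \<le> 1" "(\<Sum>i<n. \<Sum>j<i. (A i j)\<^sup>2) \<le> 1" using sum1 by (auto simp: a_def)
  note m1 = lin_moments[OF \<open>h1 \<in> borel_measurable borel\<close> h14 h1_0, of a n]
  note m2 = lin_moments2[OF \<open>h2 \<in> borel_measurable borel\<close> h22 h2_0, of a n]
  have W2: "integrable M (\<lambda>\<omega>. (W \<omega>)\<^sup>2)" "expectation (\<lambda>\<omega>. (W \<omega>)\<^sup>2) \<le> tail K"
  proof -
    show "integrable M (\<lambda>\<omega>. (W \<omega>)\<^sup>2)" using m2 by (simp add: W_def)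
    have "expectation (\<lambda>\<omega>. (W \<omega>)\<^sup>2) \<le> (\<integral>x. (h2 x)\<^sup>2 \<partial>D) * 1"
      unfolding W_def m2 using s by (intro mult_left_mono) auto
    then show "expectation (\<lambda>\<omega>. (W \<omega>)\<^sup>2) \<le> tail K" using B2 by simp
  qed
  have p4: "(u + v) ^ 4 \<le> 8 * u ^ 4 + 8 * v ^ 4" for u v :: real
  proof -
    have "((u + v)\<^sup>2)\<^sup>2 \<le> (2 * u\<^sup>2 + 2 * v\<^sup>2)\<^sup>2" by (intro power_mono power2_add_le) auto
    also have "\<dots> \<le> 2 * (2 * u\<^sup>2)\<^sup>2 + 2 * (2 * v\<^sup>2)\<^sup>2" by (rule power2_add_le)
    finally show ?thesis by (simp add: power_mult_distrib flip: power_mult)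
  qed
  have U4: "integrable M (\<lambda>\<omega>. (U \<omega>) ^ 4)" 
    unfolding U_def by (intro integrable_power4_add m1) (auto simp: power_mult_distrib chaos_power4)
  have U4e: "expectation (\<lambda>\<omega>. (U \<omega>) ^ 4) \<le> 24 * (real K + 1) ^ 4 + 128 * (24 * kurt\<^sup>2)\<^sup>2"
  proof -
    have "expectation (\<lambda>\<omega>. (U \<omega>) ^ 4) \<le> expectation (\<lambda>\<omega>. 8 * lin h1 a n \<omega> ^ 4 + 8 * (2 * chaos A n \<omega>) ^ 4)"
    proof (rule integral_mono[OF U4])
      show "integrable M (\<lambda>\<omega>. 8 * lin h1 a n \<omega> ^ 4 + 8 * (2 * chaos A n \<omega>) ^ 4)"
        using m1 chaos_power4[of A n] by (simp add: power_mult_distrib)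
      show "U \<omega> ^ 4 \<le> 8 * lin h1 a n \<omega> ^ 4 + 8 * (2 * chaos A n \<omega>) ^ 4" for \<omega>
        unfolding U_def by (rule p4)
    qed
    also have "\<dots> = 8 * expectation (\<lambda>\<omega>. lin h1 a n \<omega> ^ 4) + 128 * expectation (\<lambda>\<omega>. chaos A n \<omega> ^ 4)"
      using m1 chaos_power4[of A n] by (simp add: power_mult_distrib)
    also have "\<dots> \<le> 8 * (3 * (real K + 1) ^ 4) + 128 * (24 * kurt\<^sup>2)\<^sup>2"
    proof (intro add_mono mult_left_mono)
      have "expectation (\<lambda>\<omega>. lin h1 a n \<omega> ^ 4) \<le> 3 * (\<integral>x. h1 x ^ 4 \<partial>D) * (\<Sum>i<n. (a i)\<^sup>2)\<^sup>2" by (rule m1)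
      also have "\<dots> \<le> 3 * (real K + 1) ^ 4 * 1"
        using B1 s by (intro mult_mono) (auto intro!: power_le_one sum_nonneg)
      finally show "expectation (\<lambda>\<omega>. lin h1 a n \<omega> ^ 4) \<le> 3 * (real K + 1) ^ 4" by simp
      have "expectation (\<lambda>\<omega>. chaos A n \<omega> ^ 4) \<le> (24 * kurt\<^sup>2 * (\<Sum>i<n. \<Sum>j<i. (A i j)\<^sup>2))\<^sup>2" by (rule chaos_power4)
      also have "\<dots> \<le> (24 * kurt\<^sup>2 * 1)\<^sup>2"
        using s s0 by (intro power_mono mult_left_mono) auto
      finally show "expectation (\<lambda>\<omega>. chaos A n \<omega> ^ 4) \<le> (24 * kurt\<^sup>2)\<^sup>2" by simp
    qed auto
    finally show ?thesis by simp
  qed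
  let ?R = "\<lambda>\<omega>. 2 * l * U \<omega> ^ 4 + 1 / (2 * l * T\<^sup>2) * (quad A n \<omega>)\<^sup>2 + 2 * (W \<omega>)\<^sup>2"
  \<comment> \<open>Where |quad| > T, its square is at most 2 U^2 + 2 W^2. Completing a square gives
    2 U^2 <= 2 l U^4 + 1/(2 l), and the constant 1/(2 l) is absorbed because quad^2 / T^2 is at
    least 1 there.\<close>
  have le: "?I \<omega> \<le> ?R \<omega>" for \<omega>
  proof (cases "T < \<bar>quad A n \<omega>\<bar>")
    case True
    have "T\<^sup>2 \<le> (quad A n \<omega>)\<^sup>2" using True l by (metis abs_le_square_iff abs_of_pos less_imp_le)
    then have "1 \<le> (quad A n \<omega>)\<^sup>2 / T\<^sup>2" using l by simp
    then have "1 / (2 * l) * 1 \<le> 1 / (2 * l) * ((quad A n \<omega>)\<^sup>2 / T\<^sup>2)" using l by (intro mult_left_mono) auto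
    moreover have "2 * (U \<omega>)\<^sup>2 \<le> 2 * l * U \<omega> ^ 4 + 1 / (2 * l)"
    proof -
      have "0 \<le> 2 * l * ((U \<omega>)\<^sup>2 - 1 / (2 * l))\<^sup>2" using l by simp
      also have "\<dots> = 2 * l * U \<omega> ^ 4 - 2 * (U \<omega>)\<^sup>2 + 1 / (2 * l)"
        using l by (simp add: power2_diff power2_eq_square power4_eq_xxxx field_simps)
      finally show ?thesis by simp
    qed
    moreover have "(quad A n \<omega>)\<^sup>2 \<le> 2 * (U \<omega>)\<^sup>2 + 2 * (W \<omega>)\<^sup>2" unfolding Q by (rule power2_add_le)
    ultimately show ?thesis using True by (simp add: mult.assoc)
  qed (use l in auto)
  have iR: "integrable M ?R" using U4 W2 quad_square_integrable by simp
  have *: "integrable M ?I \<and> expectation ?I \<le> expectation ?R"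
    by (rule integral_mono_real[OF iR]) (use le in auto)
  then show "integrable M ?I" by simp
  have "expectation ?R = 2 * l * expectation (\<lambda>\<omega>. U \<omega> ^ 4) + 1 / (2 * l * T\<^sup>2) * expectation (\<lambda>\<omega>. (quad A n \<omega>)\<^sup>2) + 2 * expectation (\<lambda>\<omega>. (W \<omega>)\<^sup>2)"
    using U4 W2 quad_square_integrable by simp
  also have "\<dots> \<le> 2 * l * (24 * (real K + 1) ^ 4 + 128 * (24 * kurt\<^sup>2)\<^sup>2) + 1 / (2 * l * T\<^sup>2) * (kurt + 1) + 2 * tail K"
    using l by (intro add_mono mult_left_mono U4e W2 quad_second_moment_le A) auto
  finally show "expectation ?I \<le> 2 * l * (24 * (real K + 1) ^ 4 + 128 * (24 * kurt\<^sup>2)\<^sup>2) + (kurt + 1) / (2 * l * T\<^sup>2) + 2 * tail K"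
    using * by simp
qed

text \<open>The threshold T depends only on the law D and on e, so that one T serves every row,
  every projection determined by the earlier rows and every n. K, l and T are chosen so that each of
  the three terms in \<open>quad_tail_le\<close> is at most e/4.\<close>

lemma (in std_law) quad_uniformly_integrable:
  assumes e: "0 < e"
  shows "\<exists>T>0. \<forall>(M::'a measure) x A n. iid_seq D M x \<longrightarrow> (\<Sum>i<n. \<Sum>j<n. (A i j)\<^sup>2) \<le> 1 \<longrightarrow>
    (\<forall>i<n. \<forall>j<n. A i j = A j i) \<longrightarrow>
    (\<integral>\<omega>. (iid_seq.quad x A n \<omega>)\<^sup>2 * indicator {y. T < \<bar>y\<bar>} (iid_seq.quad x A n \<omega>) \<partial>M) \<le> e"
proof -
  obtain K where K: "tail K \<le> e / 8"
  proof -
    have "\<forall>\<^sub>F K in sequentially. tail K < e / 8" using order_tendstoD(2)[OF tail_tendsto_0, of "e / 8"] e by simp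
    then show ?thesis using that eventually_happens'[OF sequentially_bot] less_imp_le by blast
  qed
  define C where "C = 24 * (real K + 1) ^ 4 + 128 * (24 * kurt\<^sup>2)\<^sup>2"
  have C: "0 < C" unfolding C_def by (intro add_pos_nonneg) auto
  define l where "l = e / (8 * C)"
  have l: "0 < l" using C e by (simp add: l_def)
  define T where "T = sqrt ((kurt + 1) / (2 * l * (e / 4)))"
  have k: "0 < (kurt + 1) / (2 * l * (e / 4))" using kurt_ge_1 l e by (auto intro!: divide_pos_pos)
  have T: "0 < T" unfolding T_def using k by (simp only: real_sqrt_gt_0_iff)
  have T2: "T\<^sup>2 = (kurt + 1) / (2 * l * (e / 4))" unfolding T_def using k by (simp only: real_sqrt_pow2 less_imp_le)
  have "2 * l * C = e / 4" using C by (simp add: l_def)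
  moreover have "(kurt + 1) / (2 * l * T\<^sup>2) = e / 4"
  proof -
    have "k / (2 * l * (k / (2 * l * (e / 4)))) = e / 4" if "k \<noteq> 0" for k :: real
      using that l e by (simp add: field_simps)
    moreover have "kurt + 1 \<noteq> 0" using kurt_ge_1 by simp
    ultimately show ?thesis unfolding T2 by blast
  qed
  ultimately have b: "2 * l * C + (kurt + 1) / (2 * l * T\<^sup>2) + 2 * tail K \<le> e" using K e by linarith
  show ?thesis
  proof (intro exI[of _ T] conjI T allI impI)
    fix M :: "'a measure" and x :: "nat \<Rightarrow> 'a \<Rightarrow> real" and A :: "nat \<Rightarrow> nat \<Rightarrow> real" and n :: nat
    assume "iid_seq D M x" and A: "(\<Sum>i<n. \<Sum>j<n. (A i j)\<^sup>2) \<le> (1::real)" "\<forall>i<n. \<forall>j<n. A i j = A j i"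
    then interpret iid_seq D M x by simp
    show "expectation (\<lambda>\<omega>. (quad A n \<omega>)\<^sup>2 * indicator {y. T < \<bar>y\<bar>} (quad A n \<omega>)) \<le> e"
      using quad_tail_le(2)[where n=n and A=A and l=l and T=T and K=K, OF A(1) _ l T] A(2) b by (simp add: C_def)
  qed
qed

section \<open>Orthogonal projections in coordinates\<close>

definition dot :: "nat \<Rightarrow> (nat \<Rightarrow> real) \<Rightarrow> (nat \<Rightarrow> real) \<Rightarrow> real" where
  "dot n x y = (\<Sum>i<n. x i * y i)"

definition mv :: "nat \<Rightarrow> (nat \<Rightarrow> nat \<Rightarrow> real) \<Rightarrow> (nat \<Rightarrow> real) \<Rightarrow> nat \<Rightarrow> real" where
  "mv n P x i = (\<Sum>j<n. P i j * x j)"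

text \<open>Orthogonal projections as real functions of index pairs: values outside the n by n
  corner are free, and measurability in the data remains an entrywise matter.\<close>

definition is_proj :: "nat \<Rightarrow> (nat \<Rightarrow> nat \<Rightarrow> real) \<Rightarrow> bool" where
  "is_proj n P \<longleftrightarrow> (\<forall>i<n. \<forall>j<n. P i j = P j i) \<and> (\<forall>i<n. \<forall>j<n. (\<Sum>k<n. P i k * P k j) = P i j)"

definition trace :: "nat \<Rightarrow> (nat \<Rightarrow> nat \<Rightarrow> real) \<Rightarrow> real" where
  "trace n P = (\<Sum>i<n. P i i)"

lemma dot_commute: "dot n x y = dot n y x"
  by (simp add: dot_def mult.commute)

lemma dot_self_nonneg: "0 \<le> dot n x x"
  by (auto simp: dot_def intro: sum_nonneg)

lemma dot_self_eq_0_iff: "dot n x x = 0 \<longleftrightarrow> (\<forall>i<n. x i = 0)"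
  unfolding dot_def by (subst sum_nonneg_eq_0_iff) auto

lemma dot_cong: "(\<And>i. i < n \<Longrightarrow> x i = x' i) \<Longrightarrow> (\<And>i. i < n \<Longrightarrow> y i = y' i) \<Longrightarrow> dot n x y = dot n x' y'"
  by (auto simp: dot_def intro!: sum.cong)

lemma mv_cong: "(\<And>j. j < n \<Longrightarrow> x j = y j) \<Longrightarrow> mv n P x i = mv n P y i"
  by (auto simp: mv_def intro!: sum.cong)

lemma sum_power2_le_power2_sum:
  fixes f :: "nat \<Rightarrow> real"
  assumes "\<And>i. i < n \<Longrightarrow> 0 \<le> f i"
  shows "(\<Sum>i<n. (f i)\<^sup>2) \<le> (\<Sum>i<n. f i)\<^sup>2"
  using assms
proof (induction n)
  case (Suc n)
  then have "0 \<le> (\<Sum>i<n. f i) * f n" by (auto intro!: mult_nonneg_nonneg sum_nonneg)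
  moreover have "(\<Sum>i<n. (f i)\<^sup>2) \<le> (\<Sum>i<n. f i)\<^sup>2" using Suc by simp
  ultimately show ?case by (simp add: power2_eq_square algebra_simps)
qed simp

context
  fixes n P assumes P: "is_proj n P"
begin

lemma proj_sym: "i < n \<Longrightarrow> j < n \<Longrightarrow> P i j = P j i"
  using P by (auto simp: is_proj_def)

lemma proj_idem: "i < n \<Longrightarrow> j < n \<Longrightarrow> (\<Sum>k<n. P i k * P k j) = P i j"
  using P unfolding is_proj_def by blast

lemma dot_mv: "dot n x (mv n P y) = dot n (mv n P x) y"
proof -
  have "dot n x (mv n P y) = (\<Sum>i<n. \<Sum>j<n. x i * P i j * y j)"
    by (simp add: dot_def mv_def sum_distrib_left mult.assoc)
  also have "\<dots> = (\<Sum>j<n. \<Sum>i<n. x i * P i j * y j)" by (rule sum.swap)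
  also have "\<dots> = (\<Sum>j<n. \<Sum>i<n. P j i * x i * y j)"
    by (intro sum.cong refl) (auto simp: proj_sym)
  finally show ?thesis by (simp add: dot_def mv_def sum_distrib_right)
qed

lemma mv_mv: assumes "i < n" shows "mv n P (mv n P x) i = mv n P x i"
proof -
  have "mv n P (mv n P x) i = (\<Sum>k<n. \<Sum>j<n. P i k * P k j * x j)"
    by (simp add: mv_def sum_distrib_left mult.assoc)
  also have "\<dots> = (\<Sum>j<n. \<Sum>k<n. P i k * P k j * x j)" by (rule sum.swap)
  also have "\<dots> = (\<Sum>j<n. P i j * x j)"
    using assms by (intro sum.cong refl) (simp add: proj_idem sum_distrib_right[symmetric])
  finally show ?thesis by (simp add: mv_def)
qed

lemma dot_mv_mv: "dot n (mv n P x) (mv n P y) = dot n x (mv n P y)"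
  by (simp add: dot_mv[symmetric] mv_mv cong: dot_cong)

text \<open>The diagonal of P P = P, combined with symmetry. Summed over i it gives the squared
  Frobenius norm as the trace, so that P / sqrt m is a form of unit norm when P has trace m.\<close>

lemma proj_row_norm: assumes "i < n" shows "(\<Sum>j<n. (P i j)\<^sup>2) = P i i"
proof -
  have "(\<Sum>j<n. (P i j)\<^sup>2) = (\<Sum>j<n. P i j * P j i)"
    using assms by (intro sum.cong refl) (simp add: power2_eq_square proj_sym)
  then show ?thesis using assms by (simp add: proj_idem)
qed

lemma proj_frobenius: "(\<Sum>i<n. \<Sum>j<n. (P i j)\<^sup>2) = trace n P"
  by (simp add: trace_def proj_row_norm)

lemma proj_diag: assumes "i < n" shows "0 \<le> P i i" "P i i \<le> 1"
proof -
  show 0: "0 \<le> P i i" using proj_row_norm[OF assms] sum_nonneg[of "{..<n}" "\<lambda>j. (P i j)\<^sup>2"] by simp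
  have "(P i i)\<^sup>2 \<le> (\<Sum>j<n. (P i j)\<^sup>2)" using assms by (intro member_le_sum) auto
  then have "P i i * P i i \<le> 1 * P i i" using proj_row_norm[OF assms] by (simp add: power2_eq_square)
  then show "P i i \<le> 1" using 0 by (cases "P i i = 0") (auto dest: mult_right_le_imp_le)
qed

lemma dot_mv_le: "dot n x (mv n P x) \<le> dot n x x"
proof -
  have "0 \<le> dot n (\<lambda>i. x i - mv n P x i) (\<lambda>i. x i - mv n P x i)" by (rule dot_self_nonneg)
  also have "\<dots> = dot n x x - 2 * dot n x (mv n P x) + dot n (mv n P x) (mv n P x)"
    by (simp add: dot_def algebra_simps sum.distrib sum_subtractf sum_distrib_left)
  finally show ?thesis by (simp add: dot_mv_mv)
qed

end

section \<open>Expansion of the characteristic function in one step\<close>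

lemma abs_le_one_plus_square: "2 * \<bar>x\<bar> \<le> 1 + x\<^sup>2" for x :: real
  using zero_le_power2[of "\<bar>x\<bar> - 1"] by (simp add: power2_diff)

lemma iexp_quadratic_approx:
  "cmod (exp (\<i> * of_real y) - Complex (1 - y\<^sup>2 / 2) y) \<le> \<bar>y\<bar> ^ 3 / 6" for y :: real
proof -
  have "cmod (iexp y - (\<Sum>k \<le> 2. (\<i> * y) ^ k / fact k)) \<le> \<bar>y\<bar> ^ Suc 2 / fact (Suc 2)"
    by (rule iexp_approx1)
  moreover have "(\<Sum>k \<le> 2. (\<i> * y) ^ k / fact k) = Complex (1 - y\<^sup>2 / 2) y"
    by (simp add: numeral_2_eq_2 complex_eq_iff power2_eq_square fact_numeral)
  ultimately show ?thesis by (simp add: fact_numeral numeral_3_eq_3 numeral_2_eq_2)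
qed

text \<open>One regular step with all randomness frozen: m is the rank left, N the sample size, 1 +
  q the value of xi^2, and 1 + w / sqrt m the normalised pivot x.Px / m.\<close>

locale step_reals =
  fixes d m N K q w :: real
  assumes d: "0 < d" "d \<le> 1/4" and dm: "2 \<le> d * sqrt m" and N: "0 < N" "N \<le> K * m"
    and w: "\<bar>w\<bar> \<le> d * sqrt m" and q: "0 \<le> 1 + q" "1 + q \<le> d * sqrt m" and m0: "0 < m"
begin

definition "s = 1 + w / sqrt m"
definition "A = 1 - (1 + q) / s"
text \<open>The argument of the logarithm equals (1 - (1 + q) / (m s)) * m / (m - 1), the factor by
  which the normalised residual n a_k / (n - k) changes in one step.\<close>

definition "Z = sqrt N * ln (1 + A / (m - 1))"
definition "h = sqrt N / m"
definition "\<kappa> = sqrt K"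
text \<open>The unit of error: q and w have bounded second moments, so its mean is O(1/m), and
  errors of size d times \<open>e\<close> add up to O(d) over all steps.\<close>

definition "e = (1 + q\<^sup>2 + w\<^sup>2) / m"

lemma K: "0 < K"
proof -
  have "0 < K * m" using N by linarith
  then show ?thesis using m0 by (simp add: zero_less_mult_iff)
qed

lemma \<kappa>: "0 < \<kappa>" using K by (simp add: \<kappa>_def)

text \<open>From d <= 1/4 and 2 <= d sqrt m follows sqrt m >= 8. The bound serves to replace 1/(m -
  1) by 2/m.\<close>

lemma m_ge: "64 \<le> m"
proof -
  have "2 \<le> 1/4 * sqrt m" using dm d m0 by (smt (verit) mult_right_mono real_sqrt_ge_0_iff)
  then have "8 \<le> sqrt m" by simp
  then have "8\<^sup>2 \<le> (sqrt m)\<^sup>2" by (rule power_mono) simp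
  then show ?thesis using m0 by simp
qed

lemma sqm: "0 < sqrt m" "sqrt m * sqrt m = m" "1 / sqrt m \<le> d / 2"
  using m0 dm by (simp_all add: field_simps)

lemma h: "0 < h" "h \<le> \<kappa> / sqrt m"
proof -
  show "0 < h" using N m0 by (simp add: h_def)
  have "sqrt N \<le> \<kappa> * sqrt m" unfolding \<kappa>_def real_sqrt_mult[symmetric] using N by simp
  then have "h \<le> \<kappa> * sqrt m / m" using m0 by (simp add: h_def divide_right_mono)
  also have "\<dots> = \<kappa> / sqrt m" using sqm m0 by (simp add: field_simps)
  finally show "h \<le> \<kappa> / sqrt m" .
qed

lemma w_sqm: "\<bar>w / sqrt m\<bar> \<le> d"
  using w sqm by (simp add: abs_divide pos_divide_le_eq)

lemma s: "1/2 \<le> s" "\<bar>s - 1\<bar> \<le> d" "s - 1 = w / sqrt m"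
  using w_sqm d unfolding s_def abs_le_iff by linarith+

lemma A_bounds: "\<bar>A\<bar> \<le> 3 + 2 * \<bar>q\<bar>" "\<bar>A\<bar> \<le> 3 * d * sqrt m" "A\<^sup>2 \<le> 18 * (1 + q\<^sup>2)"
proof -
  have "0 \<le> (1 + q) / s" "(1 + q) / s \<le> 2 * (1 + q)"
    using s(1) q(1) mult_left_mono[of 1 "2 * s" "1 + q"] by (auto simp: pos_divide_le_eq algebra_simps)
  then show 1: "\<bar>A\<bar> \<le> 3 + 2 * \<bar>q\<bar>" "\<bar>A\<bar> \<le> 3 * d * sqrt m"
    using q dm by (auto simp: A_def abs_le_iff)
  have "A\<^sup>2 \<le> (3 + 2 * \<bar>q\<bar>)\<^sup>2" using 1(1) by (metis abs_ge_zero power2_abs power_mono)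
  also have "\<dots> \<le> 18 * (1 + q\<^sup>2)"
  proof -
    have "0 \<le> (3 - 2 * \<bar>q\<bar>)\<^sup>2" by simp
    then show ?thesis by (simp add: power2_sum power2_diff power_mult_distrib)
       (smt (verit) zero_le_power2)
  qed
  finally show "A\<^sup>2 \<le> 18 * (1 + q\<^sup>2)" .
qed

lemma x_bounds: "\<bar>A / (m - 1)\<bar> \<le> 2 * \<bar>A\<bar> / m" "\<bar>A / (m - 1)\<bar> \<le> 1/2"
proof -
  have "\<bar>A\<bar> * m \<le> \<bar>A\<bar> * (2 * (m - 1))" using m_ge by (intro mult_left_mono) auto
  then show 1: "\<bar>A / (m - 1)\<bar> \<le> 2 * \<bar>A\<bar> / m" using m_ge by (simp add: abs_divide field_simps)
  have "2 * \<bar>A\<bar> / m \<le> 2 * (3 * d * sqrt m) / m" using A_bounds(2) m0 by (intro divide_right_mono) auto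
  also have "\<dots> = 6 * d * (1 / sqrt m)" using sqm by (simp add: field_simps)
  also have "\<dots> \<le> 6 * d * (d / 2)" using sqm d by (intro mult_left_mono) auto
  also have "\<dots> \<le> 6 * (1/4) * (1/4/2)" using d by (intro mult_mono) auto
  finally show "\<bar>A / (m - 1)\<bar> \<le> 1/2" using 1 by simp
qed

lemma inv_sqrt_bound: assumes "0 \<le> c" shows "h * c \<le> \<kappa> * c / sqrt m" "h * (c / m) \<le> \<kappa> * (d / 2) * (c / m)"
proof -
  show "h * c \<le> \<kappa> * c / sqrt m" using mult_right_mono[OF h(2) assms] by simp
  have "\<kappa> / sqrt m \<le> \<kappa> * (d / 2)" using mult_left_mono[OF sqm(3), of \<kappa>] \<kappa> by simp
  then have "h \<le> \<kappa> * (d / 2)" using h(2) by linarith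
  then show "h * (c / m) \<le> \<kappa> * (d / 2) * (c / m)" using assms m0 by (intro mult_right_mono) auto
qed

lemma e_ge: "(1 + q\<^sup>2) / m \<le> e" "(\<bar>q\<bar> * \<bar>w\<bar> + \<bar>w\<bar>) / m \<le> e"
proof -
  show "(1 + q\<^sup>2) / m \<le> e" unfolding e_def using m0 by (intro divide_right_mono) auto
  have "0 \<le> (\<bar>q\<bar> - \<bar>w\<bar>)\<^sup>2" "0 \<le> (\<bar>w\<bar> - 1)\<^sup>2" by simp_all
  then have "2 * (\<bar>q\<bar> * \<bar>w\<bar>) \<le> q\<^sup>2 + w\<^sup>2" "2 * \<bar>w\<bar> \<le> w\<^sup>2 + 1" by (simp_all add: power2_diff)
  then have "\<bar>q\<bar> * \<bar>w\<bar> + \<bar>w\<bar> \<le> 1 + q\<^sup>2 + w\<^sup>2" using zero_le_power2[of q] by linarith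
  then show "(\<bar>q\<bar> * \<bar>w\<bar> + \<bar>w\<bar>) / m \<le> e" unfolding e_def using m0 by (intro divide_right_mono) auto
qed

text \<open>Two replacements: ln(1 + x) by x, at cost 72, and 1/(m - 1) by 1/m, at cost 4. Each
  leaves a spare factor 1 / sqrt m, which is at most d/2.\<close>

lemma Z_hA: "\<bar>Z - h * A\<bar> \<le> 76 * \<kappa> * d * ((1 + q\<^sup>2) / m)"
proof -
  let ?x = "A / (m - 1)"
  have "\<bar>ln (1 + ?x) - ?x\<bar> \<le> 2 * ?x\<^sup>2"
    using abs_ln_one_plus_x_minus_x_bound[OF x_bounds(2)] .
  also have "\<dots> \<le> 2 * (2 * \<bar>A\<bar> / m)\<^sup>2" using power_mono[OF x_bounds(1) abs_ge_zero, of 2] unfolding power2_abs by simp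
  also have "\<dots> = 8 * A\<^sup>2 / m\<^sup>2" by (simp add: power_divide power_mult_distrib)
  finally have "sqrt N * \<bar>ln (1 + ?x) - ?x\<bar> \<le> sqrt N * (8 * A\<^sup>2 / m\<^sup>2)" using N by (intro mult_left_mono) auto
  also have "\<dots> = h * (8 * A\<^sup>2 / m)" by (simp add: h_def power2_eq_square)
  also have "\<dots> \<le> \<kappa> * (d / 2) * (8 * A\<^sup>2 / m)" by (rule inv_sqrt_bound) simp
  also have "\<dots> \<le> \<kappa> * (d / 2) * (8 * (18 * (1 + q\<^sup>2)) / m)" using A_bounds(3) d \<kappa> m0
    by (intro mult_left_mono divide_right_mono) auto
  also have "\<dots> = 72 * \<kappa> * d * ((1 + q\<^sup>2) / m)" using m0 by (simp add: field_simps)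
  finally have "sqrt N * \<bar>ln (1 + ?x) - ?x\<bar> \<le> 72 * \<kappa> * d * ((1 + q\<^sup>2) / m)" .
  moreover have "\<bar>Z - sqrt N * ?x\<bar> = sqrt N * \<bar>ln (1 + ?x) - ?x\<bar>"
    unfolding Z_def right_diff_distrib[symmetric] abs_mult using N by (simp only: abs_of_pos real_sqrt_gt_zero)
  ultimately have 1: "\<bar>Z - sqrt N * ?x\<bar> \<le> 72 * \<kappa> * d * ((1 + q\<^sup>2) / m)" by simp
  have "sqrt N * ?x - h * A = h * (?x * 1)"
    unfolding h_def using m_ge by (simp add: field_simps)
  then have "\<bar>sqrt N * ?x - h * A\<bar> = h * \<bar>?x\<bar>" using h(1) by (simp only: abs_mult abs_of_pos mult_1_right)
  also have "\<dots> \<le> h * (2 * \<bar>A\<bar> / m)" using h x_bounds(1) by (intro mult_left_mono) auto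
  also have "\<dots> \<le> \<kappa> * (d / 2) * (2 * \<bar>A\<bar> / m)" by (rule inv_sqrt_bound) simp
  also have "\<dots> \<le> \<kappa> * (d / 2) * (2 * (4 * (1 + q\<^sup>2)) / m)"
  proof -
    have "\<bar>A\<bar> \<le> 4 + q\<^sup>2" using A_bounds(1) abs_le_one_plus_square[of q] by simp
    also have "\<dots> \<le> 4 * (1 + q\<^sup>2)" by simp
    finally have "\<bar>A\<bar> \<le> 4 * (1 + q\<^sup>2)" .
    then show ?thesis using d \<kappa> m0 by (intro mult_left_mono divide_right_mono) auto
  qed
  also have "\<dots> = 4 * \<kappa> * d * ((1 + q\<^sup>2) / m)" using m0 by (simp add: field_simps)
  finally have 2: "\<bar>sqrt N * ?x - h * A\<bar> \<le> 4 * \<kappa> * d * ((1 + q\<^sup>2) / m)" .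
  show ?thesis using abs_triangle_ineq[of "Z - sqrt N * ?x" "sqrt N * ?x - h * A"] 1 2 by simp
qed

lemma A_q: "\<bar>A + q\<bar> \<le> 2 * d * (1 + q)"
proof -
  have e: "A + q = (1 + q) * ((s - 1) / s)" using s(1) by (simp add: A_def field_simps)
  have "\<bar>(s - 1) / s\<bar> \<le> d / (1/2)" unfolding abs_divide using s d by (intro frac_le) auto
  then have "(1 + q) * \<bar>(s - 1) / s\<bar> \<le> (1 + q) * (d / (1/2))" using q by (intro mult_left_mono)
  moreover have "\<bar>A + q\<bar> = (1 + q) * \<bar>(s - 1) / s\<bar>" unfolding e abs_mult using q by (simp only: abs_of_nonneg)
  ultimately show ?thesis by (simp add: mult_ac)
qed

text \<open>With u = w / sqrt m, A equals -q + u + q u - (1 + q) u^2 / (1 + u). The last term gains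
  a factor d from |u| <= d. The terms u and q u, times h, are of the order of \<open>e\<close>
  without a factor d, so they must be kept: only their means are small.\<close>

lemma Z_linear: "\<bar>Z - h * (- q + w / sqrt m + q * (w / sqrt m))\<bar> \<le> 78 * \<kappa> * d * e"
proof -
  have "A - (- q + w / sqrt m + q * (w / sqrt m)) = - (1 + q) * ((s - 1) * ((s - 1) / s))"
    using s(1) unfolding s(3)[symmetric] by (simp add: A_def field_simps)
  then have "\<bar>A - (- q + w / sqrt m + q * (w / sqrt m))\<bar> = (1 + q) * (\<bar>s - 1\<bar> * \<bar>(s - 1) / s\<bar>)"
    using q by (simp only: abs_mult abs_minus_cancel abs_of_nonneg)
  also have "\<dots> \<le> (1 + q) * (\<bar>s - 1\<bar> * (d / (1/2)))"
  proof -
    have "\<bar>(s - 1) / s\<bar> \<le> d / (1/2)" unfolding abs_divide using s d by (intro frac_le) auto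
    then show ?thesis using q by (intro mult_left_mono) auto
  qed
  also have "\<dots> = 2 * d * ((1 + q) * \<bar>w\<bar>) / sqrt m" unfolding s(3) abs_divide using sqm by simp
  also have "\<dots> \<le> 2 * d * ((1 + \<bar>q\<bar>) * \<bar>w\<bar>) / sqrt m" using d sqm by (intro divide_right_mono mult_left_mono mult_right_mono) auto
  finally have "h * \<bar>A - (- q + w / sqrt m + q * (w / sqrt m))\<bar> \<le> h * (2 * d * ((1 + \<bar>q\<bar>) * \<bar>w\<bar>) / sqrt m)"
    using h by (intro mult_left_mono) auto
  also have "\<dots> \<le> \<kappa> * (2 * d * ((1 + \<bar>q\<bar>) * \<bar>w\<bar>) / sqrt m) / sqrt m" using d sqm by (intro inv_sqrt_bound) auto
  also have "\<dots> = 2 * \<kappa> * d * ((\<bar>q\<bar> * \<bar>w\<bar> + \<bar>w\<bar>) / m)" using sqm by (simp add: field_simps)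
  also have "\<dots> \<le> 2 * \<kappa> * d * e" using e_ge d \<kappa> by (intro mult_left_mono) auto
  finally have 1: "\<bar>h * A - h * (- q + w / sqrt m + q * (w / sqrt m))\<bar> \<le> 2 * \<kappa> * d * e"
    using h by (simp add: right_diff_distrib[symmetric] abs_mult)
  have "76 * \<kappa> * d * ((1 + q\<^sup>2) / m) \<le> 76 * \<kappa> * d * e" using e_ge d \<kappa> by (intro mult_left_mono) auto
  then show ?thesis using 1 Z_hA abs_triangle_ineq[of "Z - h * A" "h * A - h * (- q + w / sqrt m + q * (w / sqrt m))"] by simp
qed

lemma Z_bounds: "\<bar>Z\<bar> \<le> 4 * \<kappa> * \<bar>A\<bar> / sqrt m" "\<bar>Z\<bar> \<le> 12 * \<kappa> * d" "Z\<^sup>2 \<le> 288 * \<kappa>\<^sup>2 * e"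
proof -
  let ?x = "A / (m - 1)"
  have "\<bar>ln (1 + ?x) - ?x\<bar> \<le> 2 * ?x\<^sup>2"
    using abs_ln_one_plus_x_minus_x_bound[OF x_bounds(2)] .
  also have "\<dots> = 2 * \<bar>?x\<bar> * \<bar>?x\<bar>" by (simp add: power2_eq_square)
  also have "\<dots> \<le> 2 * (1/2) * \<bar>?x\<bar>" using x_bounds(2) by (intro mult_right_mono mult_left_mono) auto
  finally have "\<bar>ln (1 + ?x)\<bar> \<le> 2 * \<bar>?x\<bar>" by linarith
  then have "\<bar>ln (1 + ?x)\<bar> \<le> 4 * \<bar>A\<bar> / m" using x_bounds(1) by simp
  then have "\<bar>Z\<bar> \<le> sqrt N * (4 * \<bar>A\<bar> / m)" unfolding Z_def abs_mult using N mult_left_mono[OF \<open>_ \<le> 4 * \<bar>A\<bar> / m\<close>, of "sqrt N"] by (simp only: abs_of_pos real_sqrt_gt_zero real_sqrt_ge_zero less_imp_le)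
  also have "\<dots> = h * (4 * \<bar>A\<bar>)" by (simp add: h_def)
  also have "\<dots> \<le> \<kappa> * (4 * \<bar>A\<bar>) / sqrt m" by (rule inv_sqrt_bound) simp
  finally show 1: "\<bar>Z\<bar> \<le> 4 * \<kappa> * \<bar>A\<bar> / sqrt m" by (simp only: mult_ac)
  also have "\<dots> \<le> 4 * \<kappa> * (3 * d * sqrt m) / sqrt m" using A_bounds(2) \<kappa> sqm by (intro divide_right_mono mult_left_mono) auto
  finally show "\<bar>Z\<bar> \<le> 12 * \<kappa> * d" using sqm by simp
  have "Z\<^sup>2 \<le> (4 * \<kappa> * \<bar>A\<bar> / sqrt m)\<^sup>2" using 1 by (metis abs_ge_zero power2_abs power_mono)
  also have "\<dots> = 16 * \<kappa>\<^sup>2 * A\<^sup>2 / m" using m0 by (simp add: power_divide power_mult_distrib)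
  also have "\<dots> \<le> 16 * \<kappa>\<^sup>2 * (18 * (1 + q\<^sup>2)) / m" using A_bounds(3) m0 by (intro divide_right_mono mult_left_mono) auto
  also have "\<dots> = 288 * \<kappa>\<^sup>2 * ((1 + q\<^sup>2) / m)" by simp
  also have "\<dots> \<le> 288 * \<kappa>\<^sup>2 * e" using e_ge by (intro mult_left_mono) auto
  finally show "Z\<^sup>2 \<le> 288 * \<kappa>\<^sup>2 * e" .
qed

lemma Z_cube: "\<bar>Z\<bar> ^ 3 \<le> 3456 * \<kappa> ^ 3 * d * e"
proof -
  have "\<bar>Z\<bar> ^ 3 = \<bar>Z\<bar> * Z\<^sup>2" by (simp add: power3_eq_cube power2_eq_square)
  also have "\<dots> \<le> (12 * \<kappa> * d) * (288 * \<kappa>\<^sup>2 * e)" using Z_bounds d \<kappa> by (intro mult_mono) auto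
  finally show ?thesis by (simp add: power3_eq_cube power2_eq_square mult_ac)
qed

lemma Z_square: "\<bar>Z\<^sup>2 - h\<^sup>2 * q\<^sup>2\<bar> \<le> 352 * \<kappa>\<^sup>2 * d * e"
proof -
  have hq: "h * \<bar>q\<bar> \<le> \<kappa> * \<bar>q\<bar> / sqrt m" by (rule inv_sqrt_bound) simp
  have qd: "\<bar>q\<bar> \<le> d * sqrt m" using q dm by auto
  have "\<kappa> * \<bar>q\<bar> / sqrt m \<le> \<kappa> * d" using qd \<kappa> sqm by (simp add: pos_divide_le_eq mult_left_mono)
  then have "\<bar>Z - h * q\<bar> \<le> 13 * \<kappa> * d"
    using abs_triangle_ineq4[of Z "h * q"] hq Z_bounds(2) h by (simp add: abs_mult)
  also have "\<dots> \<le> 13 * \<kappa> * (1/4)" using d \<kappa> by (intro mult_left_mono) auto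
  finally have B1: "\<bar>Z - h * q\<bar> \<le> 4 * \<kappa>" using \<kappa> by simp
  have "4 * \<kappa> * \<bar>A\<bar> / sqrt m \<le> 4 * \<kappa> * (3 + 2 * \<bar>q\<bar>) / sqrt m" using A_bounds(1) \<kappa> sqm by (intro divide_right_mono mult_left_mono) auto
  then have "\<bar>Z - h * q\<bar> \<le> 4 * \<kappa> * (3 + 2 * \<bar>q\<bar>) / sqrt m + \<kappa> * \<bar>q\<bar> / sqrt m"
    using abs_triangle_ineq4[of Z "h * q"] hq Z_bounds(1) h by (simp add: abs_mult)
  also have "\<dots> = (12 * \<kappa> + 9 * \<kappa> * \<bar>q\<bar>) / sqrt m" by (simp add: add_divide_distrib[symmetric] algebra_simps)
  also have "\<dots> \<le> 12 * \<kappa> * (1 + \<bar>q\<bar>) / sqrt m" using \<kappa> sqm by (intro divide_right_mono) (auto simp: algebra_simps)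
  finally have B2: "\<bar>Z - h * q\<bar> \<le> 12 * \<kappa> * (1 + \<bar>q\<bar>) / sqrt m" .
  have "\<bar>h * (A + q)\<bar> \<le> h * (2 * d * (1 + \<bar>q\<bar>))"
    unfolding abs_mult using A_q h d by (intro mult_mono order_trans[OF A_q] mult_left_mono) auto
  also have "\<dots> \<le> \<kappa> * (2 * d * (1 + \<bar>q\<bar>)) / sqrt m" using d by (intro inv_sqrt_bound) auto
  finally have B3: "\<bar>h * (A + q)\<bar> \<le> \<kappa> * (2 * d * (1 + \<bar>q\<bar>)) / sqrt m" .
  \<comment> \<open>Difference of squares: Z is close to -h q, so Z + h q is the small factor, and
    it is split through h A.\<close>
  have "Z\<^sup>2 - h\<^sup>2 * q\<^sup>2 = (Z - h * A) * (Z - h * q) + h * (A + q) * (Z - h * q)"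
    by (simp add: power2_eq_square algebra_simps)
  then have "\<bar>Z\<^sup>2 - h\<^sup>2 * q\<^sup>2\<bar> \<le> \<bar>Z - h * A\<bar> * \<bar>Z - h * q\<bar> + \<bar>h * (A + q)\<bar> * \<bar>Z - h * q\<bar>"
    using abs_triangle_ineq[of "(Z - h * A) * (Z - h * q)" "h * (A + q) * (Z - h * q)"] by (simp add: abs_mult)
  also have "\<dots> \<le> (76 * \<kappa> * d * ((1 + q\<^sup>2) / m)) * (4 * \<kappa>) + (\<kappa> * (2 * d * (1 + \<bar>q\<bar>)) / sqrt m) * (12 * \<kappa> * (1 + \<bar>q\<bar>) / sqrt m)"
    using Z_hA B1 B2 B3 d \<kappa> m0 sqm by (intro add_mono mult_mono) (auto intro!: divide_nonneg_nonneg mult_nonneg_nonneg)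
  also have "\<dots> = 304 * \<kappa>\<^sup>2 * d * ((1 + q\<^sup>2) / m) + 24 * \<kappa>\<^sup>2 * d * ((1 + \<bar>q\<bar>)\<^sup>2 / m)"
    unfolding times_divide_times_eq sqm(2) power2_eq_square[of \<kappa>] power2_eq_square[of "1 + \<bar>q\<bar>"] by (simp add: algebra_simps)
  also have "\<dots> \<le> 304 * \<kappa>\<^sup>2 * d * ((1 + q\<^sup>2) / m) + 24 * \<kappa>\<^sup>2 * d * (2 * (1 + q\<^sup>2) / m)"
  proof -
    have "(1 + \<bar>q\<bar>)\<^sup>2 \<le> 2 * (1 + q\<^sup>2)" using zero_le_power2[of "\<bar>q\<bar> - 1"] by (simp add: power2_sum power2_diff)
    then show ?thesis using d m0 by (intro add_left_mono mult_left_mono divide_right_mono) auto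
  qed
  also have "\<dots> = 352 * \<kappa>\<^sup>2 * d * ((1 + q\<^sup>2) / m)" using m0 by (simp add: field_simps)
  also have "\<dots> \<le> 352 * \<kappa>\<^sup>2 * d * e" using e_ge d by (intro mult_left_mono) auto
  finally show ?thesis .
qed

text \<open>Second-order Taylor expansion of the exponential. The three coefficients come from
  \<open>Z_linear\<close> (78), half of \<open>Z_square\<close> (352/2) and a sixth of
  \<open>Z_cube\<close> (3456/6).\<close>

lemma char_expansion:
  "cmod (exp (\<i> * of_real (t * Z)) - Complex (1 - t\<^sup>2 * h\<^sup>2 * q\<^sup>2 / 2) (t * h * (- q + w / sqrt m + q * (w / sqrt m))))
    \<le> (78 * \<bar>t\<bar> * \<kappa> + 176 * t\<^sup>2 * \<kappa>\<^sup>2 + 576 * \<bar>t\<bar> ^ 3 * \<kappa> ^ 3) * d * e"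
proof -
  let ?B = "- q + w / sqrt m + q * (w / sqrt m)"
  have 1: "cmod (exp (\<i> * of_real (t * Z)) - Complex (1 - (t * Z)\<^sup>2 / 2) (t * Z)) \<le> 576 * \<bar>t\<bar> ^ 3 * \<kappa> ^ 3 * d * e"
  proof -
    have "\<bar>t * Z\<bar> ^ 3 / 6 = \<bar>t\<bar> ^ 3 * \<bar>Z\<bar> ^ 3 / 6" by (simp add: abs_mult power_mult_distrib)
    also have "\<dots> \<le> \<bar>t\<bar> ^ 3 * (3456 * \<kappa> ^ 3 * d * e) / 6" using Z_cube by (intro divide_right_mono mult_left_mono) auto
    also have "\<dots> = 576 * \<bar>t\<bar> ^ 3 * \<kappa> ^ 3 * d * e" by simp
    finally show ?thesis by (rule order_trans[OF iexp_quadratic_approx])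
  qed
  have e: "Complex (1 - (t * Z)\<^sup>2 / 2) (t * Z) - Complex (1 - t\<^sup>2 * h\<^sup>2 * q\<^sup>2 / 2) (t * h * ?B)
     = Complex (- (t\<^sup>2 * (Z\<^sup>2 - h\<^sup>2 * q\<^sup>2) / 2)) (t * (Z - h * ?B))"
    by (simp add: complex_eq_iff power_mult_distrib) (simp add: field_simps)
  have "cmod (Complex (1 - (t * Z)\<^sup>2 / 2) (t * Z) - Complex (1 - t\<^sup>2 * h\<^sup>2 * q\<^sup>2 / 2) (t * h * ?B))
     \<le> t\<^sup>2 * \<bar>Z\<^sup>2 - h\<^sup>2 * q\<^sup>2\<bar> / 2 + \<bar>t\<bar> * \<bar>Z - h * ?B\<bar>"
    unfolding e using cmod_le[of "Complex (- (t\<^sup>2 * (Z\<^sup>2 - h\<^sup>2 * q\<^sup>2) / 2)) (t * (Z - h * ?B))"]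
    by (simp add: abs_mult)
  also have "\<dots> \<le> t\<^sup>2 * (352 * \<kappa>\<^sup>2 * d * e) / 2 + \<bar>t\<bar> * (78 * \<kappa> * d * e)"
    using Z_square Z_linear by (intro add_mono divide_right_mono mult_left_mono) auto
  finally have 2: "cmod (Complex (1 - (t * Z)\<^sup>2 / 2) (t * Z) - Complex (1 - t\<^sup>2 * h\<^sup>2 * q\<^sup>2 / 2) (t * h * ?B))
     \<le> 176 * t\<^sup>2 * \<kappa>\<^sup>2 * d * e + 78 * \<bar>t\<bar> * \<kappa> * d * e" by (simp add: mult_ac)
  show ?thesis using norm_triangle_mono[OF 1 2] by (simp add: algebra_simps)
qed

end

section \<open>Revealing one row\<close>

text \<open>The earlier rows are frozen: P projects onto the complement of their span, v is the unit
  vector along P u, and x is the next row. The level \<open>d ^ 4\<close> in the tail hypothesis is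
  chosen so that a factor d^2 survives division by the squared threshold d^2 m.\<close>

locale row_step = iid_seq D M x for D and M :: "'a measure" and x +
  fixes n :: nat and P :: "nat \<Rightarrow> nat \<Rightarrow> real" and v :: "nat \<Rightarrow> real" and m d T :: real
  assumes P: "is_proj n P" and tr: "trace n P = m" and Pv: "\<And>i. i < n \<Longrightarrow> mv n P v i = v i" and v1: "dot n v v = 1"
    and m0: "0 < m" and d: "0 < d" "d \<le> 1/4" and T: "0 < T" and dT: "T + 2 \<le> d * sqrt m"
    and UI: "\<And>A. (\<Sum>i<n. \<Sum>j<n. (A i j)\<^sup>2) \<le> 1 \<Longrightarrow> (\<And>i j. i < n \<Longrightarrow> j < n \<Longrightarrow> A i j = A j i) \<Longrightarrow>
       expectation (\<lambda>\<omega>. (quad A n \<omega>)\<^sup>2 * indicator {y. T < \<bar>y\<bar>} (quad A n \<omega>)) \<le> d ^ 4"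
begin

definition "xi \<omega> = dot n v (\<lambda>i. x i \<omega>)"
definition "sc \<omega> = dot n (\<lambda>i. x i \<omega>) (mv n P (\<lambda>i. x i \<omega>)) / m"
definition "good \<omega> \<longleftrightarrow> \<bar>sc \<omega> - 1\<bar> \<le> d \<and> (xi \<omega>)\<^sup>2 \<le> d * sqrt m"
definition "q = quad (\<lambda>i j. v i * v j) n"
definition "w = quad (\<lambda>i j. P i j / sqrt m) n"
definition "psi = (\<Sum>i<n. v i ^ 4)"

lemma sqm: "0 < sqrt m" "sqrt m * sqrt m = m" "1 / sqrt m \<le> d / 2" "2 \<le> d * sqrt m"
  using m0 dT T by (simp_all add: field_simps)

lemma m_bounds: "1 \<le> m" "1 / m \<le> d"
proof -
  have "2 \<le> 1/4 * sqrt m" using sqm d by (smt (verit) mult_right_mono)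
  then have 8: "8 \<le> sqrt m" by simp
  then have "1 \<le> sqrt m" by linarith
  then show m1: "1 \<le> m" by (simp only: real_sqrt_ge_1_iff)
  have "1 / m = 1 / sqrt m * (1 / sqrt m)" using sqm by simp
  also have "\<dots> \<le> d / 2 * 1" using sqm(3) d m1 by (intro mult_mono) simp_all
  finally show "1 / m \<le> d" using d by simp
qed

lemma xi_lf: "xi \<omega> = lf v n \<omega>" by (simp add: xi_def dot_def lin_def)

lemma mv_lf: "mv n P (\<lambda>i. x i \<omega>) i = lf (P i) n \<omega>" by (simp add: mv_def lin_def)

lemma meas [measurable]: "xi \<in> borel_measurable M" "sc \<in> borel_measurable M" "q \<in> borel_measurable M" "w \<in> borel_measurable M"
proof -
  show "xi \<in> borel_measurable M" using lin_meas[of "\<lambda>y. y" v n] by (simp add: xi_lf[abs_def])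
  show "sc \<in> borel_measurable M" unfolding sc_def[abs_def] dot_def mv_def by measurable
  show "q \<in> borel_measurable M" "w \<in> borel_measurable M" unfolding q_def w_def by measurable
qed

lemma good_meas [measurable]: "Measurable.pred M good"
  unfolding good_def[abs_def] by measurable

lemma q_eq: "(xi \<omega>)\<^sup>2 = 1 + q \<omega>"
proof -
  have "(xi \<omega>)\<^sup>2 = (\<Sum>i<n. \<Sum>j<n. v i * v j * x i \<omega> * x j \<omega>)"
    by (simp add: xi_def dot_def power2_eq_square sum_product) (simp add: mult_ac)
  moreover have "(\<Sum>i<n. v i * v i) = 1" using v1 by (simp add: dot_def)
  ultimately show ?thesis unfolding q_def by (subst quad_eq) (auto simp: mult_ac)
qed

lemma w_eq: "sc \<omega> = 1 + w \<omega> / sqrt m"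
proof -
  have "w \<omega> = (\<Sum>i<n. \<Sum>j<n. P i j / sqrt m * x i \<omega> * x j \<omega>) - (\<Sum>i<n. P i i / sqrt m)"
    unfolding w_def by (rule quad_eq) (simp add: proj_sym[OF P])
  also have "(\<Sum>i<n. P i i / sqrt m) = m / sqrt m" using tr by (simp add: trace_def sum_divide_distrib[symmetric])
  also have "(\<Sum>i<n. \<Sum>j<n. P i j / sqrt m * x i \<omega> * x j \<omega>) = m * sc \<omega> / sqrt m"
    using m0 by (simp add: sc_def dot_def mv_def sum_divide_distrib sum_distrib_left mult_ac)
  finally have "w \<omega> = (m * sc \<omega> - m) / sqrt m" by (simp add: diff_divide_distrib)
  then have "w \<omega> / sqrt m = (m * sc \<omega> - m) / m" using sqm(2) by (simp only: divide_divide_eq_left)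
  then show ?thesis using m0 by (simp add: diff_divide_distrib)
qed

lemma good_iff: "good \<omega> \<longleftrightarrow> \<bar>w \<omega>\<bar> \<le> d * sqrt m \<and> 1 + q \<omega> \<le> d * sqrt m"
  unfolding good_def q_eq using sqm by (auto simp: w_eq abs_divide pos_divide_le_eq)

lemma frob_v: "(\<Sum>i<n. \<Sum>j<n. (v i * v j)\<^sup>2) \<le> 1"
proof -
  have "(\<Sum>i<n. \<Sum>j<n. (v i * v j)\<^sup>2) = (\<Sum>i<n. (v i)\<^sup>2) * (\<Sum>j<n. (v j)\<^sup>2)"
    by (simp add: sum_product power_mult_distrib)
  also have "(\<Sum>i<n. (v i)\<^sup>2) = 1" using v1 by (simp add: dot_def power2_eq_square)
  finally show ?thesis by simp
qed

lemma frob_P: "(\<Sum>i<n. \<Sum>j<n. (P i j / sqrt m)\<^sup>2) \<le> 1"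
proof -
  have "(\<Sum>i<n. \<Sum>j<n. (P i j / sqrt m)\<^sup>2) = (\<Sum>i<n. \<Sum>j<n. (P i j)\<^sup>2) / m"
    using m0 by (simp add: power_divide sum_divide_distrib)
  then show ?thesis using m0 by (simp add: proj_frobenius[OF P] tr)
qed

lemma q_int: "integrable M (\<lambda>\<omega>. (q \<omega>)\<^sup>2)" "integrable M q" "expectation q = 0" "expectation (\<lambda>\<omega>. (q \<omega>)\<^sup>2) \<le> kurt + 1"
    "expectation (\<lambda>\<omega>. (q \<omega>)\<^sup>2) = (kurt - 3) * psi + 2"
proof -
  show "integrable M (\<lambda>\<omega>. (q \<omega>)\<^sup>2)" "integrable M q" "expectation q = 0"
    unfolding q_def by (simp_all add: quad_square_integrable expectation_quad)
  show "expectation (\<lambda>\<omega>. (q \<omega>)\<^sup>2) \<le> kurt + 1" unfolding q_def by (rule quad_second_moment_le[OF frob_v]) (simp add: mult.commute)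
  have "expectation (\<lambda>\<omega>. q \<omega> * q \<omega>) = (kurt - 3) * (\<Sum>i<n. (v i * v i) * (v i * v i)) + 2 * (\<Sum>i<n. \<Sum>j<n. (v i * v j) * (v i * v j))"
    unfolding q_def by (rule quad_cov_symmetric) (simp_all add: mult.commute)
  also have "(\<Sum>i<n. \<Sum>j<n. (v i * v j) * (v i * v j)) = dot n v v * dot n v v"
    by (simp add: dot_def sum_product mult_ac)
  finally show "expectation (\<lambda>\<omega>. (q \<omega>)\<^sup>2) = (kurt - 3) * psi + 2"
    by (simp add: v1 psi_def power2_eq_square power4_eq_xxxx mult.assoc)
qed

lemma w_int: "integrable M (\<lambda>\<omega>. (w \<omega>)\<^sup>2)" "integrable M w" "expectation w = 0" "expectation (\<lambda>\<omega>. (w \<omega>)\<^sup>2) \<le> kurt + 1"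
proof -
  show "integrable M (\<lambda>\<omega>. (w \<omega>)\<^sup>2)" "integrable M w" "expectation w = 0"
    unfolding w_def by (simp_all add: quad_square_integrable expectation_quad)
  show "expectation (\<lambda>\<omega>. (w \<omega>)\<^sup>2) \<le> kurt + 1" unfolding w_def by (rule quad_second_moment_le[OF frob_P]) (simp add: proj_sym[OF P])
qed

text \<open>The matrices of the two forms are v v^T and P / sqrt m. Their trace product is v.Pv /
  sqrt m = 1 / sqrt m, because P fixes v, and the diagonal contribution is no larger, because the
  diagonal of P lies in [0,1].\<close>

lemma qw_int: "integrable M (\<lambda>\<omega>. q \<omega> * w \<omega>)" "\<bar>expectation (\<lambda>\<omega>. q \<omega> * w \<omega>)\<bar> \<le> (kurt + 5) / sqrt m"
proof -
  show "integrable M (\<lambda>\<omega>. q \<omega> * w \<omega>)" unfolding q_def w_def by (rule quad_cov)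
  have "expectation (\<lambda>\<omega>. q \<omega> * w \<omega>) = (kurt - 3) * (\<Sum>i<n. (v i * v i) * (P i i / sqrt m)) + 2 * (\<Sum>i<n. \<Sum>j<n. (v i * v j) * (P i j / sqrt m))"
    unfolding q_def w_def by (rule quad_cov_symmetric) (simp_all add: mult.commute proj_sym[OF P])
  also have "(\<Sum>i<n. \<Sum>j<n. (v i * v j) * (P i j / sqrt m)) = dot n v (mv n P v) / sqrt m"
    by (simp add: dot_def mv_def sum_divide_distrib sum_distrib_left mult_ac)
  also have "dot n v (mv n P v) = 1" using v1 by (simp add: Pv cong: dot_cong)
  also have "(\<Sum>i<n. (v i * v i) * (P i i / sqrt m)) = (\<Sum>i<n. (v i * v i) * P i i) / sqrt m"
    by (simp add: sum_divide_distrib)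
  finally have e: "expectation (\<lambda>\<omega>. q \<omega> * w \<omega>) = ((kurt - 3) * (\<Sum>i<n. (v i * v i) * P i i) + 2) / sqrt m"
    by (simp add: add_divide_distrib)
  have "0 \<le> (\<Sum>i<n. (v i * v i) * P i i)" using proj_diag[OF P] by (auto intro!: sum_nonneg)
  moreover have "(\<Sum>i<n. (v i * v i) * P i i) \<le> (\<Sum>i<n. (v i * v i) * 1)"
    using proj_diag[OF P] by (intro sum_mono mult_left_mono) auto
  ultimately have "\<bar>\<Sum>i<n. (v i * v i) * P i i\<bar> \<le> 1" using v1 by (simp add: dot_def)
  then have "\<bar>(kurt - 3) * (\<Sum>i<n. (v i * v i) * P i i)\<bar> \<le> (kurt + 3) * 1"
    unfolding abs_mult using kurt_ge_1 by (intro mult_mono) auto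
  moreover have "\<bar>y + 2\<bar> \<le> kurt + 5" if "\<bar>y\<bar> \<le> (kurt + 3) * 1" for y using that by simp
  ultimately have "\<bar>(kurt - 3) * (\<Sum>i<n. (v i * v i) * P i i) + 2\<bar> \<le> kurt + 5" by blast
  then show "\<bar>expectation (\<lambda>\<omega>. q \<omega> * w \<omega>)\<bar> \<le> (kurt + 5) / sqrt m"
    unfolding e abs_divide using sqm by (simp add: divide_right_mono)
qed

lemma pos_one: "(0::real) < 1"
  by simp

definition "bad \<omega> = (if good \<omega> then 0 else 1 :: real)"

lemma bad_meas [measurable]: "bad \<in> borel_measurable M"
  unfolding bad_def[abs_def] by measurable

lemma bad_integrable: "integrable M (\<lambda>\<omega>. bad \<omega>)"
  by (rule integrable_const_bound[where B=1]) (auto simp: bad_def)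

text \<open>Chebyshev applied to the truncated squares. A failure means |w| > d sqrt m or, as 1 <= d
  sqrt m / 2, q > d sqrt m / 2; both values exceed T. Hence d^2 m times the probability is at most
  (4 + 1) d^4.\<close>

lemma bad_le: "expectation bad \<le> 5 * d\<^sup>2 / m"
proof -
  let ?q = "\<lambda>\<omega>. (q \<omega>)\<^sup>2 * indicator {y. T < \<bar>y\<bar>} (q \<omega>)" and ?w = "\<lambda>\<omega>. (w \<omega>)\<^sup>2 * indicator {y. T < \<bar>y\<bar>} (w \<omega>) :: real"
  have i: "integrable M ?q" "integrable M ?w"
    unfolding q_def w_def using T 
    by (auto intro!: quad_tail_le(1)[OF frob_v _ pos_one] quad_tail_le(1)[OF frob_P _ pos_one] simp: mult.commute proj_sym[OF P])
  have e: "expectation ?q \<le> d ^ 4" "expectation ?w \<le> d ^ 4"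
    unfolding q_def w_def by (rule UI[OF frob_v], simp add: mult.commute, rule UI[OF frob_P], simp add: proj_sym[OF P])
  have dm: "0 < d\<^sup>2 * m" using d m0 by simp
  have pw: "d\<^sup>2 * m * bad \<omega> \<le> 4 * ?q \<omega> + ?w \<omega>" for \<omega>
  proof (cases "good \<omega>")
    case False
    then consider "d * sqrt m < \<bar>w \<omega>\<bar>" | "d * sqrt m < 1 + q \<omega>" unfolding good_iff by linarith
    then show ?thesis
    proof cases
      case 1
      have "(d * sqrt m)\<^sup>2 \<le> (\<bar>w \<omega>\<bar>)\<^sup>2" using 1 d sqm by (intro power_mono) auto
      moreover have "T < \<bar>w \<omega>\<bar>" using 1 dT by linarith
      ultimately show ?thesis using m0 False by (simp add: bad_def power_mult_distrib add_increasing)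
    next
      case 2
      then have q2: "d * sqrt m / 2 < q \<omega>" "T < q \<omega>" using sqm(4) dT by linarith+
      then have "(d * sqrt m / 2)\<^sup>2 \<le> (q \<omega>)\<^sup>2" using d sqm by (intro power_mono) auto
      moreover have "T < \<bar>q \<omega>\<bar>" using q2 by linarith
      ultimately show ?thesis using m0 False by (simp add: bad_def power_mult_distrib power_divide add_increasing2)
    qed
  qed (auto simp: bad_def)
  have "expectation (\<lambda>\<omega>. d\<^sup>2 * m * bad \<omega>) \<le> expectation (\<lambda>\<omega>. 4 * ?q \<omega> + ?w \<omega>)"
    by (rule integral_mono) (use i bad_integrable pw in auto)
  also have "\<dots> = 4 * expectation ?q + expectation ?w" using i by simp
  also have "\<dots> \<le> 5 * d ^ 4" using e by simp
  finally have "d\<^sup>2 * m * expectation bad \<le> 5 * d ^ 4" by simp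
  then have "expectation bad \<le> 5 * d ^ 4 / (d\<^sup>2 * m)" using dm by (simp add: pos_le_divide_eq mult.commute)
  also have "\<dots> = 5 * d\<^sup>2 / m" using d by (simp add: power2_eq_square power4_eq_xxxx)
  finally show ?thesis .
qed

text \<open>Above T the truncated moments apply. Below T each square is at most T^2 <= d^2 m, which
  \<open>bad_le\<close> compensates: 2 + 2 * 5 = 12.\<close>

lemma bad_weighted: "integrable M (\<lambda>\<omega>. ((q \<omega>)\<^sup>2 + (w \<omega>)\<^sup>2) * bad \<omega>)"
   "expectation (\<lambda>\<omega>. ((q \<omega>)\<^sup>2 + (w \<omega>)\<^sup>2) * bad \<omega>) \<le> 12 * d ^ 4"
proof -
  let ?q = "\<lambda>\<omega>. (q \<omega>)\<^sup>2 * indicator {y. T < \<bar>y\<bar>} (q \<omega>)" and ?w = "\<lambda>\<omega>. (w \<omega>)\<^sup>2 * indicator {y. T < \<bar>y\<bar>} (w \<omega>) :: real"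
  have i: "integrable M ?q" "integrable M ?w"
    unfolding q_def w_def using T
    by (auto intro!: quad_tail_le(1)[OF frob_v _ pos_one] quad_tail_le(1)[OF frob_P _ pos_one] simp: mult.commute proj_sym[OF P])
  have e: "expectation ?q \<le> d ^ 4" "expectation ?w \<le> d ^ 4"
    unfolding q_def w_def by (rule UI[OF frob_v], simp add: mult.commute, rule UI[OF frob_P], simp add: proj_sym[OF P])
  have *: "y\<^sup>2 * bad \<omega> \<le> y\<^sup>2 * indicator {y. T < \<bar>y\<bar>} y + T\<^sup>2 * bad \<omega>" for y \<omega>
  proof (cases "T < \<bar>y\<bar>")
    case False
    then have "y\<^sup>2 \<le> T\<^sup>2" using T by (auto simp: abs_le_square_iff[symmetric])
    then show ?thesis using False by (auto simp: bad_def)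
  qed (auto simp: bad_def)
  have pw: "((q \<omega>)\<^sup>2 + (w \<omega>)\<^sup>2) * bad \<omega> \<le> ?q \<omega> + ?w \<omega> + 2 * T\<^sup>2 * bad \<omega>" for \<omega>
    using *[of "q \<omega>" \<omega>] *[of "w \<omega>" \<omega>] by (simp add: algebra_simps)
  have i2: "integrable M (\<lambda>\<omega>. ?q \<omega> + ?w \<omega> + 2 * T\<^sup>2 * bad \<omega>)" using i bad_integrable by simp
  have 1: "integrable M (\<lambda>\<omega>. ((q \<omega>)\<^sup>2 + (w \<omega>)\<^sup>2) * bad \<omega>) \<and>
    expectation (\<lambda>\<omega>. ((q \<omega>)\<^sup>2 + (w \<omega>)\<^sup>2) * bad \<omega>) \<le> expectation (\<lambda>\<omega>. ?q \<omega> + ?w \<omega> + 2 * T\<^sup>2 * bad \<omega>)"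
    by (rule integral_mono_real[OF i2]) (use pw in \<open>auto simp: bad_def\<close>)
  then show "integrable M (\<lambda>\<omega>. ((q \<omega>)\<^sup>2 + (w \<omega>)\<^sup>2) * bad \<omega>)" by simp
  have "expectation (\<lambda>\<omega>. ?q \<omega> + ?w \<omega> + 2 * T\<^sup>2 * bad \<omega>) = expectation ?q + expectation ?w + 2 * T\<^sup>2 * expectation bad"
    using i bad_integrable by simp
  also have "\<dots> \<le> d ^ 4 + d ^ 4 + 2 * (d\<^sup>2 * m) * (5 * d\<^sup>2 / m)"
  proof -
    have "T\<^sup>2 \<le> (d * sqrt m)\<^sup>2" using T dT by (intro power_mono) auto
    then have t: "2 * T\<^sup>2 \<le> 2 * (d\<^sup>2 * m)" using m0 by (simp add: power_mult_distrib)
    show ?thesis by (intro add_mono e mult_mono[OF t bad_le]) (use m0 in \<open>auto intro!: integral_nonneg_AE simp: bad_def\<close>)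
  qed
  also have "\<dots> = 12 * d ^ 4" using m0 by (simp add: power2_eq_square power4_eq_xxxx)
  finally show "expectation (\<lambda>\<omega>. ((q \<omega>)\<^sup>2 + (w \<omega>)\<^sup>2) * bad \<omega>) \<le> 12 * d ^ 4" using 1 by simp
qed

end

text \<open>The first summand is the expansion error on the good event times a bound 2 kurt + 3 for
  the mean of 1 + q^2 + w^2. Then come the cost 5 + 12 of the bad event, the fourth-power correction
  to the variance, and the correlation of q and w.\<close>

definition (in std_law) char_const :: "real \<Rightarrow> real \<Rightarrow> real" where
  "char_const k t = (78 * \<bar>t\<bar> * k + 176 * t\<^sup>2 * k\<^sup>2 + 576 * \<bar>t\<bar> ^ 3 * k ^ 3) * (2 * kurt + 3)
     + 17 * (1 + 2 * \<bar>t\<bar> * k + t\<^sup>2 * k\<^sup>2) + t\<^sup>2 * k\<^sup>2 * (kurt + 3) + \<bar>t\<bar> * k * (kurt + 5)"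

section \<open>Characteristic function of one logarithmic increment\<close>

context row_step
begin

definition "log_incr N \<omega> = sqrt N * ln (1 + (1 - (xi \<omega>)\<^sup>2 / sc \<omega>) / (m - 1))"

lemma log_incr_meas [measurable]: "log_incr N \<in> borel_measurable M"
  unfolding log_incr_def[abs_def] by measurable

lemma psi_nonneg: "0 \<le> psi"
  by (auto simp: psi_def intro: sum_nonneg)

text \<open>The exponential is compared with the quadratic polynomial of
  \<open>char_expansion\<close>, whose mean is explicit: q and w are centred, so the linear part
  contributes only the mean of q w, and E q^2 = 2 + (kurt - 3) psi produces the main term t^2 h^2
  together with an error proportional to \<open>psi\<close>.\<close>

lemma char_step:
  assumes N: "0 < N" "N \<le> K * m"
  shows "cmod (expectation (\<lambda>\<omega>. exp (\<i> * of_real (t * log_incr N \<omega>)) * of_real (1 - bad \<omega>)) - of_real (1 - t\<^sup>2 * (sqrt N / m)\<^sup>2))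
    \<le> char_const (sqrt K) t * (d + psi) / m"
proof -
  define h where "h = sqrt N / m"
  define \<kappa> where "\<kappa> = sqrt K"
  define C1 where "C1 = 78 * \<bar>t\<bar> * \<kappa> + 176 * t\<^sup>2 * \<kappa>\<^sup>2 + 576 * \<bar>t\<bar> ^ 3 * \<kappa> ^ 3"
  define C2 where "C2 = 1 + 2 * \<bar>t\<bar> * \<kappa> + t\<^sup>2 * \<kappa>\<^sup>2"
  define L where "L \<omega> = t * h * (- q \<omega> + w \<omega> / sqrt m + q \<omega> * (w \<omega> / sqrt m))" for \<omega>
  define R where "R \<omega> = 1 - t\<^sup>2 * h\<^sup>2 * (q \<omega>)\<^sup>2 / 2" for \<omega>
  define F where "F \<omega> = exp (\<i> * of_real (t * log_incr N \<omega>)) * of_real (1 - bad \<omega>)" for \<omega>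
  have K: "0 < K"
  proof -
    have "0 < K * m" using N by linarith
    then show ?thesis using m0 by (simp add: zero_less_mult_iff)
  qed
  have \<kappa>: "0 < \<kappa>" "\<kappa>\<^sup>2 = K" using K by (auto simp: \<kappa>_def)
  have h: "0 < h" "h \<le> \<kappa> / sqrt m" "h\<^sup>2 \<le> \<kappa>\<^sup>2 / m"
  proof -
    show 0: "0 < h" using N m0 by (simp add: h_def)
    have "sqrt N \<le> \<kappa> * sqrt m" unfolding \<kappa>_def real_sqrt_mult[symmetric] using N by simp
    then have "h \<le> \<kappa> * sqrt m / m" using m0 by (simp add: h_def divide_right_mono)
    also have "\<dots> = \<kappa> / sqrt m" using sqm m0 by (simp add: field_simps)
    finally show 1: "h \<le> \<kappa> / sqrt m" .
    have "h\<^sup>2 \<le> (\<kappa> / sqrt m)\<^sup>2" using 0 1 by (intro power_mono) auto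
    then show "h\<^sup>2 \<le> \<kappa>\<^sup>2 / m" using m0 by (simp add: power_divide)
  qed
  have C1: "0 \<le> C1" and C2: "0 \<le> C2" using \<kappa> by (auto simp: C1_def C2_def intro!: add_nonneg_nonneg mult_nonneg_nonneg)
  have [measurable]: "R \<in> borel_measurable M" "L \<in> borel_measurable M" "F \<in> borel_measurable M"
    unfolding R_def[abs_def] L_def[abs_def] F_def[abs_def] by measurable
  have Ri: "integrable M R" "expectation R = 1 - t\<^sup>2 * h\<^sup>2 * ((kurt - 3) * psi + 2) / 2"
    unfolding R_def using q_int by (simp_all add: prob_space)
  have Le: "L \<omega> = t * h * (- q \<omega> + w \<omega> / sqrt m + (q \<omega> * w \<omega>) / sqrt m)" for \<omega> by (simp add: L_def)
  have Li: "integrable M L" "expectation L = t * h * (expectation (\<lambda>\<omega>. q \<omega> * w \<omega>) / sqrt m)"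
    unfolding Le using q_int w_int qw_int by simp_all
  have Fi: "integrable M F"
    by (rule integrable_const_bound[where B=1]) (auto simp: F_def bad_def norm_mult)
  let ?B = "\<lambda>\<omega>. C1 * d * ((1 + (q \<omega>)\<^sup>2 + (w \<omega>)\<^sup>2) / m) + C2 * (bad \<omega> + (((q \<omega>)\<^sup>2 + (w \<omega>)\<^sup>2) * bad \<omega>) / m)"
  have pw: "cmod (F \<omega> - Complex (R \<omega>) (L \<omega>)) \<le> ?B \<omega>" for \<omega>
  proof (cases "good \<omega>")
    case True
    interpret s: step_reals d m N K "q \<omega>" "w \<omega>"
    proof
      show "0 \<le> 1 + q \<omega>" using q_eq[of \<omega>] zero_le_power2[of "xi \<omega>"] by simp
    qed (use d sqm N True m0 in \<open>auto simp: good_iff\<close>)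
    have "log_incr N \<omega> = s.Z" by (simp add: log_incr_def s.Z_def s.A_def s.s_def q_eq w_eq)
    then have "cmod (F \<omega> - Complex (R \<omega>) (L \<omega>)) \<le> C1 * d * s.e"
      using s.char_expansion[of t] True
      by (simp add: F_def bad_def R_def L_def s.h_def s.\<kappa>_def h_def[symmetric] \<kappa>_def[symmetric] C1_def)
    then show ?thesis using True by (simp add: s.e_def bad_def)
  next
    \<comment> \<open>The integrand vanishes here, but the comparison polynomial is unbounded. It is
      dominated by a multiple of 1 + (q^2 + w^2)/m, whose mean over the bad event is controlled by
      \<open>bad_le\<close> and \<open>bad_weighted\<close>.\<close>
    case False
    have "h * \<bar>q \<omega>\<bar> \<le> \<kappa> * (1 + (q \<omega>)\<^sup>2 / m)"
    proof -
      have "2 * \<bar>q \<omega> / sqrt m\<bar> \<le> 1 + (q \<omega> / sqrt m)\<^sup>2" by (rule abs_le_one_plus_square)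
      moreover have "\<bar>q \<omega> / sqrt m\<bar> = \<bar>q \<omega>\<bar> / sqrt m" "(q \<omega> / sqrt m)\<^sup>2 = (q \<omega>)\<^sup>2 / m" "0 \<le> \<bar>q \<omega>\<bar> / sqrt m"
        using m0 by (simp_all add: power_divide abs_divide)
      ultimately have 1: "\<bar>q \<omega>\<bar> / sqrt m \<le> 1 + (q \<omega>)\<^sup>2 / m" by linarith
      have "h * \<bar>q \<omega>\<bar> \<le> \<kappa> / sqrt m * \<bar>q \<omega>\<bar>" using h by (intro mult_right_mono) auto
      also have "\<dots> = \<kappa> * (\<bar>q \<omega>\<bar> / sqrt m)" by simp
      also have "\<dots> \<le> \<kappa> * (1 + (q \<omega>)\<^sup>2 / m)" using 1 \<kappa> by (intro mult_left_mono) auto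
      finally show ?thesis .
    qed
    moreover have "h * (\<bar>w \<omega>\<bar> / sqrt m) \<le> \<kappa> * (1 + (w \<omega>)\<^sup>2 / m)"
    proof -
      have "2 * \<bar>w \<omega>\<bar> \<le> 1 + (w \<omega>)\<^sup>2" by (rule abs_le_one_plus_square)
      then have "\<bar>w \<omega>\<bar> / m \<le> (1 + (w \<omega>)\<^sup>2) / m" using m0 by (intro divide_right_mono) auto
      also have "\<dots> \<le> 1 + (w \<omega>)\<^sup>2 / m" using m_bounds(1) by (simp add: add_divide_distrib)
      finally have 1: "\<bar>w \<omega>\<bar> / m \<le> 1 + (w \<omega>)\<^sup>2 / m" .
      have "h * (\<bar>w \<omega>\<bar> / sqrt m) \<le> \<kappa> / sqrt m * (\<bar>w \<omega>\<bar> / sqrt m)" using h sqm by (intro mult_right_mono) auto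
      also have "\<dots> = \<kappa> * (\<bar>w \<omega>\<bar> / m)" using sqm by simp
      also have "\<dots> \<le> \<kappa> * (1 + (w \<omega>)\<^sup>2 / m)" using 1 \<kappa> by (intro mult_left_mono) auto
      finally show ?thesis .
    qed
    moreover have "h * (\<bar>q \<omega>\<bar> * \<bar>w \<omega>\<bar> / sqrt m) \<le> \<kappa> * (((q \<omega>)\<^sup>2 + (w \<omega>)\<^sup>2) / m)"
    proof -
      have "\<bar>q \<omega> * w \<omega>\<bar> \<le> (q \<omega>)\<^sup>2 + (w \<omega>)\<^sup>2" by (rule abs_prod_le_sum_squares)
      then have 1: "\<bar>q \<omega>\<bar> * \<bar>w \<omega>\<bar> / m \<le> ((q \<omega>)\<^sup>2 + (w \<omega>)\<^sup>2) / m" using m0 by (intro divide_right_mono) (auto simp: abs_mult)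
      have "h * (\<bar>q \<omega>\<bar> * \<bar>w \<omega>\<bar> / sqrt m) \<le> \<kappa> / sqrt m * (\<bar>q \<omega>\<bar> * \<bar>w \<omega>\<bar> / sqrt m)" using h sqm by (intro mult_right_mono) auto
      also have "\<dots> = \<kappa> * (\<bar>q \<omega>\<bar> * \<bar>w \<omega>\<bar> / m)" using sqm by simp
      also have "\<dots> \<le> \<kappa> * (((q \<omega>)\<^sup>2 + (w \<omega>)\<^sup>2) / m)" using 1 \<kappa> by (intro mult_left_mono) auto
      finally show ?thesis .
    qed
    moreover have "h * \<bar>- q \<omega> + w \<omega> / sqrt m + q \<omega> * (w \<omega> / sqrt m)\<bar> \<le> h * \<bar>q \<omega>\<bar> + h * (\<bar>w \<omega>\<bar> / sqrt m) + h * (\<bar>q \<omega>\<bar> * \<bar>w \<omega>\<bar> / sqrt m)"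
    proof -
      have "\<bar>- q \<omega> + w \<omega> / sqrt m + q \<omega> * (w \<omega> / sqrt m)\<bar> \<le> \<bar>- q \<omega>\<bar> + \<bar>w \<omega> / sqrt m\<bar> + \<bar>q \<omega> * (w \<omega> / sqrt m)\<bar>"
        by (intro order_trans[OF abs_triangle_ineq] add_mono abs_triangle_ineq order_refl)
      also have "\<dots> = \<bar>q \<omega>\<bar> + \<bar>w \<omega>\<bar> / sqrt m + \<bar>q \<omega>\<bar> * \<bar>w \<omega>\<bar> / sqrt m" using sqm by (simp add: abs_mult abs_divide)
      finally show ?thesis unfolding distrib_left[symmetric] using h by (intro mult_left_mono) auto
    qed
    ultimately have "h * \<bar>- q \<omega> + w \<omega> / sqrt m + q \<omega> * (w \<omega> / sqrt m)\<bar> \<le>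
       \<kappa> * (1 + (q \<omega>)\<^sup>2 / m) + \<kappa> * (1 + (w \<omega>)\<^sup>2 / m) + \<kappa> * (((q \<omega>)\<^sup>2 + (w \<omega>)\<^sup>2) / m)" by linarith
    also have "\<dots> = \<kappa> * (2 + 2 * (((q \<omega>)\<^sup>2 + (w \<omega>)\<^sup>2) / m))" by (simp add: algebra_simps add_divide_distrib)
    finally have "\<bar>t\<bar> * (h * \<bar>- q \<omega> + w \<omega> / sqrt m + q \<omega> * (w \<omega> / sqrt m)\<bar>) \<le> \<bar>t\<bar> * (\<kappa> * (2 + 2 * (((q \<omega>)\<^sup>2 + (w \<omega>)\<^sup>2) / m)))"
      by (intro mult_left_mono) auto
    then have L: "\<bar>L \<omega>\<bar> \<le> \<bar>t\<bar> * (\<kappa> * (2 + 2 * (((q \<omega>)\<^sup>2 + (w \<omega>)\<^sup>2) / m)))"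
      using h by (simp add: L_def abs_mult)
    have "h\<^sup>2 * (q \<omega>)\<^sup>2 \<le> \<kappa>\<^sup>2 / m * ((q \<omega>)\<^sup>2 + (w \<omega>)\<^sup>2)" using h m0 by (intro mult_mono) auto
    then have "t\<^sup>2 * (h\<^sup>2 * (q \<omega>)\<^sup>2) \<le> t\<^sup>2 * (\<kappa>\<^sup>2 / m * ((q \<omega>)\<^sup>2 + (w \<omega>)\<^sup>2))" by (intro mult_left_mono) auto
    moreover have "\<bar>R \<omega>\<bar> \<le> 1 + t\<^sup>2 * (h\<^sup>2 * (q \<omega>)\<^sup>2)"
    proof -
      have "0 \<le> t\<^sup>2 * (h\<^sup>2 * (q \<omega>)\<^sup>2)" by simp
      then show ?thesis unfolding R_def mult.assoc[of "t\<^sup>2"] by linarith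
    qed
    ultimately have R: "\<bar>R \<omega>\<bar> \<le> 1 + t\<^sup>2 * (\<kappa>\<^sup>2 / m * ((q \<omega>)\<^sup>2 + (w \<omega>)\<^sup>2))" by linarith
    have "cmod (F \<omega> - Complex (R \<omega>) (L \<omega>)) \<le> \<bar>R \<omega>\<bar> + \<bar>L \<omega>\<bar>"
      using False cmod_le[of "Complex (R \<omega>) (L \<omega>)"] by (simp add: F_def bad_def)
    also have "\<dots> \<le> C2 * (1 + ((q \<omega>)\<^sup>2 + (w \<omega>)\<^sup>2) / m)"
    proof -
      define y where "y = ((q \<omega>)\<^sup>2 + (w \<omega>)\<^sup>2) / m"
      have y: "0 \<le> y" using m0 by (simp add: y_def)
      have "\<bar>R \<omega>\<bar> + \<bar>L \<omega>\<bar> \<le> 1 + t\<^sup>2 * \<kappa>\<^sup>2 * y + \<bar>t\<bar> * (\<kappa> * (2 + 2 * y))" using R L by (simp add: y_def)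
      also have "\<dots> \<le> 1 + t\<^sup>2 * \<kappa>\<^sup>2 * y + \<bar>t\<bar> * (\<kappa> * (2 + 2 * y)) + (t\<^sup>2 * \<kappa>\<^sup>2 + y)" using y by simp
      also have "\<dots> = C2 * (1 + y)" by (simp add: C2_def algebra_simps)
      finally show ?thesis by (simp add: y_def)
    qed
    also have "\<dots> \<le> ?B \<omega>" using False C1 d m0 by (simp add: bad_def)
    finally show ?thesis .
  qed
  have "cmod (expectation F - Complex (expectation R) (expectation L)) \<le> expectation ?B"
  proof -
    have c: "integrable M (\<lambda>\<omega>. Complex (R \<omega>) (L \<omega>))" "expectation (\<lambda>\<omega>. Complex (R \<omega>) (L \<omega>)) = Complex (expectation R) (expectation L)"
      unfolding Complex_eq using Ri Li by simp_all
    have "cmod (expectation F - Complex (expectation R) (expectation L)) = cmod (expectation (\<lambda>\<omega>. F \<omega> - Complex (R \<omega>) (L \<omega>)))"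
      using Fi c by simp
    also have "\<dots> \<le> expectation (\<lambda>\<omega>. cmod (F \<omega> - Complex (R \<omega>) (L \<omega>)))" by (rule integral_norm_bound)
    also have "\<dots> \<le> expectation ?B"
      by (rule integral_mono) (use Fi c pw q_int w_int bad_integrable bad_weighted in auto)
    finally show ?thesis .
  qed
  also have "expectation ?B = C1 * d * ((1 + expectation (\<lambda>\<omega>. (q \<omega>)\<^sup>2) + expectation (\<lambda>\<omega>. (w \<omega>)\<^sup>2)) / m)
      + C2 * (expectation bad + expectation (\<lambda>\<omega>. ((q \<omega>)\<^sup>2 + (w \<omega>)\<^sup>2) * bad \<omega>) / m)"
    using q_int w_int bad_integrable bad_weighted by (simp add: prob_space)
  also have "\<dots> \<le> C1 * d * ((1 + (kurt + 1) + (kurt + 1)) / m) + C2 * (5 * d\<^sup>2 / m + 12 * d ^ 4 / m)"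
    using C1 C2 d m0 by (intro add_mono mult_left_mono divide_right_mono bad_le bad_weighted q_int w_int order_refl) auto
  also have "\<dots> \<le> C1 * d * ((2 * kurt + 3) / m) + C2 * (17 * d / m)"
  proof -
    have "d\<^sup>2 \<le> d" "d ^ 4 \<le> d"
      using d power_decreasing[of 1 2 d] power_decreasing[of 1 4 d] by auto
    then have "5 * d\<^sup>2 / m + 12 * d ^ 4 / m \<le> 17 * d / m" using m0 by (simp add: add_divide_distrib[symmetric] divide_right_mono)
    then show ?thesis using C1 C2 d by (intro add_mono mult_left_mono) (auto simp: algebra_simps)
  qed
  finally have 1: "cmod (expectation F - Complex (expectation R) (expectation L)) \<le> C1 * d * ((2 * kurt + 3) / m) + C2 * (17 * d / m)" .
  have "\<bar>expectation R - (1 - t\<^sup>2 * h\<^sup>2)\<bar> \<le> t\<^sup>2 * (\<kappa>\<^sup>2 / m) * ((kurt + 3) * psi)"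
  proof -
    have "expectation R - (1 - t\<^sup>2 * h\<^sup>2) = - (t\<^sup>2 * h\<^sup>2 * ((kurt - 3) * psi) / 2)"
      unfolding Ri by (simp add: field_simps)
    then have "\<bar>expectation R - (1 - t\<^sup>2 * h\<^sup>2)\<bar> = t\<^sup>2 * h\<^sup>2 * (\<bar>kurt - 3\<bar> * psi) / 2"
      using psi_nonneg by (simp add: abs_mult)
    also have "\<dots> \<le> t\<^sup>2 * h\<^sup>2 * (\<bar>kurt - 3\<bar> * psi)" using psi_nonneg by simp
    also have "\<dots> \<le> t\<^sup>2 * (\<kappa>\<^sup>2 / m) * ((kurt + 3) * psi)"
      using h psi_nonneg kurt_ge_1 m0 by (intro mult_mono mult_left_mono) auto
    finally show ?thesis .
  qed
  moreover have "\<bar>expectation L\<bar> \<le> \<bar>t\<bar> * \<kappa> * ((kurt + 5) * d / m)"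
  proof -
    have "\<bar>expectation L\<bar> = \<bar>t\<bar> * (h * (\<bar>expectation (\<lambda>\<omega>. q \<omega> * w \<omega>)\<bar> / sqrt m))"
      unfolding Li using h sqm by (simp add: abs_mult abs_divide)
    also have "\<dots> \<le> \<bar>t\<bar> * (\<kappa> / sqrt m * ((kurt + 5) / sqrt m / sqrt m))"
      using h qw_int sqm by (intro mult_left_mono mult_mono divide_right_mono) auto
    also have "\<dots> = \<bar>t\<bar> * \<kappa> * ((kurt + 5) * (1 / sqrt m) / m)" using sqm by (simp add: divide_divide_eq_left)
    also have "\<dots> \<le> \<bar>t\<bar> * \<kappa> * ((kurt + 5) * d / m)"
      using sqm d \<kappa> kurt_ge_1 m0 by (intro mult_left_mono divide_right_mono) auto
    finally show ?thesis .
  qed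
  moreover have "cmod (Complex (expectation R) (expectation L) - of_real (1 - t\<^sup>2 * h\<^sup>2)) \<le> \<bar>expectation R - (1 - t\<^sup>2 * h\<^sup>2)\<bar> + \<bar>expectation L\<bar>"
    using cmod_le[of "Complex (expectation R) (expectation L) - of_real (1 - t\<^sup>2 * h\<^sup>2)"] by simp
  ultimately have 2: "cmod (Complex (expectation R) (expectation L) - of_real (1 - t\<^sup>2 * h\<^sup>2))
     \<le> t\<^sup>2 * (\<kappa>\<^sup>2 / m) * ((kurt + 3) * psi) + \<bar>t\<bar> * \<kappa> * ((kurt + 5) * d / m)" by linarith
  have "cmod (expectation F - of_real (1 - t\<^sup>2 * h\<^sup>2)) \<le> C1 * d * ((2 * kurt + 3) / m) + C2 * (17 * d / m) 
      + (t\<^sup>2 * (\<kappa>\<^sup>2 / m) * ((kurt + 3) * psi) + \<bar>t\<bar> * \<kappa> * ((kurt + 5) * d / m))"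
  proof -
    have "a - c = (a - b) + (b - c)" for a b c :: complex by simp
    then show ?thesis using norm_triangle_mono[OF 1 2] by metis
  qed
  also have "\<dots> = ((C1 * (2 * kurt + 3) + 17 * C2 + \<bar>t\<bar> * \<kappa> * (kurt + 5)) * d + (t\<^sup>2 * \<kappa>\<^sup>2 * (kurt + 3)) * psi) / m"
    by (simp add: algebra_simps add_divide_distrib)
  also have "\<dots> \<le> char_const \<kappa> t * (d + psi) / m"
  proof -
    define E1 where "E1 = C1 * (2 * kurt + 3) + 17 * C2 + \<bar>t\<bar> * \<kappa> * (kurt + 5)"
    define E2 where "E2 = t\<^sup>2 * \<kappa>\<^sup>2 * (kurt + 3)"
    have "0 \<le> E1" "0 \<le> E2" using C1 C2 \<kappa> kurt_ge_1 by (auto simp: E1_def E2_def intro!: add_nonneg_nonneg mult_nonneg_nonneg)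
    then have "0 \<le> E2 * d + E1 * psi" using d psi_nonneg by simp
    then have "E1 * d + E2 * psi \<le> (E1 + E2) * (d + psi)" by (simp add: algebra_simps)
    moreover have "E1 + E2 = char_const \<kappa> t" by (simp add: E1_def E2_def char_const_def C1_def C2_def)
    ultimately show ?thesis unfolding E1_def[symmetric] E2_def[symmetric] using m0 by (intro divide_right_mono) auto
  qed
  finally show ?thesis unfolding F_def[abs_def] h_def \<kappa>_def .
qed

end

section \<open>One-step evolution of the fourth-power sum of the direction\<close>

lemma power4_diff_le:
  fixes v e :: real
  shows "(v - e) ^ 4 \<le> v ^ 4 - 4 * (v ^ 3 * e) + 8 * (v\<^sup>2 * e\<^sup>2) + 3 * e ^ 4" "(v - e) ^ 4 \<le> 8 * v ^ 4 + 8 * e ^ 4"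
proof -
  \<comment> \<open>Exactly the difference of the two sides. The term linear in e is left untouched,
    because later its mean has a favourable sign.\<close>
  have "0 \<le> 2 * (v * e + e\<^sup>2)\<^sup>2" by simp
  then show "(v - e) ^ 4 \<le> v ^ 4 - 4 * (v ^ 3 * e) + 8 * (v\<^sup>2 * e\<^sup>2) + 3 * e ^ 4"
    by (simp add: power2_eq_square power3_eq_cube power4_eq_xxxx algebra_simps)
  have "((v - e)\<^sup>2)\<^sup>2 \<le> (2 * v\<^sup>2 + 2 * e\<^sup>2)\<^sup>2"
    using power2_add_le[of v "- e"] by (intro power_mono) auto
  also have "\<dots> \<le> 2 * (2 * v\<^sup>2)\<^sup>2 + 2 * (2 * e\<^sup>2)\<^sup>2" by (rule power2_add_le)
  finally show "(v - e) ^ 4 \<le> 8 * v ^ 4 + 8 * e ^ 4" by (simp add: power_mult_distrib flip: power_mult)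
qed

lemma inverse_square_le: "1 / (1 - y)\<^sup>2 \<le> 1 + 6 * y" if "0 \<le> y" "y \<le> 1/2" for y :: real
proof -
  have "1 \<le> (1 + 6 * y) * (1 - y)\<^sup>2"
  proof -
    have "(1 + 6 * y) * (1 - y)\<^sup>2 - 1 = y * ((1 - 2 * y) * (4 - 3 * y))"
      by (simp add: power2_eq_square algebra_simps)
    moreover have "0 \<le> y * ((1 - 2 * y) * (4 - 3 * y))" using that by (intro mult_nonneg_nonneg) auto
    ultimately show ?thesis by linarith
  qed
  then show ?thesis using that by (simp add: pos_divide_le_eq)
qed

context row_step
begin

text \<open>The fourth-power sum of the next unit direction: the vector v - xi / (m sc) * P x has
  squared length 1 - xi^2 / (m sc), since v.Px = xi and x.Px = m sc.\<close>

definition "newpsi \<omega> = (\<Sum>i<n. (v i - xi \<omega> / (m * sc \<omega>) * mv n P (\<lambda>i. x i \<omega>) i) ^ 4) / (1 - (xi \<omega>)\<^sup>2 / (m * sc \<omega>))\<^sup>2"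
definition "zeta \<omega> = (\<Sum>i<n. v i ^ 3 * lf (P i) n \<omega>)"
definition "G \<omega> = (\<Sum>i<n. (v i)\<^sup>2 * lf (P i) n \<omega> ^ 4)"

lemma zeta_lf: "zeta \<omega> = lf (mv n P (\<lambda>i. v i ^ 3)) n \<omega>"
proof -
  have "zeta \<omega> = dot n (\<lambda>i. v i ^ 3) (mv n P (\<lambda>i. x i \<omega>))" by (simp add: zeta_def dot_def mv_lf)
  also have "\<dots> = dot n (mv n P (\<lambda>i. v i ^ 3)) (\<lambda>i. x i \<omega>)" by (rule dot_mv[OF P])
  finally show ?thesis by (simp add: dot_def lin_def)
qed

lemma meas2 [measurable]: "zeta \<in> borel_measurable M" "G \<in> borel_measurable M" "newpsi \<in> borel_measurable M"
  unfolding zeta_def[abs_def] G_def[abs_def] newpsi_def[abs_def] mv_lf by measurable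

lemma xi_moments: "integrable M (\<lambda>\<omega>. xi \<omega> ^ 4)" "integrable M (\<lambda>\<omega>. (xi \<omega>)\<^sup>2)" "expectation (\<lambda>\<omega>. (xi \<omega>)\<^sup>2) = 1"
  "expectation (\<lambda>\<omega>. xi \<omega> ^ 4) \<le> 3 * kurt"
  using lf_moments[of v n] v1 unfolding xi_lf by (auto simp: dot_def power2_eq_square)

lemma v_le_1: "i < n \<Longrightarrow> (v i)\<^sup>2 \<le> 1"
  using v1 member_le_sum[of i "{..<n}" "\<lambda>i. (v i)\<^sup>2"] by (auto simp: dot_def power2_eq_square)

text \<open>\<open>zeta\<close> is the linear form with coefficient vector P(v^3), entrywise cube.
  The vector has norm at most 1 because P contracts and the entries of v are at most 1 in modulus; P
  v = v turns the covariance with xi into v.v^3 = \<open>psi\<close>.\<close>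

lemma zeta_moments: "integrable M (\<lambda>\<omega>. zeta \<omega> ^ 4)" "integrable M (\<lambda>\<omega>. (zeta \<omega>)\<^sup>2)" "expectation (\<lambda>\<omega>. (zeta \<omega>)\<^sup>2) \<le> 1"
  "expectation (\<lambda>\<omega>. zeta \<omega> ^ 4) \<le> 3 * kurt" "integrable M (\<lambda>\<omega>. xi \<omega> * zeta \<omega>)" "expectation (\<lambda>\<omega>. xi \<omega> * zeta \<omega>) = psi"
proof -
  let ?b = "mv n P (\<lambda>i. v i ^ 3)"
  have s: "(\<Sum>i<n. (?b i)\<^sup>2) \<le> 1"
  proof -
    have "(\<Sum>i<n. (?b i)\<^sup>2) = dot n ?b ?b" by (simp add: dot_def power2_eq_square)
    also have "\<dots> = dot n (\<lambda>i. v i ^ 3) (mv n P (\<lambda>i. v i ^ 3))" by (rule dot_mv_mv[OF P])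
    also have "\<dots> \<le> dot n (\<lambda>i. v i ^ 3) (\<lambda>i. v i ^ 3)" by (rule dot_mv_le[OF P])
    also have "\<dots> = (\<Sum>i<n. (v i)\<^sup>2 * ((v i)\<^sup>2)\<^sup>2)" by (simp add: dot_def power2_eq_square power3_eq_cube mult_ac)
    also have "\<dots> \<le> (\<Sum>i<n. (v i)\<^sup>2 * 1)" using v_le_1 by (intro sum_mono mult_left_mono power_le_one[of "(v _)\<^sup>2"]) auto
    also have "\<dots> = 1" using v1 by (simp add: dot_def power2_eq_square)
    finally show ?thesis .
  qed
  have s0: "0 \<le> (\<Sum>i<n. (?b i)\<^sup>2)" by (auto intro: sum_nonneg)
  show "integrable M (\<lambda>\<omega>. zeta \<omega> ^ 4)" "integrable M (\<lambda>\<omega>. (zeta \<omega>)\<^sup>2)" "integrable M (\<lambda>\<omega>. xi \<omega> * zeta \<omega>)"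
    unfolding zeta_lf xi_lf by (rule lf_moments lf_cov)+
  show "expectation (\<lambda>\<omega>. (zeta \<omega>)\<^sup>2) \<le> 1" unfolding zeta_lf lf_moments by (rule s)
  have "expectation (\<lambda>\<omega>. zeta \<omega> ^ 4) \<le> 3 * kurt * (\<Sum>i<n. (?b i)\<^sup>2)\<^sup>2" unfolding zeta_lf by (rule lf_moments)
  also have "\<dots> \<le> 3 * kurt * 1" using s s0 kurt_ge_1 by (intro mult_left_mono) (auto intro!: power_le_one)
  finally show "expectation (\<lambda>\<omega>. zeta \<omega> ^ 4) \<le> 3 * kurt" by simp
  have "expectation (\<lambda>\<omega>. xi \<omega> * zeta \<omega>) = dot n v ?b" unfolding xi_lf zeta_lf lf_cov dot_def ..
  also have "\<dots> = dot n v (\<lambda>i. v i ^ 3)" unfolding dot_mv[OF P] by (rule dot_cong) (auto simp: Pv)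
  finally show "expectation (\<lambda>\<omega>. xi \<omega> * zeta \<omega>) = psi" by (simp add: dot_def psi_def power3_eq_cube power4_eq_xxxx mult_ac)
qed

lemma G_moments: "integrable M G" "expectation G \<le> 3 * kurt"
proof -
  show "integrable M G" unfolding G_def using lf_moments by auto
  have "expectation G = (\<Sum>i<n. (v i)\<^sup>2 * expectation (\<lambda>\<omega>. lf (P i) n \<omega> ^ 4))"
    unfolding G_def using lf_moments by simp
  also have "\<dots> \<le> (\<Sum>i<n. (v i)\<^sup>2 * (3 * kurt))"
  proof (intro sum_mono mult_left_mono)
    fix i assume "i \<in> {..<n}"
    then have i: "i < n" by simp
    have "expectation (\<lambda>\<omega>. lf (P i) n \<omega> ^ 4) \<le> 3 * kurt * (\<Sum>j<n. (P i j)\<^sup>2)\<^sup>2" by (rule lf_moments)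
    also have "\<dots> = 3 * kurt * (P i i)\<^sup>2" using i by (simp add: proj_row_norm[OF P])
    also have "\<dots> \<le> 3 * kurt * 1" using proj_diag[OF P i] kurt_ge_1 by (intro mult_left_mono) (auto intro: power_le_one)
    finally show "expectation (\<lambda>\<omega>. lf (P i) n \<omega> ^ 4) \<le> 3 * kurt" by simp
  qed simp
  also have "\<dots> = 3 * kurt" using v1 by (simp add: sum_distrib_right[symmetric] dot_def power2_eq_square)
  finally show "expectation G \<le> 3 * kurt" .
qed

text \<open>Fourth powers are bounded by the square of the squared length of P x, which is m
  sc.\<close>

lemma sum_lf_power4: "(\<Sum>i<n. lf (P i) n \<omega> ^ 4) \<le> (m * sc \<omega>)\<^sup>2"
proof -
  have "(\<Sum>i<n. lf (P i) n \<omega> ^ 4) = (\<Sum>i<n. ((lf (P i) n \<omega>)\<^sup>2)\<^sup>2)" by (simp flip: power_mult)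
  also have "\<dots> \<le> (\<Sum>i<n. (lf (P i) n \<omega>)\<^sup>2)\<^sup>2" by (rule sum_power2_le_power2_sum) simp
  also have "(\<Sum>i<n. (lf (P i) n \<omega>)\<^sup>2) = dot n (mv n P (\<lambda>i. x i \<omega>)) (mv n P (\<lambda>i. x i \<omega>))"
    by (simp add: dot_def mv_lf power2_eq_square)
  also have "\<dots> = m * sc \<omega>" using m0 by (simp add: dot_mv_mv[OF P] sc_def)
  finally show ?thesis .
qed

text \<open>Y is the numerator of \<open>newpsi\<close>. The refined bound \<open>Yb\<close> is used
  for Y itself, the crude bound \<open>Ya\<close> only for the part already carrying a factor xi^2 /
  m. The constants are 96 = 12 * 8 and 412 = 16 + 12 + 12 * 32.\<close>

lemma newpsi_le:
  assumes "good \<omega>"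
  shows "newpsi \<omega> \<le> psi + 96 * psi * (xi \<omega>)\<^sup>2 / m - 4 / m * (xi \<omega> * zeta \<omega>) + 4 * d / m * ((xi \<omega>)\<^sup>2 + (zeta \<omega>)\<^sup>2)
     + (412 * xi \<omega> ^ 4 + 16 * G \<omega>) / m\<^sup>2"
proof -
  define g where "g = xi \<omega> / (m * sc \<omega>)"
  define Y where "Y = (\<Sum>i<n. (v i - g * lf (P i) n \<omega>) ^ 4)"
  have g: "\<bar>sc \<omega> - 1\<bar> \<le> d" "(xi \<omega>)\<^sup>2 \<le> d * sqrt m" using assms by (auto simp: good_def)
  then have s: "1/2 \<le> sc \<omega>" using d by linarith
  then have s0: "0 < sc \<omega>" by linarith
  have si: "1 / sc \<omega> \<le> 2" using s s0 by (simp add: pos_divide_le_eq)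
  have xm: "(xi \<omega>)\<^sup>2 / m \<le> d * (d / 2)"
  proof -
    have "(xi \<omega>)\<^sup>2 / m \<le> d * sqrt m / m" using g m0 by (intro divide_right_mono) auto
    also have "\<dots> = d * (1 / sqrt m)" using sqm by (simp add: field_simps)
    also have "\<dots> \<le> d * (d / 2)" using sqm d by (intro mult_left_mono) auto
    finally show ?thesis .
  qed
  have dd: "d * (d / 2) \<le> 1/4 * (1/4/2)" using d by (intro mult_mono) auto
  have tau: "(xi \<omega>)\<^sup>2 / (m * sc \<omega>) \<le> 2 * ((xi \<omega>)\<^sup>2 / m)"
  proof -
    have "(xi \<omega>)\<^sup>2 / (m * sc \<omega>) = (xi \<omega>)\<^sup>2 / m * (1 / sc \<omega>)" by simp
    also have "\<dots> \<le> (xi \<omega>)\<^sup>2 / m * 2" using si m0 by (intro mult_left_mono) auto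
    finally show ?thesis by (simp add: mult.commute)
  qed
  have tau0: "0 \<le> (xi \<omega>)\<^sup>2 / (m * sc \<omega>)" using m0 s0 by simp
  have Y0: "0 \<le> Y" unfolding Y_def by (auto intro: sum_nonneg)
  have "newpsi \<omega> = Y * (1 / (1 - (xi \<omega>)\<^sup>2 / (m * sc \<omega>))\<^sup>2)" by (simp add: newpsi_def Y_def g_def mv_lf)
  also have "\<dots> \<le> Y * (1 + 6 * ((xi \<omega>)\<^sup>2 / (m * sc \<omega>)))"
  proof -
    have "(xi \<omega>)\<^sup>2 / (m * sc \<omega>) \<le> 1/2" using tau xm dd by linarith
    then show ?thesis using tau0 Y0 by (intro mult_left_mono inverse_square_le)
  qed
  also have "\<dots> \<le> Y * (1 + 12 * ((xi \<omega>)\<^sup>2 / m))" using tau Y0 by (intro mult_left_mono) linarith+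
  finally have 1: "newpsi \<omega> \<le> Y + 12 * ((xi \<omega>)\<^sup>2 / m) * Y" by (simp add: algebra_simps)
  have g4: "g ^ 4 * (\<Sum>i<n. lf (P i) n \<omega> ^ 4) \<le> 4 * xi \<omega> ^ 4 / m\<^sup>2"
  proof -
    have "g ^ 4 * (\<Sum>i<n. lf (P i) n \<omega> ^ 4) \<le> g ^ 4 * (m * sc \<omega>)\<^sup>2" by (intro mult_left_mono sum_lf_power4) auto
    also have "\<dots> = xi \<omega> ^ 4 / m\<^sup>2 * (1 / sc \<omega>)\<^sup>2" using m0 s0 by (simp add: g_def power2_eq_square power4_eq_xxxx field_simps)
    also have "\<dots> \<le> xi \<omega> ^ 4 / m\<^sup>2 * 2\<^sup>2" using si s0 m0 by (intro mult_left_mono power_mono) auto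
    finally show ?thesis by (simp add: mult.commute)
  qed
  have Ya: "Y \<le> 8 * psi + 32 * xi \<omega> ^ 4 / m\<^sup>2"
  proof -
    have "Y \<le> (\<Sum>i<n. 8 * v i ^ 4 + 8 * (g * lf (P i) n \<omega>) ^ 4)" unfolding Y_def by (intro sum_mono power4_diff_le)
    also have "\<dots> = 8 * psi + 8 * (g ^ 4 * (\<Sum>i<n. lf (P i) n \<omega> ^ 4))"
      by (simp add: sum.distrib psi_def sum_distrib_left power_mult_distrib)
    finally show ?thesis using g4 by linarith
  qed
  have g2: "8 * (g\<^sup>2 * (\<Sum>i<n. (v i)\<^sup>2 * (lf (P i) n \<omega>)\<^sup>2)) \<le> 16 * (xi \<omega> ^ 4 + G \<omega>) / m\<^sup>2"
  proof -
    have "(xi \<omega>)\<^sup>2 * (\<Sum>i<n. (v i)\<^sup>2 * (lf (P i) n \<omega>)\<^sup>2) = (\<Sum>i<n. (v i)\<^sup>2 * ((xi \<omega>)\<^sup>2 * (lf (P i) n \<omega>)\<^sup>2))"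
      by (simp add: sum_distrib_left mult_ac)
    also have "\<dots> \<le> (\<Sum>i<n. (v i)\<^sup>2 * ((xi \<omega> ^ 4 + lf (P i) n \<omega> ^ 4) / 2))"
    proof (intro sum_mono mult_left_mono)
      fix i show "(xi \<omega>)\<^sup>2 * (lf (P i) n \<omega>)\<^sup>2 \<le> (xi \<omega> ^ 4 + lf (P i) n \<omega> ^ 4) / 2"
        using two_abs_prod_le[of "(xi \<omega>)\<^sup>2" "(lf (P i) n \<omega>)\<^sup>2"] by (simp add: abs_mult flip: power_mult)
    qed auto
    also have "\<dots> = ((\<Sum>i<n. (v i)\<^sup>2) * xi \<omega> ^ 4 + G \<omega>) / 2"
      by (simp add: G_def sum_divide_distrib sum_distrib_right sum.distrib[symmetric] distrib_left add_divide_distrib)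
    also have "(\<Sum>i<n. (v i)\<^sup>2) = 1" using v1 by (simp add: dot_def power2_eq_square)
    finally have a: "(xi \<omega>)\<^sup>2 * (\<Sum>i<n. (v i)\<^sup>2 * (lf (P i) n \<omega>)\<^sup>2) \<le> (xi \<omega> ^ 4 + G \<omega>) / 2" by simp
    have "8 * (g\<^sup>2 * (\<Sum>i<n. (v i)\<^sup>2 * (lf (P i) n \<omega>)\<^sup>2)) = 8 / m\<^sup>2 * ((1 / sc \<omega>)\<^sup>2 * ((xi \<omega>)\<^sup>2 * (\<Sum>i<n. (v i)\<^sup>2 * (lf (P i) n \<omega>)\<^sup>2)))"
      by (simp add: g_def power_divide power_mult_distrib)
    also have "\<dots> \<le> 8 / m\<^sup>2 * (2\<^sup>2 * ((xi \<omega> ^ 4 + G \<omega>) / 2))"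
      using a si s0 by (intro mult_left_mono mult_mono power_mono) (auto intro!: mult_nonneg_nonneg sum_nonneg)
    also have "\<dots> = 16 * (xi \<omega> ^ 4 + G \<omega>) / m\<^sup>2" using m0 by (simp add: field_simps)
    finally show ?thesis .
  qed
  have gz: "- 4 * (g * zeta \<omega>) \<le> - 4 / m * (xi \<omega> * zeta \<omega>) + 4 * d / m * ((xi \<omega>)\<^sup>2 + (zeta \<omega>)\<^sup>2)"
  proof -
    have e: "- 4 * (g * zeta \<omega>) = - 4 / m * (xi \<omega> * zeta \<omega>) + 4 / m * ((sc \<omega> - 1) * (1 / sc \<omega>) * (xi \<omega> * zeta \<omega>))"
      using s0 m0 by (simp add: g_def field_simps)
    have "(sc \<omega> - 1) * (1 / sc \<omega>) * (xi \<omega> * zeta \<omega>) \<le> \<bar>sc \<omega> - 1\<bar> * \<bar>1 / sc \<omega>\<bar> * \<bar>xi \<omega> * zeta \<omega>\<bar>"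
      unfolding abs_mult[symmetric] by (rule abs_ge_self)
    also have "\<dots> \<le> d * 2 * \<bar>xi \<omega> * zeta \<omega>\<bar>" using g si s0 d by (intro mult_right_mono mult_mono) auto
    also have "\<dots> \<le> d * ((xi \<omega>)\<^sup>2 + (zeta \<omega>)\<^sup>2)" using mult_left_mono[OF two_abs_prod_le[of "xi \<omega>" "zeta \<omega>"], of d] d by simp
    finally have "4 / m * ((sc \<omega> - 1) * (1 / sc \<omega>) * (xi \<omega> * zeta \<omega>)) \<le> 4 / m * (d * ((xi \<omega>)\<^sup>2 + (zeta \<omega>)\<^sup>2))"
      using m0 by (intro mult_left_mono) auto
    then show ?thesis unfolding e by simp
  qed
  have Yb: "Y \<le> psi - 4 * (g * zeta \<omega>) + 16 * (xi \<omega> ^ 4 + G \<omega>) / m\<^sup>2 + 12 * xi \<omega> ^ 4 / m\<^sup>2"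
  proof -
    have "Y \<le> (\<Sum>i<n. v i ^ 4 - 4 * (v i ^ 3 * (g * lf (P i) n \<omega>)) + 8 * ((v i)\<^sup>2 * (g * lf (P i) n \<omega>)\<^sup>2) + 3 * (g * lf (P i) n \<omega>) ^ 4)"
      unfolding Y_def by (intro sum_mono power4_diff_le)
    also have "\<dots> = psi - 4 * (g * zeta \<omega>) + 8 * (g\<^sup>2 * (\<Sum>i<n. (v i)\<^sup>2 * (lf (P i) n \<omega>)\<^sup>2)) + 3 * (g ^ 4 * (\<Sum>i<n. lf (P i) n \<omega> ^ 4))"
      by (simp add: sum.distrib sum_subtractf psi_def zeta_def sum_distrib_left power_mult_distrib mult_ac)
    finally show ?thesis using g2 g4 by linarith
  qed
  have "12 * ((xi \<omega>)\<^sup>2 / m) * Y \<le> 12 * ((xi \<omega>)\<^sup>2 / m) * (8 * psi + 32 * xi \<omega> ^ 4 / m\<^sup>2)" using Ya m0 by (intro mult_left_mono) auto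
  also have "\<dots> = 96 * psi * (xi \<omega>)\<^sup>2 / m + (xi \<omega>)\<^sup>2 / m * (384 * xi \<omega> ^ 4 / m\<^sup>2)" by (simp add: distrib_left mult_ac)
  also have "\<dots> \<le> 96 * psi * (xi \<omega>)\<^sup>2 / m + 1 * (384 * xi \<omega> ^ 4 / m\<^sup>2)" using xm dd by (intro add_left_mono mult_right_mono) auto
  finally have "newpsi \<omega> \<le> psi - 4 * (g * zeta \<omega>) + 16 * (xi \<omega> ^ 4 + G \<omega>) / m\<^sup>2 + 12 * xi \<omega> ^ 4 / m\<^sup>2 + (96 * psi * (xi \<omega>)\<^sup>2 / m + 384 * xi \<omega> ^ 4 / m\<^sup>2)"
    using 1 Yb by simp
  also have "\<dots> = psi + 96 * psi * (xi \<omega>)\<^sup>2 / m - 4 * (g * zeta \<omega>) + (412 * xi \<omega> ^ 4 + 16 * G \<omega>) / m\<^sup>2"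
    by (simp add: add_divide_distrib)
  finally show ?thesis using gz by linarith
qed

lemma newpsi_nonneg: "0 \<le> newpsi \<omega>"
  by (auto simp: newpsi_def intro!: divide_nonneg_nonneg sum_nonneg)

text \<open>The first-order term $-4 \xi \zeta / m$ has nonpositive mean, so only terms of order $1/m$ times a small
  factor or times the old value remain.\<close>

lemma psi_step:
  "integrable M (\<lambda>\<omega>. newpsi \<omega> * (1 - bad \<omega>))"
  "expectation (\<lambda>\<omega>. newpsi \<omega> * (1 - bad \<omega>)) \<le> psi * (1 + 96 / m) + (1296 * kurt + 18) * d / m"
proof -
  let ?R = "\<lambda>\<omega>. psi + 96 * psi / m * (xi \<omega>)\<^sup>2 - 4 / m * (xi \<omega> * zeta \<omega>) + 2 / m * (d * (xi \<omega> ^ 4 + zeta \<omega> ^ 4) + bad \<omega> / d)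
     + 4 * d / m * ((xi \<omega>)\<^sup>2 + (zeta \<omega>)\<^sup>2) + (412 * xi \<omega> ^ 4 + 16 * G \<omega>) / m\<^sup>2"
  have pw: "newpsi \<omega> * (1 - bad \<omega>) \<le> ?R \<omega>" for \<omega>
  proof (cases "good \<omega>")
    case True
    have "0 \<le> 2 / m * (d * (xi \<omega> ^ 4 + zeta \<omega> ^ 4))" using d m0 by simp
    then show ?thesis using newpsi_le[OF True] True by (simp add: bad_def)
  next
    case False
    \<comment> \<open>The mean of xi zeta is known over the whole space, not over the good event.
      Its contribution from the bad event is paid for by this weighted inequality: the weight d
      falls on the fourth moments and 1/d on the probability, which is O(d^2 / m).\<close>
    have "\<bar>xi \<omega> * zeta \<omega>\<bar> * 2 \<le> d * (xi \<omega> ^ 4 + zeta \<omega> ^ 4) + 1 / d"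
    proof -
      have "0 \<le> d * (\<bar>xi \<omega> * zeta \<omega>\<bar> - 1 / d)\<^sup>2" using d by simp
      also have "\<dots> = d * (xi \<omega> * zeta \<omega>)\<^sup>2 - 2 * \<bar>xi \<omega> * zeta \<omega>\<bar> + 1 / d"
        using d by (simp only: power2_diff power2_abs) (simp add: field_simps power2_eq_square)
      finally have "2 * \<bar>xi \<omega> * zeta \<omega>\<bar> \<le> d * (xi \<omega> * zeta \<omega>)\<^sup>2 + 1 / d" by simp
      moreover have "d * (xi \<omega> * zeta \<omega>)\<^sup>2 \<le> d * (xi \<omega> ^ 4 + zeta \<omega> ^ 4)"
      proof (rule mult_left_mono)
        show "(xi \<omega> * zeta \<omega>)\<^sup>2 \<le> xi \<omega> ^ 4 + zeta \<omega> ^ 4"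
          using abs_prod_le_sum_squares[of "(xi \<omega>)\<^sup>2" "(zeta \<omega>)\<^sup>2"] by (simp add: power_mult_distrib flip: power_mult)
      qed (use d in simp)
      ultimately show ?thesis by linarith
    qed
    then have "2 / m * (\<bar>xi \<omega> * zeta \<omega>\<bar> * 2) \<le> 2 / m * (d * (xi \<omega> ^ 4 + zeta \<omega> ^ 4) + 1 / d)" using m0 by (intro mult_left_mono) auto
    moreover have "4 / m * (xi \<omega> * zeta \<omega>) \<le> 2 / m * (\<bar>xi \<omega> * zeta \<omega>\<bar> * 2)" using m0 by (simp add: divide_right_mono)
    moreover have "0 \<le> 4 * d / m * ((xi \<omega>)\<^sup>2 + (zeta \<omega>)\<^sup>2)" "0 \<le> (412 * xi \<omega> ^ 4 + 16 * G \<omega>) / m\<^sup>2" "0 \<le> 96 * psi / m * (xi \<omega>)\<^sup>2"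
      using d m0 psi_nonneg by (auto simp: G_def intro!: divide_nonneg_nonneg add_nonneg_nonneg mult_nonneg_nonneg sum_nonneg)
    moreover have "newpsi \<omega> * (1 - bad \<omega>) = 0" and b: "bad \<omega> = 1" using False by (auto simp: bad_def)
    ultimately show ?thesis using psi_nonneg unfolding b by linarith
  qed
  have iR: "integrable M ?R" using xi_moments zeta_moments G_moments bad_integrable by simp
  have 1: "integrable M (\<lambda>\<omega>. newpsi \<omega> * (1 - bad \<omega>)) \<and> expectation (\<lambda>\<omega>. newpsi \<omega> * (1 - bad \<omega>)) \<le> expectation ?R"
    by (rule integral_mono_real[OF iR _ _ pw]) (use newpsi_nonneg in \<open>auto simp: bad_def\<close>)
  then show "integrable M (\<lambda>\<omega>. newpsi \<omega> * (1 - bad \<omega>))" by simp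
  have "expectation ?R = psi + 96 * psi / m * 1 - 4 / m * psi + 2 / m * (d * (expectation (\<lambda>\<omega>. xi \<omega> ^ 4) + expectation (\<lambda>\<omega>. zeta \<omega> ^ 4)) + expectation bad / d)
     + 4 * d / m * (1 + expectation (\<lambda>\<omega>. (zeta \<omega>)\<^sup>2)) + (412 * expectation (\<lambda>\<omega>. xi \<omega> ^ 4) + 16 * expectation G) / m\<^sup>2"
    using xi_moments zeta_moments G_moments bad_integrable by (simp add: prob_space)
  also have "\<dots> \<le> psi + 96 * psi / m * 1 - 0 + 2 / m * (d * (3 * kurt + 3 * kurt) + (5 * d\<^sup>2 / m) / d)
     + 4 * d / m * (1 + 1) + (412 * (3 * kurt) + 16 * (3 * kurt)) / m\<^sup>2"
    using d m0 psi_nonneg bad_le xi_moments zeta_moments G_moments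
    by (intro add_mono diff_mono mult_left_mono divide_right_mono) auto
  also have "\<dots> \<le> psi + 96 * psi / m + 2 / m * (d * (6 * kurt) + 5 * d) + 8 * d / m + 1284 * kurt * (d / m)"
  proof -
    have "(5 * d\<^sup>2 / m) / d = 5 * d * (1 / m)" using d by (simp add: power2_eq_square)
    also have "\<dots> \<le> 5 * d * 1" using d m_bounds by (intro mult_left_mono) auto
    finally have a: "2 / m * (d * (3 * kurt + 3 * kurt) + (5 * d\<^sup>2 / m) / d) \<le> 2 / m * (d * (6 * kurt) + 5 * d)" using m0 by (intro mult_left_mono) auto
    have "(412 * (3 * kurt) + 16 * (3 * kurt)) / m\<^sup>2 = 1284 * kurt * (1 / m / m)" by (simp add: power2_eq_square)
    also have "\<dots> \<le> 1284 * kurt * (d / m)" using m_bounds m0 kurt_ge_1 by (intro mult_left_mono divide_right_mono) auto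
    finally show ?thesis using a by simp
  qed
  also have "\<dots> = psi * (1 + 96 / m) + (1296 * kurt + 18) * d / m" using m0 by (simp add: field_simps)
  finally show "expectation (\<lambda>\<omega>. newpsi \<omega> * (1 - bad \<omega>)) \<le> psi * (1 + 96 / m) + (1296 * kurt + 18) * d / m" using 1 by simp
qed

end

section \<open>Sequential projection and the statistic\<close>

lemma dot_diff_right: "dot n x (\<lambda>i. y i - z i) = dot n x y - dot n x z"
  by (simp add: dot_def right_diff_distrib sum_subtractf)

lemma dot_scale_right: "dot n x (\<lambda>i. c * y i) = c * dot n x y"
  by (simp add: dot_def sum_distrib_left mult_ac)

lemma dot_sum_right: "dot n x (\<lambda>i. \<Sum>j\<in>J. c j * y j i) = (\<Sum>j\<in>J. c j * dot n x (y j))"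
  unfolding dot_def sum_distrib_left by (subst sum.swap) (simp add: mult_ac)

lemma mv_diff: "mv n P (\<lambda>i. y i - z i) i = mv n P y i - mv n P z i"
  by (simp add: mv_def right_diff_distrib sum_subtractf)

lemma mv_scale: "mv n P (\<lambda>i. c * y i) i = c * mv n P y i"
  by (simp add: mv_def sum_distrib_left mult_ac)

lemma mv_sum: "mv n P (\<lambda>i. \<Sum>j\<in>J. c j * y j i) i = (\<Sum>j\<in>J. c j * mv n P (y j) i)"
  unfolding mv_def sum_distrib_left by (subst sum.swap) (simp add: mult_ac)

text \<open>When $r$ lies in the kernel of $P$, the divisor is $0$ and $P$ is left unchanged.\<close>

definition deflate :: "nat \<Rightarrow> (nat \<Rightarrow> nat \<Rightarrow> real) \<Rightarrow> (nat \<Rightarrow> real) \<Rightarrow> nat \<Rightarrow> nat \<Rightarrow> real" where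
  "deflate n P r i j = P i j - mv n P r i * mv n P r j / dot n r (mv n P r)"

lemma mv_deflate: assumes "is_proj n P"
  shows "mv n (deflate n P r) y i = mv n P y i - mv n P r i * (dot n r (mv n P y) / dot n r (mv n P r))"
proof -
  let ?c = "dot n r (mv n P r)"
  have "mv n (deflate n P r) y i = (\<Sum>j<n. P i j * y j - mv n P r i / ?c * (mv n P r j * y j))"
    unfolding mv_def[of n "deflate n P r"] deflate_def by (intro sum.cong refl) (simp add: left_diff_distrib)
  also have "\<dots> = mv n P y i - mv n P r i / ?c * dot n (mv n P r) y"
    unfolding sum_subtractf sum_distrib_left[symmetric] mv_def[of n P y] dot_def[of n "mv n P r" y] ..
  finally have "mv n (deflate n P r) y i = mv n P y i - mv n P r i * (dot n (mv n P r) y / ?c)" by simp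
  then show ?thesis by (simp add: dot_mv[OF assms])
qed

lemma proj_kernel: assumes "is_proj n P" "dot n r (mv n P r) = 0" "i < n" shows "mv n P r i = 0"
  using assms dot_mv_mv[OF assms(1), of r r] dot_self_eq_0_iff[of n "mv n P r"] by simp

lemma is_proj_deflate: assumes P: "is_proj n P" shows "is_proj n (deflate n P r)"
proof -
  let ?w = "mv n P r" and ?c = "dot n r (mv n P r)"
  have "(\<Sum>k<n. deflate n P r i k * deflate n P r k j) = deflate n P r i j" if ij: "i < n" "j < n" for i j
  proof (cases "?c = 0")
    case True
    then show ?thesis using ij by (simp add: deflate_def proj_idem[OF P])
  next
    case False
    have w: "(\<Sum>k<n. P i k * ?w k) = ?w i" using mv_mv[OF P ij(1), of r] by (simp add: mv_def[of n P "mv n P r"])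
    have "(\<Sum>k<n. P k j * ?w k) = (\<Sum>k<n. P j k * ?w k)" using ij by (intro sum.cong refl) (simp add: proj_sym[OF P])
    also have "\<dots> = ?w j" using mv_mv[OF P ij(2), of r] by (simp add: mv_def[of n P "mv n P r"])
    finally have w': "(\<Sum>k<n. P k j * ?w k) = ?w j" .
    have ww: "(\<Sum>k<n. ?w k * ?w k) = ?c" using dot_mv_mv[OF P, of r r] by (simp add: dot_def)
    have "(\<Sum>k<n. deflate n P r i k * deflate n P r k j)
       = (\<Sum>k<n. P i k * P k j - ?w j / ?c * (P i k * ?w k) - ?w i / ?c * (P k j * ?w k) + ?w i * ?w j / (?c * ?c) * (?w k * ?w k))"
      by (intro sum.cong refl) (simp add: deflate_def algebra_simps add_divide_distrib diff_divide_distrib)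
    also have "\<dots> = P i j - ?w j / ?c * ?w i - ?w i / ?c * ?w j + ?w i * ?w j / (?c * ?c) * ?c"
      by (simp only: sum.distrib sum_subtractf sum_distrib_left[symmetric] proj_idem[OF P ij] w w' ww)
    also have "\<dots> = deflate n P r i j" using False by (simp add: deflate_def mult.commute)
    finally show ?thesis .
  qed
  moreover have "deflate n P r i j = deflate n P r j i" if "i < n" "j < n" for i j
    using that by (simp add: deflate_def proj_sym[OF P] mult.commute)
  ultimately show ?thesis by (auto simp: is_proj_def simp del: mult_eq_0_iff)
qed

lemma trace_deflate: assumes P: "is_proj n P" and "dot n r (mv n P r) \<noteq> 0"
  shows "trace n (deflate n P r) = trace n P - 1"
proof -
  have "trace n (deflate n P r) = trace n P - dot n (mv n P r) (mv n P r) / dot n r (mv n P r)"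
    by (simp add: trace_def deflate_def sum_subtractf dot_def[of n "mv n P r" "mv n P r"] sum_divide_distrib)
  then show ?thesis using assms by (simp add: dot_mv_mv[OF P])
qed

primrec residual_proj :: "nat \<Rightarrow> (nat \<Rightarrow> nat \<Rightarrow> real) \<Rightarrow> nat \<Rightarrow> nat \<Rightarrow> nat \<Rightarrow> real" where
  "residual_proj n x 0 = (\<lambda>i j. if i = j then 1 else 0)"
| "residual_proj n x (Suc k) = deflate n (residual_proj n x k) (x k)"

definition pivot :: "nat \<Rightarrow> (nat \<Rightarrow> nat \<Rightarrow> real) \<Rightarrow> nat \<Rightarrow> real" where
  "pivot n x k = dot n (x k) (mv n (residual_proj n x k) (x k))"

definition unit1 :: "nat \<Rightarrow> nat \<Rightarrow> real" where "unit1 n = (\<lambda>_. 1 / sqrt (real n))"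

definition residual :: "nat \<Rightarrow> (nat \<Rightarrow> nat \<Rightarrow> real) \<Rightarrow> nat \<Rightarrow> real" where
  "residual n x k = dot n (unit1 n) (mv n (residual_proj n x k) (unit1 n))"

lemma is_proj_residual_proj: "is_proj n (residual_proj n x k)"
proof (induction k)
  case 0
  have "(\<Sum>k<n. (if i = k then 1 else 0) * (if k = j then 1 else 0)) = (if i = j then 1 else (0::real))" if "i < n" for i j
    using that by (subst sum.cong[OF refl, of _ _ "\<lambda>k. if k = i then (if i = j then 1 else 0) else 0"]) auto
  then show ?case by (auto simp: is_proj_def)
qed (simp add: is_proj_deflate)

lemma trace_residual_proj: "(\<And>j. j < k \<Longrightarrow> pivot n x j \<noteq> 0) \<Longrightarrow> trace n (residual_proj n x k) = real n - real k"
proof (induction k)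
  case 0 then show ?case by (simp add: trace_def)
next
  case (Suc k)
  then have "trace n (residual_proj n x (Suc k)) = trace n (residual_proj n x k) - 1"
    by (simp add: trace_deflate is_proj_residual_proj pivot_def)
  then show ?case using Suc by simp
qed

lemma residual_proj_row: "j < k \<Longrightarrow> i < n \<Longrightarrow> mv n (residual_proj n x k) (x j) i = 0"
proof (induction k arbitrary: i)
  case (Suc k)
  show ?case
  proof (cases "j = k")
    case True
    show ?thesis
    proof (cases "pivot n x k = 0")
      case True
      \<comment> \<open>With a zero pivot the projection is unchanged, but it already annihilates
        the row.\<close>
      then have "mv n (residual_proj n x k) (x k) i = 0" using Suc.prems by (intro proj_kernel is_proj_residual_proj) (auto simp: pivot_def)
      then show ?thesis using \<open>j = k\<close> by (simp add: mv_deflate is_proj_residual_proj)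
    qed (use True in \<open>simp add: mv_deflate is_proj_residual_proj pivot_def\<close>)
  next
    case False
    then have "\<And>i. i < n \<Longrightarrow> mv n (residual_proj n x k) (x j) i = 0" using Suc by auto
    then show ?thesis using Suc.prems by (simp add: mv_deflate is_proj_residual_proj dot_def)
  qed
qed simp

text \<open>Together with \<open>residual_proj_row\<close> this identifies the matrix as the
  projection onto the orthogonal complement of the first k rows, dependent rows included. The
  induction runs over all y because the step also needs the coefficients of
  \<open>x k\<close>.\<close>

lemma residual_proj_span: "\<exists>c. \<forall>i<n. y i - mv n (residual_proj n x k) y i = (\<Sum>j<k. c j * x j i)"
proof (induction k arbitrary: y)
  case 0
  have "mv n (residual_proj n x 0) y i = y i" if "i < n" for i
    using that by (simp add: mv_def if_distrib[of "\<lambda>t. t * _"] sum.delta' cong: if_cong)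
  then show ?case by simp
next
  case (Suc k)
  obtain c where c: "\<And>i. i < n \<Longrightarrow> y i - mv n (residual_proj n x k) y i = (\<Sum>j<k. c j * x j i)" using Suc by blast
  obtain b where b: "\<And>i. i < n \<Longrightarrow> x k i - mv n (residual_proj n x k) (x k) i = (\<Sum>j<k. b j * x j i)" using Suc by blast
  define g where "g = dot n (x k) (mv n (residual_proj n x k) y) / dot n (x k) (mv n (residual_proj n x k) (x k))"
  have "y i - mv n (residual_proj n x (Suc k)) y i = (\<Sum>j<Suc k. (if j = k then g else c j - g * b j) * x j i)" if i: "i < n" for i
  proof -
    have "y i - mv n (residual_proj n x (Suc k)) y i = (y i - mv n (residual_proj n x k) y i) + g * mv n (residual_proj n x k) (x k) i"
      by (simp add: mv_deflate is_proj_residual_proj g_def)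
    also have "\<dots> = (\<Sum>j<k. c j * x j i) + g * (x k i - (\<Sum>j<k. b j * x j i))" using c[OF i] b[OF i] by (simp add: algebra_simps)
    also have "\<dots> = (\<Sum>j<k. (c j - g * b j) * x j i) + g * x k i"
      by (simp add: left_diff_distrib right_diff_distrib sum_subtractf sum_distrib_left mult.assoc)
    also have "(\<Sum>j<k. (c j - g * b j) * x j i) = (\<Sum>j<k. (if j = k then g else c j - g * b j) * x j i)" by (intro sum.cong) auto
    finally show ?thesis by simp
  qed
  then show ?case by (intro exI[of _ "\<lambda>j. if j = k then g else c j - g * b j"] allI impI)
qed

text \<open>The vector g - P g is a combination of rows, hence orthogonal to g, so its squared
  length g.g - g.Pg is 0.\<close>

lemma residual_proj_fixes_orthogonal:
  assumes "\<And>j. j < k \<Longrightarrow> dot n (x j) g = 0" "i < n"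
  shows "mv n (residual_proj n x k) g i = g i"
proof -
  let ?P = "residual_proj n x k"
  obtain c where c: "\<And>i. i < n \<Longrightarrow> g i - mv n ?P g i = (\<Sum>j<k. c j * x j i)" using residual_proj_span by blast
  have "dot n g (\<lambda>i. g i - mv n ?P g i) = dot n g (\<lambda>i. \<Sum>j<k. c j * x j i)" by (rule dot_cong) (auto simp: c)
  also have "\<dots> = 0" using assms(1) by (simp add: dot_sum_right dot_commute[of n g])
  finally have 0: "dot n g g = dot n g (mv n ?P g)" by (simp add: dot_diff_right)
  have "dot n (\<lambda>i. g i - mv n ?P g i) (\<lambda>i. g i - mv n ?P g i) = dot n g g - 2 * dot n g (mv n ?P g) + dot n (mv n ?P g) (mv n ?P g)"
    by (simp add: dot_def algebra_simps sum.distrib sum_subtractf sum_distrib_left)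
  also have "\<dots> = 0" by (simp add: dot_mv_mv is_proj_residual_proj 0)
  finally show ?thesis using assms(2) by (simp add: dot_self_eq_0_iff)
qed

lemma dot_unit1: "dot n x (unit1 n) = (\<Sum>j<n. x j) / sqrt (real n)"
  by (simp add: dot_def unit1_def sum_divide_distrib)

section \<open>The sample covariance and the statistic in terms of residuals\<close>

context
  fixes n p :: nat and x :: "nat \<Rightarrow> nat \<Rightarrow> real"
  assumes n: "0 < n"
begin

private abbreviation "C \<equiv> sample_cov n x"
private abbreviation "xb \<equiv> sample_mean n x"
private definition "comb y j = (\<Sum>l<p. y l * x l j)" for y :: "nat \<Rightarrow> real"
private definition "tau y = (\<Sum>l<p. xb l * y l)" for y :: "nat \<Rightarrow> real"

lemma row_sum: "(\<Sum>j<n. x i j) = real n * xb i" using n by (simp add: sample_mean_def)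

text \<open>n times the covariance is X X^T minus n times the outer product of the mean. This turns
  linear systems for the covariance into orthogonality relations between the rows and vectors
  indexed by observations.\<close>

lemma cov_apply: "(\<Sum>l<p. C i l * y l) = (dot n (x i) (comb y) - real n * xb i * tau y) / real n"
proof -
  have c: "real n * C i l = dot n (x i) (x l) - real n * xb i * xb l" for l
  proof -
    have "real n * C i l = (\<Sum>j<n. (x i j - xb i) * (x l j - xb l))" using n by (simp add: sample_cov_def)
    also have "\<dots> = (\<Sum>j<n. x i j * x l j) - xb l * (\<Sum>j<n. x i j) - xb i * (\<Sum>j<n. x l j) + real n * (xb i * xb l)"
      by (simp add: algebra_simps sum.distrib sum_subtractf sum_distrib_left)
    finally show ?thesis by (simp add: dot_def row_sum algebra_simps)
  qed
  have "real n * (\<Sum>l<p. C i l * y l) = (\<Sum>l<p. (real n * C i l) * y l)" by (simp add: sum_distrib_left mult_ac)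
  also have "\<dots> = (\<Sum>l<p. y l * dot n (x i) (x l)) - real n * xb i * tau y"
  proof -
    have "(\<Sum>l<p. (real n * C i l) * y l) = (\<Sum>l<p. y l * dot n (x i) (x l) - real n * xb i * (xb l * y l))"
      unfolding c by (intro sum.cong refl) (simp add: algebra_simps)
    then show ?thesis unfolding tau_def sum_distrib_left sum_subtractf .
  qed
  also have "(\<Sum>l<p. y l * dot n (x i) (x l)) = dot n (x i) (comb y)" unfolding comb_def[abs_def] dot_sum_right ..
  finally show ?thesis using n by (simp add: field_simps)
qed

lemma comb_sum: "dot n (unit1 n) (comb y) = sqrt (real n) * tau y"
proof -
  have "dot n (unit1 n) (comb y) = (\<Sum>l<p. y l * dot n (unit1 n) (x l))" by (simp add: comb_def[abs_def] dot_sum_right)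
  also have "\<dots> = (\<Sum>l<p. y l * (real n / sqrt (real n) * xb l))" by (simp add: dot_commute[of n "unit1 n"] dot_unit1 row_sum)
  also have "\<dots> = real n / sqrt (real n) * tau y" by (simp add: tau_def sum_distrib_left mult_ac)
  finally show ?thesis by (simp add: real_div_sqrt)
qed

lemma residual_proj_comb: "i < n \<Longrightarrow> mv n (residual_proj n x p) (comb y) i = 0"
  by (simp add: comb_def[abs_def] mv_sum residual_proj_row)

lemma unit1_unit: "dot n (unit1 n) (unit1 n) = 1"
  using n by (simp add: dot_def unit1_def)

text \<open>The case $e = 1$ identifies the statistic; the case $e = 0$ gives injectivity of the sample covariance.\<close>

lemma cov_solution_residual:
  assumes "\<And>i. i < p \<Longrightarrow> (\<Sum>l<p. C i l * y l) = e * xb i"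
  shows "(e + tau y) * residual n x p = e" "e = 0 \<Longrightarrow> tau y = 0 \<Longrightarrow> i < n \<Longrightarrow> comb y i = 0"
proof -
  \<comment> \<open>The equations say that g is orthogonal to every row, so the projection fixes it.
    The projection also annihilates \<open>comb y\<close>, hence g is a multiple of the projected
    unit vector; its inner product with \<open>unit1 n\<close>, computed in both ways, gives the
    identity.\<close>
  define g where "g = (\<lambda>i. comb y i - sqrt (real n) * (e + tau y) * unit1 n i)"
  have "dot n (x i) g = 0" if "i < p" for i
  proof -
    have "dot n (x i) (comb y) = real n * xb i * (e + tau y)"
      using assms[OF that] n unfolding cov_apply by (simp add: field_simps)
    moreover have "dot n (x i) g = dot n (x i) (comb y) - sqrt (real n) * (e + tau y) * dot n (x i) (unit1 n)"
      by (simp only: g_def dot_diff_right dot_scale_right)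
    ultimately show ?thesis using n by (simp add: dot_unit1 row_sum)
  qed
  then have g: "mv n (residual_proj n x p) g i = g i" if "i < n" for i using that by (intro residual_proj_fixes_orthogonal) auto
  then have g': "g i = - (sqrt (real n) * (e + tau y) * mv n (residual_proj n x p) (unit1 n) i)" if "i < n" for i
    using g[OF that] residual_proj_comb[OF that, of y] unfolding g_def mv_diff mv_scale by simp
  have "dot n (unit1 n) g = - (sqrt (real n) * (e + tau y)) * residual n x p"
    unfolding residual_def dot_scale_right[symmetric] by (rule dot_cong) (auto simp: g')
  moreover have "dot n (unit1 n) g = sqrt (real n) * tau y - sqrt (real n) * (e + tau y)"
    unfolding g_def dot_diff_right dot_scale_right comb_sum unit1_unit by simp
  ultimately have "sqrt (real n) * ((e + tau y) * residual n x p) = sqrt (real n) * e" by (simp add: algebra_simps)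
  then show "(e + tau y) * residual n x p = e" using n by simp
  show "comb y i = 0" if "e = 0" "tau y = 0" "i < n" using g'[OF that(3)] that by (simp add: g_def)
qed

text \<open>Non-zero pivots mean independent rows: in a vanishing combination, the row with the
  largest non-zero coefficient lies in the span of the earlier ones and has pivot 0.\<close>

lemma comb_zero:
  assumes nd: "\<And>k. k < p \<Longrightarrow> pivot n x k \<noteq> 0" and 0: "\<And>i. i < n \<Longrightarrow> comb y i = 0" and l: "l < p"
  shows "y l = 0"
proof (rule ccontr)
  assume "y l \<noteq> 0"
  define k where "k = Max {l. l < p \<and> y l \<noteq> 0}"
  have "k \<in> {l. l < p \<and> y l \<noteq> 0}" unfolding k_def using \<open>y l \<noteq> 0\<close> l by (intro Max_in) auto
  then have k: "k < p" "y k \<noteq> 0" by auto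
  have k0: "y j = 0" if "j < p" "k < j" for j
  proof (rule ccontr)
    assume "y j \<noteq> 0"
    then have "j \<le> k" unfolding k_def using that by (intro Max_ge) auto
    then show False using that by simp
  qed
  have "x k i = (\<Sum>j<k. (- y j / y k) * x j i)" if i: "i < n" for i
  proof -
    have "0 = (\<Sum>j<p. y j * x j i)" using 0[OF i] by (simp add: comb_def)
    also have "\<dots> = (\<Sum>j<Suc k. y j * x j i)" using k k0 by (intro sum.mono_neutral_right) auto
    finally have "y k * x k i = - (\<Sum>j<k. y j * x j i)" by simp
    then have "x k i = - (\<Sum>j<k. y j * x j i) / y k" using k by (simp add: field_simps)
    then show ?thesis by (simp add: sum_divide_distrib sum_negf)
  qed
  then have "mv n (residual_proj n x k) (x k) i = mv n (residual_proj n x k) (\<lambda>i. \<Sum>j<k. (- y j / y k) * x j i) i" for i by (intro mv_cong)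
  then have "mv n (residual_proj n x k) (x k) i = 0" if "i < n" for i unfolding mv_sum using that by (simp add: residual_proj_row)
  then have "pivot n x k = 0" by (simp add: pivot_def dot_def)
  then show False using nd k by blast
qed

text \<open>The covariance can be singular for two reasons: the rows are dependent, or centring
  makes them so because the constant vector lies in their span. The first is a zero pivot, the
  second a zero residual.\<close>

lemma right_inverse_iff: "(\<exists>B. right_inverse_on p C B) \<longleftrightarrow> (\<forall>k<p. pivot n x k \<noteq> 0) \<and> residual n x p \<noteq> 0" (is "?L \<longleftrightarrow> ?R")
proof
  assume ?L
  then obtain B where B: "\<And>i k. i < p \<Longrightarrow> k < p \<Longrightarrow> (\<Sum>l<p. C i l * B l k) = (if i = k then 1 else 0)"
    by (auto simp: right_inverse_on_def)
  have "(\<Sum>l<p. C i l * (\<Sum>k<p. B l k * xb k)) = 1 * xb i" if i: "i < p" for i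
  proof -
    have "(\<Sum>l<p. C i l * (\<Sum>k<p. B l k * xb k)) = (\<Sum>k<p. (\<Sum>l<p. C i l * B l k) * xb k)"
      unfolding sum_distrib_left sum_distrib_right by (subst sum.swap) (simp add: mult_ac)
    also have "\<dots> = (\<Sum>k<p. if i = k then xb k else 0)" using i by (intro sum.cong) (auto simp: B)
    finally show ?thesis using i by simp
  qed
  from cov_solution_residual(1)[OF this] have "residual n x p \<noteq> 0" by auto
  moreover have "pivot n x k \<noteq> 0" if k: "k < p" for k
  proof
    assume "pivot n x k = 0"
    then have w: "mv n (residual_proj n x k) (x k) i = 0" if "i < n" for i using that by (intro proj_kernel is_proj_residual_proj) (auto simp: pivot_def)
    obtain c where c: "\<And>i. i < n \<Longrightarrow> x k i - mv n (residual_proj n x k) (x k) i = (\<Sum>j<k. c j * x j i)" using residual_proj_span by blast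
    \<comment> \<open>The coefficients of the dependence of row k on the earlier rows; the entry 1
      at k is what survives in the contradiction 0 = 1.\<close>
    define y where "y j = (if j < k then - c j else if j = k then 1 else 0)" for j
    have h: "comb y i = 0" if i: "i < n" for i
    proof -
      have "comb y i = (\<Sum>j<Suc k. y j * x j i)" unfolding comb_def using k by (intro sum.mono_neutral_right) (auto simp: y_def)
      also have "\<dots> = (\<Sum>j<k. - c j * x j i) + x k i" by (simp add: y_def)
      also have "\<dots> = 0" using c[OF i] w[OF i] by (simp add: sum_negf)
      finally show ?thesis .
    qed
    then have "dot n z (comb y) = 0" for z by (simp add: dot_def)
    moreover from this have "tau y = 0" using comb_sum[of y] n by simp
    ultimately have "(\<Sum>l<p. C i l * y l) = 0" for i by (simp add: cov_apply)
    \<comment> \<open>A right inverse is met by a left kernel vector; symmetry of the covariance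
      provides it.\<close>
    moreover have "(\<Sum>l<p. C i l * y l) = (\<Sum>l<p. y l * C l i)" for i
      unfolding sample_cov_def by (intro sum.cong refl) (simp add: mult.commute)
    ultimately have "(\<Sum>l<p. y l * C l i) = 0" for i by simp
    then have "0 = (\<Sum>i<p. (\<Sum>l<p. y l * C l i) * B i k)" by simp
    also have "\<dots> = (\<Sum>l<p. y l * (\<Sum>i<p. C l i * B i k))"
      unfolding sum_distrib_left sum_distrib_right by (subst sum.swap) (simp add: mult_ac)
    also have "\<dots> = (\<Sum>l<p. if l = k then y l else 0)" using k by (intro sum.cong) (auto simp: B)
    also have "\<dots> = 1" using k by (simp add: y_def)
    finally show False by simp
  qed
  ultimately show ?R by blast
next
  assume R: ?R
  \<comment> \<open>Trivial kernel implies non-zero determinant and hence an inverse. Matrix theory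
    enters for this finite-dimensional fact alone.\<close>
  define A where "A = mat p p (\<lambda>(i, j). C i j)"
  have A: "A \<in> carrier_mat p p" by (simp add: A_def)
  have "det A \<noteq> 0"
  proof
    assume "det A = 0"
    then obtain v where v: "v \<in> carrier_vec p" "v \<noteq> 0\<^sub>v p" "A *\<^sub>v v = 0\<^sub>v p"
      using det_0_iff_vec_prod_zero_field[OF A] by blast
    define y where "y l = v $ l" for l
    have "(\<Sum>l<p. C i l * y l) = 0 * xb i" if i: "i < p" for i
    proof -
      have "(A *\<^sub>v v) $ i = (\<Sum>l<p. C i l * y l)"
        using i v(1) by (simp add: A_def scalar_prod_def y_def atLeast0LessThan)
      then show ?thesis using v(3) i by simp
    qed
    note s = cov_solution_residual[OF this]
    from s(1) R have "tau y = 0" by auto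
    with s(2) have "\<And>i. i < n \<Longrightarrow> comb y i = 0" by auto
    with R have "\<And>l. l < p \<Longrightarrow> y l = 0" using comb_zero by blast
    then have "v = 0\<^sub>v p" using v(1) by (intro eq_vecI) (auto simp: y_def)
    with v show False by simp
  qed
  from det_non_zero_imp_unit[OF A this, of "()"] obtain B where B: "B \<in> carrier_mat p p" "A * B = 1\<^sub>m p"
    unfolding Units_def ring_mat_def by auto
  have "(\<Sum>l<p. C i l * (B $$ (l, k))) = (if i = k then 1 else 0)" if "i < p" "k < p" for i k
  proof -
    have "(A * B) $$ (i, k) = (\<Sum>l<p. C i l * (B $$ (l, k)))"
      using that A B(1) by (simp add: A_def scalar_prod_def atLeast0LessThan)
    then have "(1\<^sub>m p :: real mat) $$ (i, k) = (\<Sum>l<p. C i l * (B $$ (l, k)))" unfolding B(2) .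
    then show ?thesis using that by (simp only: index_one_mat(1))
  qed
  then show ?L by (auto simp: right_inverse_on_def intro!: exI[of _ "\<lambda>l k. B $$ (l, k)"])
qed

text \<open>Shift and scale cancel between the mean and the covariance. The value is independent of
  the inverse picked by \<open>SOME\<close>: it equals tau y for y = B xb, which solves C y = xb,
  and \<open>cov_solution_residual\<close> determines tau y from the residual.\<close>

lemma inv_quad_form_eq:
  assumes \<sigma>: "\<sigma> \<noteq> 0" and X: "\<And>i j. i < p \<Longrightarrow> j < n \<Longrightarrow> X i j = \<mu> + \<sigma> * x i j"
  shows "inv_quad_form p (sample_cov n X) (\<lambda>i. sample_mean n X i - \<mu>) =
    (if (\<forall>k<p. pivot n x k \<noteq> 0) \<and> residual n x p \<noteq> 0 then 1 / residual n x p - 1 else 0)"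
proof -
  have m: "sample_mean n X i = \<mu> + \<sigma> * xb i" if "i < p" for i
    using n that by (simp add: sample_mean_def X sum.distrib sum_distrib_left[symmetric] add_divide_distrib)
  have S: "sample_cov n X i k = \<sigma>\<^sup>2 * C i k" if "i < p" "k < p" for i k
  proof -
    have "sample_cov n X i k = (\<Sum>j<n. \<sigma>\<^sup>2 * ((x i j - xb i) * (x k j - xb k))) / real n"
      unfolding sample_cov_def using that
      by (intro arg_cong2[of _ _ _ _ "(/)"] sum.cong refl) (simp add: m X power2_eq_square algebra_simps)
    then show ?thesis by (simp add: sample_cov_def sum_distrib_left)
  qed
  have r: "right_inverse_on p (sample_cov n X) B \<longleftrightarrow> right_inverse_on p C (\<lambda>l k. \<sigma>\<^sup>2 * B l k)" for B
    unfolding right_inverse_on_def by (auto simp: S mult_ac cong: sum.cong_simp)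
  have ex: "(\<exists>B. right_inverse_on p (sample_cov n X) B) \<longleftrightarrow> (\<exists>B. right_inverse_on p C B)"
  proof
    assume "\<exists>B. right_inverse_on p C B"
    then obtain B where B: "right_inverse_on p C B" by blast
    have "right_inverse_on p (sample_cov n X) (\<lambda>l k. B l k / \<sigma>\<^sup>2)" using B \<sigma> by (simp add: r)
    then show "\<exists>B. right_inverse_on p (sample_cov n X) B" by blast
  qed (auto simp: r)
  show ?thesis
  proof (cases "\<exists>B. right_inverse_on p (sample_cov n X) B")
    case False
    then have nd: "\<not> ((\<forall>k<p. pivot n x k \<noteq> 0) \<and> residual n x p \<noteq> 0)" using ex right_inverse_iff by blast
    show ?thesis unfolding if_not_P[OF nd] inv_quad_form_def if_not_P[OF False] ..
  next
    case True
    define B where "B = (SOME B. right_inverse_on p (sample_cov n X) B)"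
    have "right_inverse_on p (sample_cov n X) B" unfolding B_def by (rule someI_ex[OF True])
    then have B: "right_inverse_on p C (\<lambda>l k. \<sigma>\<^sup>2 * B l k)" by (rule r[THEN iffD1])
    define y where "y l = (\<Sum>k<p. \<sigma>\<^sup>2 * B l k * xb k)" for l
    have "(\<Sum>l<p. C i l * y l) = 1 * xb i" if i: "i < p" for i
    proof -
      have "(\<Sum>l<p. C i l * y l) = (\<Sum>k<p. (\<Sum>l<p. C i l * (\<sigma>\<^sup>2 * B l k)) * xb k)"
        unfolding y_def sum_distrib_left sum_distrib_right by (subst sum.swap) (simp add: mult_ac)
      also have "\<dots> = (\<Sum>k<p. if i = k then xb k else 0)" using i B by (intro sum.cong) (auto simp: right_inverse_on_def)
      finally show ?thesis using i by simp
    qed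
    from cov_solution_residual(1)[OF this] have t: "(1 + tau y) * residual n x p = 1" .
    then have "tau y = 1 / residual n x p - 1" by (cases "residual n x p = 0") (auto simp: field_simps)
    moreover have "(\<Sum>i<p. \<Sum>k<p. (sample_mean n X i - \<mu>) * B i k * (sample_mean n X k - \<mu>)) = tau y"
      by (simp add: tau_def y_def m sum_distrib_left power2_eq_square mult_ac cong: sum.cong_simp)
    moreover have "(\<forall>k<p. pivot n x k \<noteq> 0) \<and> residual n x p \<noteq> 0" using True ex right_inverse_iff by blast
    ultimately show ?thesis unfolding inv_quad_form_def if_P[OF True] B_def[symmetric] Let_def by simp
  qed
qed

end

section \<open>Inverse moments of the Marchenko--Pastur law\<close>

lemma cancel_factor: "s \<noteq> 0 \<Longrightarrow> c / (k * s) * (s / z) = c / (k * z)" for s c k z :: real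
  by simp

context
  fixes a b :: real
  assumes ab: "0 < a" "a < b"
begin

private definition "R x = sqrt ((b - x) * (x - a))"
private abbreviation (input) "s \<equiv> sqrt (a * b)"
text \<open>\<open>A1\<close> and \<open>A2\<close> are antiderivatives of 1 / R and s / (x R). Both
  arguments run from -1 to 1 over [a,b]; the second is, up to sign, the first for the interval
  [1/b, 1/a] evaluated at 1/x.\<close>

private definition "A1 x = arcsin ((2 * x - a - b) / (b - a))"
private definition "A2 x = arcsin (((a + b) * x - 2 * (a * b)) / ((b - a) * x))"

private lemma s_pos: "0 < s" "s * s = a * b"
  using ab by simp_all

private lemma R_pos: "a < x \<Longrightarrow> x < b \<Longrightarrow> 0 < R x" "a \<le> x \<Longrightarrow> x \<le> b \<Longrightarrow> R x * R x = (b - x) * (x - a)"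
  by (simp_all add: R_def)

private lemma R_deriv:
  assumes "a < x" "x < b" shows "(R has_real_derivative (a + b - 2 * x) / (2 * R x)) (at x)"
proof -
  have 1: "((\<lambda>x. (b - x) * (x - a)) has_real_derivative (a + b - 2 * x)) (at x)"
    by (auto intro!: derivative_eq_intros)
  have 2: "0 < (b - x) * (x - a)" using assms by simp
  have "(R has_real_derivative inverse (R x) / 2 * (a + b - 2 * x)) (at x)"
    using DERIV_chain2[OF DERIV_real_sqrt[OF 2] 1] unfolding R_def[abs_def] .
  moreover have "inverse (R x) / 2 * (a + b - 2 * x) = (a + b - 2 * x) / (2 * R x)" using R_pos(1)[OF assms] by (simp add: field_simps)
  ultimately show ?thesis by (simp only:)
qed

private lemma A1_arg: "(2 * x - a - b) / (b - a) \<le> 1 \<and> -1 \<le> (2 * x - a - b) / (b - a)" if "a \<le> x" "x \<le> b" for x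
proof -
  have "0 < b - a" using ab by simp
  then show ?thesis unfolding pos_divide_le_eq[OF \<open>0 < b - a\<close>] pos_le_divide_eq[OF \<open>0 < b - a\<close>] using that by auto
qed

private lemma A1_deriv:
  assumes x: "a < x" "x < b" shows "(A1 has_real_derivative 1 / R x) (at x)"
proof -
  let ?g = "(2 * x - a - b) / (b - a)"
  have e: "1 - ?g\<^sup>2 = (2 * R x / (b - a))\<^sup>2"
  proof -
    have "(2 * R x / (b - a))\<^sup>2 = 4 * ((b - x) * (x - a)) / (b - a)\<^sup>2"
      using R_pos(2)[of x] x by (simp add: power_divide power2_eq_square)
    also have "\<dots> = ((b - a)\<^sup>2 - (2 * x - a - b)\<^sup>2) / (b - a)\<^sup>2" by (simp add: power2_eq_square algebra_simps)
    finally show ?thesis using ab unfolding power_divide[of "2 * x - a - b"] by (simp only: diff_divide_distrib) simp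
  qed
  have p: "0 < 2 * R x / (b - a)" using R_pos(1)[OF x] ab by simp
  have "?g\<^sup>2 < 1" using e p by (smt (verit) zero_less_power)
  then have g: "-1 < ?g" "?g < 1" by (auto simp: power2_less_1_iff abs_less_iff abs_square_less_1)
  have sq: "sqrt (1 - ?g\<^sup>2) = 2 * R x / (b - a)" unfolding e using p by (simp only: real_sqrt_abs abs_of_pos)
  have "((\<lambda>x. (2 * x - a - b) / (b - a)) has_real_derivative 2 / (b - a)) (at x)"
    by (intro DERIV_cdivide) (auto intro!: derivative_eq_intros)
  from DERIV_chain2[OF DERIV_arcsin[OF g] this]
  have "(A1 has_real_derivative inverse (2 * R x / (b - a)) * (2 / (b - a))) (at x)"
    unfolding A1_def[abs_def] sq .
  moreover
  have k: "inverse (2 * r / e) * (2 / e) = 1 / r" if "e \<noteq> 0" for r e :: real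
    using that by (simp add: field_simps)
  have "b - a \<noteq> 0" using ab by simp
  note k[OF this, of "R x"]
  ultimately show ?thesis using \<open>b - a \<noteq> 0\<close> by (simp only: k)
qed

private lemma A2_deriv:
  assumes x: "a < x" "x < b" shows "(A2 has_real_derivative s / (x * R x)) (at x)"
proof -
  let ?g = "((a + b) * x - 2 * (a * b)) / ((b - a) * x)"
  have x0: "0 < x" using x ab by simp
  have e: "1 - ?g\<^sup>2 = (2 * s * R x / ((b - a) * x))\<^sup>2"
  proof -
    have "(2 * s * R x / ((b - a) * x))\<^sup>2 = 4 * (s * s) * (R x * R x) / ((b - a) * x)\<^sup>2"
      by (simp add: power_divide power2_eq_square)
    also have "\<dots> = 4 * (a * b) * ((b - x) * (x - a)) / ((b - a) * x)\<^sup>2"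
      using R_pos(2)[of x] x s_pos by simp
    also have "\<dots> = (((b - a) * x)\<^sup>2 - ((a + b) * x - 2 * (a * b))\<^sup>2) / ((b - a) * x)\<^sup>2" by (simp add: power2_eq_square algebra_simps)
    finally show ?thesis using ab x0 unfolding power_divide[of "(a + b) * x - 2 * (a * b)"] by (simp only: diff_divide_distrib) simp
  qed
  have p: "0 < 2 * s * R x / ((b - a) * x)" using R_pos(1)[OF x] ab x0 s_pos by (auto intro!: divide_pos_pos mult_pos_pos)
  have "?g\<^sup>2 < 1" using e p by (smt (verit) zero_less_power)
  then have "\<bar>?g\<bar> < 1" by (simp only: abs_square_less_1)
  then have g: "-1 < ?g" "?g < 1" by linarith+
  have sq: "sqrt (1 - ?g\<^sup>2) = 2 * s * R x / ((b - a) * x)" unfolding e using p by (simp only: real_sqrt_abs abs_of_pos)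
  have "((\<lambda>x. ((a + b) * x - 2 * (a * b)) / ((b - a) * x)) has_real_derivative 2 * (a * b) / ((b - a) * x\<^sup>2)) (at x)"
  proof -
    have 1: "((\<lambda>x. (a + b) * x - 2 * (a * b)) has_real_derivative (a + b)) (at x)" "((\<lambda>x. (b - a) * x) has_real_derivative (b - a)) (at x)"
      by (auto intro!: derivative_eq_intros)
    have "((a + b) * (e * x) - ((a + b) * x - 2 * (a * b)) * e) / ((e * x) * (e * x)) = 2 * (a * b) / (e * x\<^sup>2)" if "e \<noteq> 0" for e
      using that x0 by (simp add: field_simps power2_eq_square)
    then have "((a + b) * ((b - a) * x) - ((a + b) * x - 2 * (a * b)) * (b - a)) / (((b - a) * x) * ((b - a) * x)) = 2 * (a * b) / ((b - a) * x\<^sup>2)"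
      using ab by simp
    moreover have "(b - a) * x \<noteq> 0" using ab x0 by simp
    ultimately show ?thesis using DERIV_divide[OF 1] by simp
  qed
  from DERIV_chain2[OF DERIV_arcsin[OF g] this]
  have "(A2 has_real_derivative inverse (2 * s * R x / ((b - a) * x)) * (2 * (a * b) / ((b - a) * x\<^sup>2))) (at x)"
    unfolding A2_def[abs_def] sq .
  also have "inverse (2 * s * R x / ((b - a) * x)) * (2 * (a * b) / ((b - a) * x\<^sup>2)) = (a * b) / (s * (x * R x))"
  proof -
    have k: "inverse (2 * t * r / (e * x)) * (2 * k / (e * x\<^sup>2)) = k / (t * (x * r))" if "e \<noteq> 0" for r e t k :: real
      using that x0 by (simp add: field_simps power2_eq_square)
    have "b - a \<noteq> 0" using ab by simp
    then show ?thesis by (rule k)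
  qed
  also have "\<dots> = (s * s) / (s * (x * R x))" by (simp only: s_pos(2))
  also have "\<dots> = s / (x * R x)"
  proof -
    have "t * t / (t * z) = t / z" if "0 < t" for t z :: real using that by simp
    then show ?thesis using s_pos(1) by blast
  qed
  finally show ?thesis .
qed

private lemma A2_arg: "((a + b) * x - 2 * (a * b)) / ((b - a) * x) \<le> 1 \<and> -1 \<le> ((a + b) * x - 2 * (a * b)) / ((b - a) * x)" if x: "a \<le> x" "x \<le> b" for x
proof -
  have x0: "0 < x" using x ab by simp
  have "0 \<le> 2 * a * (b - x)" "0 \<le> 2 * b * (x - a)" using x ab by auto
  moreover have "0 < (b - a) * x" using ab x0 by simp
  ultimately show ?thesis
    unfolding pos_divide_le_eq[OF \<open>0 < (b - a) * x\<close>] pos_le_divide_eq[OF \<open>0 < (b - a) * x\<close>] by (simp add: algebra_simps)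
qed

private lemma continuous_pieces: "continuous_on {a..b} R" "continuous_on {a..b} A1" "continuous_on {a..b} A2"
  unfolding R_def[abs_def] A1_def[abs_def] A2_def[abs_def] using ab A1_arg A2_arg
  by (auto intro!: continuous_intros)

private lemma endpoints: "R a = 0" "R b = 0" "A1 a = - (pi/2)" "A1 b = pi/2" "A2 a = - (pi/2)" "A2 b = pi/2"
proof -
  have "(2 * a - a - b) / (b - a) = -1" "(2 * b - a - b) / (b - a) = 1" using ab by (simp_all add: field_simps)
  then show "A1 a = - (pi/2)" "A1 b = pi/2" by (simp_all add: A1_def)
  have "((a + b) * a - 2 * (a * b)) / ((b - a) * a) = -1" "((a + b) * b - 2 * (a * b)) / ((b - a) * b) = 1"
    using ab by (simp_all add: field_simps)
  then show "A2 a = - (pi/2)" "A2 b = pi/2" unfolding A2_def by simp_all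
qed (simp_all add: R_def)

text \<open>The derivative is required only inside the interval because R has vertical tangents at a
  and b.\<close>

private lemma lebesgue_of_antiderivative:
  assumes F: "continuous_on {a..b} F" "\<And>x. a < x \<Longrightarrow> x < b \<Longrightarrow> (F has_real_derivative f x) (at x)" and f: "continuous_on {a..b} f"
  shows "(\<integral>x. indicator {a..b} x * f x \<partial>lborel) = F b - F a"
proof -
  have "(f has_integral (F b - F a)) {a..b}"
    using ab F by (intro fundamental_theorem_of_calculus_interior) (auto simp: has_real_derivative_iff_has_vector_derivative)
  then have "integral {a..b} f = F b - F a" by (rule integral_unique)
  moreover have "(LINT x:{a..b}|lborel. f x) = integral {a..b} f"
    by (rule set_borel_integral_eq_integral(2)[OF borel_integrable_atLeastAtMost'[OF f]])
  ultimately show ?thesis by (simp add: set_lebesgue_integral_def)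
qed

lemma integral_sqrt_div_x2:
  "(\<integral>x. indicator {a..b} x * (sqrt ((b - x) * (x - a)) / x\<^sup>2) \<partial>lborel) = pi * ((a + b) / (2 * sqrt (a * b)) - 1)"
proof -
  \<comment> \<open>Integration by parts: the boundary term -R/x leaves (a + b - 2 x) / (2 x R),
    which splits into the derivatives of \<open>A2\<close> and \<open>A1\<close>.\<close>
  define F where "F x = - (R x / x) + (a + b) / (2 * s) * A2 x - A1 x" for x
  have "(\<integral>x. indicator {a..b} x * (R x / x\<^sup>2) \<partial>lborel) = F b - F a"
  proof (rule lebesgue_of_antiderivative)
    show "continuous_on {a..b} F" unfolding F_def[abs_def] using ab by (intro continuous_intros continuous_pieces) auto
    show "continuous_on {a..b} (\<lambda>x. R x / x\<^sup>2)" using ab by (intro continuous_intros continuous_pieces) auto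
    fix x assume x: "a < x" "x < b"
    have x0: "0 < x" and R0: "0 < R x" using x ab R_pos by auto
    have "(F has_real_derivative - (((a + b - 2 * x) / (2 * R x) * x - R x * 1) / (x * x)) + (a + b) / (2 * s) * (s / (x * R x)) - 1 / R x) (at x)"
      unfolding F_def[abs_def]
      by (intro DERIV_diff DERIV_add DERIV_minus DERIV_cmult DERIV_divide R_deriv A1_deriv A2_deriv DERIV_ident x) (use x0 in simp)
    also have "- (((a + b - 2 * x) / (2 * R x) * x - R x * 1) / (x * x)) + (a + b) / (2 * s) * (s / (x * R x)) - 1 / R x
      = - (a + b - 2 * x) / (2 * R x * x) + R x / (x * x) + (a + b) / (2 * (x * R x)) - 1 / R x"
    proof -
      have "(a + b) / (2 * s) * (s / (x * R x)) = (a + b) / (2 * (x * R x))" using s_pos(1) by (intro cancel_factor) (rule less_imp_neq[symmetric])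
      moreover have "(a + b - 2 * x) / (2 * R x) * x - R x * 1 = x * ((a + b - 2 * x) / (2 * R x)) - R x" by simp
      moreover have "- ((x * ((a + b - 2 * x) / (2 * R x)) - R x) / (x * x)) = - (a + b - 2 * x) / (2 * R x * x) + R x / (x * x)"
        using x0 R0 by (simp add: field_simps)
      ultimately show ?thesis by presburger
    qed
    also have "\<dots> = R x / x\<^sup>2"
      using x0 R0 by (simp add: field_simps power2_eq_square)
    finally show "(F has_real_derivative R x / x\<^sup>2) (at x)" .
  qed
  also have "\<dots> = pi * ((a + b) / (2 * s) - 1)"
  proof -
    have "- (0 / b) + k * (pi / 2) - pi / 2 - (- (0 / a) + k * - (pi / 2) - - (pi / 2)) = pi * (k - 1)" for k
      by (simp add: field_simps)
    then show ?thesis unfolding F_def endpoints .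
  qed
  finally show ?thesis by (simp add: R_def)
qed

lemma integral_sqrt_div_x3:
  "(\<integral>x. indicator {a..b} x * (sqrt ((b - x) * (x - a)) / x ^ 3) \<partial>lborel) = pi * (b - a)\<^sup>2 / (8 * (a * b) * sqrt (a * b))"
proof -
  define c where "c = (b - a)\<^sup>2 / (8 * (a * b))"
  \<comment> \<open>Integration by parts leaves (a + b - 2 x) / (4 x^2 R). Here 1 / (x^2 R) is
    (R/x)' / (a b) plus (a + b) / (2 a b) times 1 / (x R); the coefficient c of \<open>A2\<close> /
    s is (a + b)^2 / (8 a b) - 1/2.\<close>
  define F where "F x = - (R x / (2 * x\<^sup>2)) + (a + b) / (4 * (a * b)) * (R x / x) + c / s * A2 x" for x
  have "(\<integral>x. indicator {a..b} x * (R x / x ^ 3) \<partial>lborel) = F b - F a"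
  proof (rule lebesgue_of_antiderivative)
    show "continuous_on {a..b} F" unfolding F_def[abs_def] using ab by (intro continuous_intros continuous_pieces) auto
    show "continuous_on {a..b} (\<lambda>x. R x / x ^ 3)" using ab by (intro continuous_intros continuous_pieces) auto
    fix x assume x: "a < x" "x < b"
    have x0: "0 < x" and R0: "0 < R x" using x ab R_pos by auto
    let ?r = "(a + b - 2 * x) / (2 * R x)"
    have d2: "((\<lambda>x. 2 * x\<^sup>2) has_real_derivative 4 * x) (at x)" by (auto intro!: derivative_eq_intros)
    have "(F has_real_derivative - ((?r * (2 * x\<^sup>2) - R x * (4 * x)) / ((2 * x\<^sup>2) * (2 * x\<^sup>2)))
       + (a + b) / (4 * (a * b)) * ((?r * x - R x * 1) / (x * x)) + c / s * (s / (x * R x))) (at x)"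
      unfolding F_def[abs_def]
      by (intro DERIV_diff DERIV_add DERIV_minus DERIV_cmult DERIV_divide R_deriv A2_deriv DERIV_ident d2 x) (use x0 in simp_all)
    also have "- ((?r * (2 * x\<^sup>2) - R x * (4 * x)) / ((2 * x\<^sup>2) * (2 * x\<^sup>2)))
       + (a + b) / (4 * (a * b)) * ((?r * x - R x * 1) / (x * x)) + c / s * (s / (x * R x))
      = (R x * R x) / (x ^ 3 * R x)"
    proof -
      have 1: "(?r * (2 * x\<^sup>2) - R x * (4 * x)) / ((2 * x\<^sup>2) * (2 * x\<^sup>2)) = ((a + b - 2 * x) * x - 4 * (R x * R x)) / (4 * x ^ 3 * R x)"
        using x0 R0 by (simp add: field_simps power2_eq_square power3_eq_cube)
      have 2: "(?r * x - R x * 1) / (x * x) = ((a + b - 2 * x) * x - 2 * (R x * R x)) / (2 * x\<^sup>2 * R x)"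
        using x0 R0 by (simp add: field_simps power2_eq_square)
      have 3: "c / s * (s / (x * R x)) = c / (x * R x)" using cancel_factor[of s c 1 "x * R x", OF less_imp_neq[OF s_pos(1), symmetric]] by (simp only: mult_1_left)
      have RR: "R x * R x = (b - x) * (x - a)" using R_pos(2) x by simp
      have 4: "((a + b - 2 * x) * x - 2 * (R x * R x)) = 2 * (a * b) - (a + b) * x" unfolding RR by (simp add: algebra_simps)
      have "- (((a + b - 2 * x) * x - 4 * (R x * R x)) / (4 * x ^ 3 * R x)) + (a + b) / (4 * (a * b)) * ((2 * (a * b) - (a + b) * x) / (2 * x\<^sup>2 * R x)) + c / (x * R x)
        = (- ((a + b - 2 * x) * x - 4 * (R x * R x)) * (8 * (a * b)) + (a + b) * x * (2 * (2 * (a * b) - (a + b) * x)) * 2 + c * (4 * x\<^sup>2) * (8 * (a * b))) / (32 * (a * b) * (x ^ 3 * R x))"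
        using x0 R0 ab by (simp add: field_simps power2_eq_square power3_eq_cube)
      also have "c * (4 * x\<^sup>2) * (8 * (a * b)) = (b - a)\<^sup>2 * (4 * x\<^sup>2)" using ab by (simp add: c_def)
      also have "(- ((a + b - 2 * x) * x - 4 * (R x * R x)) * (8 * (a * b)) + (a + b) * x * (2 * (2 * (a * b) - (a + b) * x)) * 2 + (b - a)\<^sup>2 * (4 * x\<^sup>2)) = 32 * (a * b) * (R x * R x)"
        unfolding RR by (simp add: power2_eq_square algebra_simps)
      also have "\<dots> / (32 * (a * b) * (x ^ 3 * R x)) = (R x * R x) / (x ^ 3 * R x)" using ab by simp
      finally show ?thesis unfolding 1 2 3 4 .
    qed
    also have "\<dots> = R x / x ^ 3" using R0 by simp
    finally show "(F has_real_derivative R x / x ^ 3) (at x)" .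
  qed
  also have "\<dots> = pi * (c / s)" by (simp add: F_def endpoints)
  finally show ?thesis by (simp add: R_def c_def)
qed

end

lemma marchenko_pastur_eq_density:
  assumes "y \<le> 1"
  shows "marchenko_pastur y = density lborel (\<lambda>x. ennreal (mp_density y x))"
proof -
  let ?D = "density lborel (\<lambda>x. ennreal (mp_density y x))"
  have "marchenko_pastur y = measure_of (space ?D) (sets ?D) (emeasure ?D)"
    using assms by (simp add: marchenko_pastur_def)
  then show ?thesis by (simp only: measure_of_of_measure)
qed

text \<open>For y < 1 there is no atom, and the support endpoints satisfy a b = (1 - y)^2. The
  centring c_n / (1 - c_n) then equals 1 / (1 - c_n) - 1, which matches the form 1 / a_p - 1 of the
  statistic.\<close>

lemma mp_moments:
  assumes y: "0 < y" "y < 1"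
  shows "integral\<^sup>L (marchenko_pastur y) (\<lambda>x. 1 / x) = 1 / (1 - y)"
    "integral\<^sup>L (marchenko_pastur y) (\<lambda>x. 1 / x\<^sup>2) = 1 / (1 - y) ^ 3"
proof -
  define a where "a = (1 - sqrt y)\<^sup>2"
  define b where "b = (1 + sqrt y)\<^sup>2"
  have sy: "0 < sqrt y" "sqrt y < 1" "sqrt y * sqrt y = y" using y by auto
  have ba: "b - a = 4 * sqrt y" unfolding a_def b_def by (simp add: power2_eq_square algebra_simps)
  have "0 < a" using sy by (simp add: a_def)
  moreover have "a < b" using sy ba by linarith
  ultimately have ab: "0 < a" "a < b" by auto
  have abm: "sqrt (a * b) = 1 - y" "a * b = (1 - y)\<^sup>2" "a + b = 2 + 2 * y" "(b - a)\<^sup>2 = 16 * y"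
  proof -
    show e: "a * b = (1 - y)\<^sup>2"
      unfolding a_def b_def power_mult_distrib[symmetric] using sy(3) by (simp add: algebra_simps)
    show "sqrt (a * b) = 1 - y" unfolding e using y by simp
    show "a + b = 2 + 2 * y" unfolding a_def b_def using sy(3) by (simp add: power2_eq_square algebra_simps)
    show "(b - a)\<^sup>2 = 16 * y" unfolding ba using y by (simp add: power_mult_distrib)
  qed
  have sq: "sqrt ((1 - y)\<^sup>2) = 1 - y" using y by simp
  have mp: "mp_density y x = indicator {a..b} x * (sqrt ((b - x) * (x - a)) / (2 * pi * y * x))" for x
    by (simp add: mp_density_def a_def b_def Let_def indicator_def)
  have mp0: "0 \<le> mp_density y x" for x
    unfolding mp using ab y by (auto simp: indicator_def intro!: divide_nonneg_nonneg mult_nonneg_nonneg)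
  have mpm: "mp_density y \<in> borel_measurable borel" unfolding mp[abs_def] by measurable
  have I: "integral\<^sup>L (marchenko_pastur y) g = (\<integral>x. mp_density y x * g x \<partial>lborel)" if "g \<in> borel_measurable borel" for g :: "real \<Rightarrow> real"
    using y mp0 mpm that by (simp add: marchenko_pastur_eq_density integral_density)
  have "integral\<^sup>L (marchenko_pastur y) (\<lambda>x. 1 / x) = (\<integral>x. 1 / (2 * pi * y) * (indicator {a..b} x * (sqrt ((b - x) * (x - a)) / x\<^sup>2)) \<partial>lborel)"
    by (subst I) (auto simp: mp power2_eq_square mult_ac intro!: Bochner_Integration.integral_cong)
  also have "\<dots> = 1 / (2 * pi * y) * (pi * ((2 + 2 * y) / (2 * (1 - y)) - 1))"
    by (simp only: Bochner_Integration.integral_mult_right_zero integral_sqrt_div_x2[OF ab] abm sq)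
  also have "\<dots> = 1 / (1 - y)" using y by (simp add: field_simps)
  finally show "integral\<^sup>L (marchenko_pastur y) (\<lambda>x. 1 / x) = 1 / (1 - y)" .
  have "integral\<^sup>L (marchenko_pastur y) (\<lambda>x. 1 / x\<^sup>2) = (\<integral>x. 1 / (2 * pi * y) * (indicator {a..b} x * (sqrt ((b - x) * (x - a)) / x ^ 3)) \<partial>lborel)"
    by (subst I) (auto simp: mp power2_eq_square power3_eq_cube mult_ac intro!: Bochner_Integration.integral_cong)
  also have "\<dots> = 1 / (2 * pi * y) * (pi * (16 * y) / (8 * (1 - y)\<^sup>2 * (1 - y)))"
    by (simp only: Bochner_Integration.integral_mult_right_zero integral_sqrt_div_x3[OF ab] abm sq)
  also have "\<dots> = 1 / (1 - y) ^ 3" using y by (simp add: power2_eq_square power3_eq_cube)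
  finally show "integral\<^sup>L (marchenko_pastur y) (\<lambda>x. 1 / x\<^sup>2) = 1 / (1 - y) ^ 3" .
qed

section \<open>The array process\<close>

lemma residual_proj_cong: "(\<And>i j. i < k \<Longrightarrow> x i j = y i j) \<Longrightarrow> residual_proj n x k = residual_proj n y k"
proof (induction k)
  case (Suc k)
  then have "x k = y k" "residual_proj n x k = residual_proj n y k" by (auto simp: fun_eq_iff)
  then show ?case by simp
qed simp

definition direction :: "nat \<Rightarrow> (nat \<Rightarrow> nat \<Rightarrow> real) \<Rightarrow> nat \<Rightarrow> nat \<Rightarrow> real" where
  "direction n x k i = mv n (residual_proj n x k) (unit1 n) i / sqrt (residual n x k)"

text \<open>The event \<open>good\<close> of \<open>row_step\<close>, with the projection and
  direction computed from the array itself.\<close>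

definition regular_step :: "real \<Rightarrow> nat \<Rightarrow> (nat \<Rightarrow> nat \<Rightarrow> real) \<Rightarrow> nat \<Rightarrow> bool" where
  "regular_step d n x k \<longleftrightarrow> \<bar>pivot n x k / (real n - real k) - 1\<bar> \<le> d \<and> (dot n (direction n x k) (x k))\<^sup>2 \<le> d * sqrt (real n - real k)"

definition regular_upto :: "real \<Rightarrow> nat \<Rightarrow> (nat \<Rightarrow> nat \<Rightarrow> real) \<Rightarrow> nat \<Rightarrow> bool" where
  "regular_upto d n x k \<longleftrightarrow> (\<forall>j<k. regular_step d n x j)"

text \<open>(n - k)/n is the typical size of the residual, being the fraction of dimensions left;
  the factor sqrt n brings the fluctuations to order one.\<close>

definition log_residual :: "nat \<Rightarrow> (nat \<Rightarrow> nat \<Rightarrow> real) \<Rightarrow> nat \<Rightarrow> real" where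
  "log_residual n x k = sqrt (real n) * ln (residual n x k * real n / (real n - real k))"

definition quartic_norm :: "nat \<Rightarrow> (nat \<Rightarrow> nat \<Rightarrow> real) \<Rightarrow> nat \<Rightarrow> real" where
  "quartic_norm n x k = (\<Sum>i<n. direction n x k i ^ 4)"

lemma regular_upto_Suc: "regular_upto d n x (Suc k) \<longleftrightarrow> regular_upto d n x k \<and> regular_step d n x k"
  by (auto simp: regular_upto_def less_Suc_eq)

context
  fixes d :: real and n k :: nat
  assumes d: "0 < d" "d \<le> 1/4" and kn: "k < n" and dm: "2 \<le> d * sqrt (real n - real k)"
begin

lemma regular_step_facts:
  assumes "regular_step d n x k"
  shows "0 < pivot n x k" "0 \<le> (dot n (direction n x k) (x k))\<^sup>2 / pivot n x k" "(dot n (direction n x k) (x k))\<^sup>2 / pivot n x k \<le> 1/2"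
proof -
  define m where "m = real n - real k"
  define s where "s = pivot n x k / m"
  have m: "0 < m" using kn by (simp add: m_def)
  have s: "1/2 \<le> s" using assms d by (auto simp: regular_step_def s_def m_def abs_le_iff)
  have p: "pivot n x k = m * s" using m by (simp add: s_def)
  have ms: "0 < m * s" using m s by simp
  then show p0: "0 < pivot n x k" by (simp only: p)
  then show "0 \<le> (dot n (direction n x k) (x k))\<^sup>2 / pivot n x k" by simp
  have dq: "d * sqrt m \<le> m / 4"
  proof -
    have "2 \<le> d * sqrt m" using dm by (simp add: m_def)
    also have "\<dots> \<le> 1/4 * sqrt m" using d m by (intro mult_right_mono) auto
    finally have "1 \<le> sqrt m" by linarith
    then have "sqrt m * 1 \<le> sqrt m * sqrt m" using m by (intro mult_left_mono) auto
    then have "sqrt m \<le> m" using m by simp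
    then have "d * sqrt m \<le> 1/4 * m" using d m by (intro mult_mono) auto
    then show ?thesis by simp
  qed
  have "(dot n (direction n x k) (x k))\<^sup>2 \<le> m / 4" using assms dq by (simp add: regular_step_def m_def)
  also have "\<dots> \<le> 1/2 * (m * s)" using m s mult_left_mono[of "1/2" s m] by simp
  finally show "(dot n (direction n x k) (x k))\<^sup>2 / pivot n x k \<le> 1/2" using ms by (simp add: p pos_divide_le_eq)
qed

lemma residual_eq: "dot n (mv n (residual_proj n x k) (unit1 n)) (mv n (residual_proj n x k) (unit1 n)) = residual n x k"
  by (simp add: dot_mv_mv is_proj_residual_proj residual_def)

text \<open>The alternative n <= i' appears because idempotence is available only inside the n by n
  corner.\<close>

lemma direction_facts:
  assumes "0 < residual n x k"
  shows "dot n (direction n x k) (direction n x k) = 1" "mv n (residual_proj n x k) (direction n x k) i' = direction n x k i' \<or> n \<le> i'"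
    "mv n (residual_proj n x k) (unit1 n) i = sqrt (residual n x k) * direction n x k i"
proof -
  show e: "mv n (residual_proj n x k) (unit1 n) i = sqrt (residual n x k) * direction n x k i" for i using assms by (simp add: direction_def)
  have "dot n (direction n x k) (direction n x k) = dot n (mv n (residual_proj n x k) (unit1 n)) (mv n (residual_proj n x k) (unit1 n)) / residual n x k"
    using assms by (simp add: direction_def dot_def sum_divide_distrib)
  then show "dot n (direction n x k) (direction n x k) = 1" using assms by (simp add: residual_eq)
  have "mv n (residual_proj n x k) (direction n x k) i' = mv n (residual_proj n x k) (\<lambda>j. (1 / sqrt (residual n x k)) * mv n (residual_proj n x k) (unit1 n) j) i'"
    by (simp add: direction_def[abs_def])
  also have "\<dots> = 1 / sqrt (residual n x k) * mv n (residual_proj n x k) (mv n (residual_proj n x k) (unit1 n)) i'" by (rule mv_scale)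
  finally show "mv n (residual_proj n x k) (direction n x k) i' = direction n x k i' \<or> n \<le> i'"
    by (cases "i' < n") (simp_all add: mv_mv is_proj_residual_proj direction_def)
qed

lemma residual_Suc:
  assumes "0 < residual n x k"
  shows "residual n x (Suc k) = residual n x k * (1 - (dot n (direction n x k) (x k))\<^sup>2 / pivot n x k)"
    "mv n (residual_proj n x (Suc k)) (unit1 n) i = sqrt (residual n x k) * (direction n x k i - dot n (direction n x k) (x k) / pivot n x k * mv n (residual_proj n x k) (x k) i)"
proof -
  let ?P = "residual_proj n x k" and ?r = "sqrt (residual n x k)" and ?xi = "dot n (direction n x k) (x k)"
  note e = direction_facts(3)[OF assms]
  have 1: "dot n (x k) (mv n ?P (unit1 n)) = ?r * ?xi"
  proof -
    have "dot n (x k) (mv n ?P (unit1 n)) = dot n (x k) (\<lambda>i. ?r * direction n x k i)" by (rule dot_cong) (auto simp only: e)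
    then show ?thesis by (simp only: dot_scale_right dot_commute[of n "direction n x k"])
  qed
  have 2: "dot n (unit1 n) (mv n ?P (x k)) = ?r * ?xi"
  proof -
    have "dot n (unit1 n) (mv n ?P (x k)) = dot n (mv n ?P (unit1 n)) (x k)" by (rule dot_mv[OF is_proj_residual_proj])
    also have "\<dots> = dot n (x k) (mv n ?P (unit1 n))" by (rule dot_commute)
    finally show ?thesis using 1 by (simp only:)
  qed
  have 3: "mv n (residual_proj n x (Suc k)) (unit1 n) i = mv n ?P (unit1 n) i - mv n ?P (x k) i * (?r * ?xi / pivot n x k)" for i
    by (simp add: mv_deflate is_proj_residual_proj 1 pivot_def)
  then show "mv n (residual_proj n x (Suc k)) (unit1 n) i = ?r * (direction n x k i - ?xi / pivot n x k * mv n ?P (x k) i)"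
    by (simp add: e algebra_simps)
  have "residual n x (Suc k) = dot n (unit1 n) (\<lambda>i. mv n ?P (unit1 n) i - (?r * ?xi / pivot n x k) * mv n ?P (x k) i)"
    unfolding residual_def[of n x "Suc k"] by (rule dot_cong) (simp_all only: 3 mult.commute[of "mv n ?P (x k) _"])
  also have "\<dots> = residual n x k - (?r * ?xi / pivot n x k) * (?r * ?xi)"
    unfolding dot_diff_right dot_scale_right 2 residual_def[symmetric] ..
  also have "\<dots> = residual n x k - (?r * ?r) * ?xi\<^sup>2 / pivot n x k" by (simp add: power2_eq_square)
  also have "?r * ?r = residual n x k" using assms by simp
  finally show "residual n x (Suc k) = residual n x k * (1 - ?xi\<^sup>2 / pivot n x k)" by (simp add: right_diff_distrib)
qed

lemma step_update:
  assumes r: "0 < residual n x k" and g: "regular_step d n x k"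
  shows "0 < residual n x (Suc k)"
    "Suc k < n \<Longrightarrow> log_residual n x (Suc k) = log_residual n x k + sqrt (real n) * ln (1 + (1 - (dot n (direction n x k) (x k))\<^sup>2 / (pivot n x k / (real n - real k))) / ((real n - real k) - 1))"
    "quartic_norm n x (Suc k) = (\<Sum>i<n. (direction n x k i - dot n (direction n x k) (x k) / pivot n x k * mv n (residual_proj n x k) (x k) i) ^ 4) / (1 - (dot n (direction n x k) (x k))\<^sup>2 / pivot n x k)\<^sup>2"
proof -
  let ?xi = "dot n (direction n x k) (x k)"
  define \<theta> where "\<theta> = ?xi\<^sup>2 / pivot n x k"
  define m where "m = real n - real k"
  have t: "0 \<le> \<theta>" "\<theta> \<le> 1/2" and p: "0 < pivot n x k" using regular_step_facts[OF g] by (auto simp: \<theta>_def)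
  have e: "residual n x (Suc k) = residual n x k * (1 - \<theta>)" using residual_Suc(1)[OF r] by (simp add: \<theta>_def)
  show r': "0 < residual n x (Suc k)" unfolding e using r t by simp
  show "log_residual n x (Suc k) = log_residual n x k + sqrt (real n) * ln (1 + (1 - ?xi\<^sup>2 / (pivot n x k / (real n - real k))) / ((real n - real k) - 1))" if "Suc k < n"
  proof -
    have m: "1 < m" using that by (simp add: m_def)
    \<comment> \<open>One more row lowers the rank from m to m - 1, so the normalised residual
      changes by the factor on the right. The guard \<open>Suc k < n\<close> keeps m - 1
      positive.\<close>
    have "1 + (1 - ?xi\<^sup>2 / (pivot n x k / m)) / (m - 1) = (1 - \<theta>) * m / (m - 1)"
      using m p by (simp add: \<theta>_def field_simps)
    moreover have "residual n x (Suc k) * real n / (real n - real (Suc k)) = (residual n x k * real n / m) * ((1 - \<theta>) * m / (m - 1))"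
    proof -
      have 1: "real n - real (Suc k) = m - 1" by (simp add: m_def)
      show ?thesis unfolding e 1 using m by simp
    qed
    moreover have "ln ((residual n x k * real n / m) * ((1 - \<theta>) * m / (m - 1))) = ln (residual n x k * real n / m) + ln ((1 - \<theta>) * m / (m - 1))"
      using r m t kn by (intro ln_mult_pos) (auto intro!: mult_pos_pos divide_pos_pos)
    ultimately show ?thesis by (simp add: log_residual_def m_def[symmetric] distrib_left)
  qed
  have "direction n x (Suc k) i ^ 4 = (direction n x k i - ?xi / pivot n x k * mv n (residual_proj n x k) (x k) i) ^ 4 / (1 - \<theta>)\<^sup>2" for i
  proof -
    have sq: "sqrt y ^ 4 = y\<^sup>2" if "0 \<le> y" for y using that by (simp add: power4_eq_xxxx power2_eq_square)
    have "direction n x (Suc k) i ^ 4 = (sqrt (residual n x k) * (direction n x k i - ?xi / pivot n x k * mv n (residual_proj n x k) (x k) i)) ^ 4 / sqrt (residual n x (Suc k)) ^ 4"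
      unfolding direction_def[of n x "Suc k"] residual_Suc(2)[OF r] by (simp add: power_divide)
    also have "\<dots> = (residual n x k)\<^sup>2 * (direction n x k i - ?xi / pivot n x k * mv n (residual_proj n x k) (x k) i) ^ 4 / (residual n x k * (1 - \<theta>))\<^sup>2"
      using r r' t by (simp only: power_mult_distrib sq less_imp_le e)
    finally show ?thesis using r by (simp add: power_mult_distrib)
  qed
  then show "quartic_norm n x (Suc k) = (\<Sum>i<n. (direction n x k i - ?xi / pivot n x k * mv n (residual_proj n x k) (x k) i) ^ 4) / (1 - ?xi\<^sup>2 / pivot n x k)\<^sup>2"
    by (simp add: quartic_norm_def \<theta>_def sum_divide_distrib)
qed

end

lemma residual_0: "0 < n \<Longrightarrow> residual n x 0 = 1"
proof -
  assume n: "0 < n"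
  have "mv n (residual_proj n x 0) (unit1 n) i = unit1 n i" if "i < n" for i
    using that by (simp add: mv_def if_distrib[of "\<lambda>t. t * _"] sum.delta' cong: if_cong)
  then have "residual n x 0 = dot n (unit1 n) (unit1 n)" unfolding residual_def by (intro dot_cong) auto
  then show ?thesis using n by (simp add: unit1_unit)
qed

lemma quartic_norm_0: "0 < n \<Longrightarrow> quartic_norm n x 0 = 1 / real n"
proof -
  assume n: "0 < n"
  have "mv n (residual_proj n x 0) (unit1 n) i = unit1 n i" if "i < n" for i
    using that by (simp add: mv_def if_distrib[of "\<lambda>t. t * _"] sum.delta' cong: if_cong)
  then have "quartic_norm n x 0 = (\<Sum>i<n. (1 / sqrt (real n)) ^ 4)" using n by (simp add: quartic_norm_def direction_def residual_0 unit1_def)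
  also have "\<dots> = 1 / real n" using n by (simp add: power4_eq_xxxx)
  finally show ?thesis .
qed

lemma log_residual_0: "0 < n \<Longrightarrow> log_residual n x 0 = 0"
  by (simp add: log_residual_def residual_0)

lemma regular_upto_facts:
  assumes d: "0 < d" "d \<le> 1/4" and k: "k \<le> n" "0 < n" and dm: "\<And>j. j < k \<Longrightarrow> 2 \<le> d * sqrt (real n - real j)" and ok: "regular_upto d n x k"
  shows "0 < residual n x k" "\<And>j. j < k \<Longrightarrow> pivot n x j \<noteq> 0"
proof -
  show "0 < residual n x k" using k dm ok
  proof (induction k)
    case (Suc k)
    then show ?case by (intro step_update(1)[OF d]) (auto simp: regular_upto_Suc)
  qed (simp add: residual_0)
  show "pivot n x j \<noteq> 0" if "j < k" for j
    using regular_step_facts(1)[OF d, of j n x] that k dm ok by (auto simp: regular_upto_def)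
qed

lemma quartic_norm_bounds:
  assumes "0 < residual n x k" shows "0 \<le> quartic_norm n x k" "quartic_norm n x k \<le> 1"
proof -
  show "0 \<le> quartic_norm n x k" by (auto simp: quartic_norm_def intro: sum_nonneg)
  have "(\<Sum>i<n. direction n x k i ^ 4) = (\<Sum>i<n. ((direction n x k i)\<^sup>2)\<^sup>2)" by (simp flip: power_mult)
  also have "\<dots> \<le> (\<Sum>i<n. (direction n x k i)\<^sup>2)\<^sup>2" by (rule sum_power2_le_power2_sum) simp
  also have "(\<Sum>i<n. (direction n x k i)\<^sup>2) = dot n (direction n x k) (direction n x k)" by (simp add: dot_def power2_eq_square)
  also have "\<dots> = 1" 
  proof -
    have "dot n (direction n x k) (direction n x k) = dot n (mv n (residual_proj n x k) (unit1 n)) (mv n (residual_proj n x k) (unit1 n)) / residual n x k"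
      using assms by (simp add: direction_def dot_def sum_divide_distrib)
    then show ?thesis using assms by (simp add: dot_mv_mv is_proj_residual_proj residual_def)
  qed
  finally show "quartic_norm n x k \<le> 1" by (simp add: quartic_norm_def)
qed

section \<open>Measurability on arrays and freezing of the first rows\<close>

abbreviation arr :: "(nat \<times> nat \<Rightarrow> real) \<Rightarrow> nat \<Rightarrow> nat \<Rightarrow> real" where "arr g \<equiv> \<lambda>i j. g (i, j)"

abbreviation "array_space \<equiv> PiM UNIV (\<lambda>_ :: nat \<times> nat. borel :: real measure)"

lemma arr_meas [measurable]: "(\<lambda>g. g (i, j)) \<in> borel_measurable array_space"
  by (rule measurable_component_singleton) simp

lemma residual_proj_meas [measurable]: "(\<lambda>g. residual_proj n (arr g) k i j) \<in> borel_measurable array_space"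
proof (induction k arbitrary: i j)
  case (Suc k)
  note [measurable] = Suc
  show ?case unfolding residual_proj.simps deflate_def mv_def dot_def by measurable
qed simp

lemma pivot_meas [measurable]: "(\<lambda>g. pivot n (arr g) k) \<in> borel_measurable array_space"
  unfolding pivot_def mv_def dot_def by measurable

lemma residual_meas [measurable]: "(\<lambda>g. residual n (arr g) k) \<in> borel_measurable array_space"
  unfolding residual_def mv_def dot_def by measurable

lemma direction_meas [measurable]: "(\<lambda>g. direction n (arr g) k i) \<in> borel_measurable array_space"
  unfolding direction_def mv_def by measurable

lemma log_residual_meas [measurable]: "(\<lambda>g. log_residual n (arr g) k) \<in> borel_measurable array_space"
  unfolding log_residual_def by measurable

lemma quartic_norm_meas [measurable]: "(\<lambda>g. quartic_norm n (arr g) k) \<in> borel_measurable array_space"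
  unfolding quartic_norm_def by measurable

lemma regular_step_meas [measurable]: "Measurable.pred array_space (\<lambda>g. regular_step d n (arr g) k)"
  unfolding regular_step_def dot_def by measurable

lemma regular_upto_meas [measurable]: "Measurable.pred array_space (\<lambda>g. regular_upto d n (arr g) k)"
  unfolding regular_upto_def by measurable

text \<open>The past comes from y, the present and future from z. If y and z come from independent
  copies of the array, averaging over z amounts to conditioning on the first k rows.\<close>

definition mix :: "nat \<Rightarrow> (nat \<Rightarrow> nat \<Rightarrow> real) \<Rightarrow> (nat \<Rightarrow> nat \<Rightarrow> real) \<Rightarrow> nat \<Rightarrow> nat \<Rightarrow> real" where
  "mix k y z = (\<lambda>i. if i < k then y i else z i)"

lemma mix_simps:
  "residual_proj n (mix k y z) k = residual_proj n y k" "mix k y z k = z k" "residual n (mix k y z) k = residual n y k" "direction n (mix k y z) k = direction n y k"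
  "log_residual n (mix k y z) k = log_residual n y k" "quartic_norm n (mix k y z) k = quartic_norm n y k" "regular_upto d n (mix k y z) k = regular_upto d n y k"
proof -
  have P: "residual_proj n (mix k y z) j = residual_proj n y j" if "j \<le> k" for j by (rule residual_proj_cong) (use that in \<open>auto simp: mix_def\<close>)
  show "residual_proj n (mix k y z) k = residual_proj n y k" by (rule P) simp
  show "mix k y z k = z k" by (simp add: mix_def)
  have r: "residual n (mix k y z) j = residual n y j" if "j \<le> k" for j using that by (simp add: residual_def P)
  have D: "direction n (mix k y z) j = direction n y j" if "j \<le> k" for j using that by (simp add: direction_def fun_eq_iff P r)
  show "residual n (mix k y z) k = residual n y k" "direction n (mix k y z) k = direction n y k"
    "log_residual n (mix k y z) k = log_residual n y k" "quartic_norm n (mix k y z) k = quartic_norm n y k" by (simp_all add: r D log_residual_def quartic_norm_def)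
  have row: "mix k y z j = y j" if "j < k" for j using that by (simp add: mix_def)
  have "regular_step d n (mix k y z) j = regular_step d n y j" if "j < k" for j
    using that by (simp add: regular_step_def D pivot_def P row)
  then show "regular_upto d n (mix k y z) k = regular_upto d n y k" by (auto simp: regular_upto_def)
qed

locale iid_array = std_law D + prob_space M for D and M :: "'a measure" +
  fixes Y :: "nat \<Rightarrow> nat \<Rightarrow> 'a \<Rightarrow> real"
  assumes indep2: "indep_vars (\<lambda>_. borel) (\<lambda>(i, j). Y i j) UNIV" and law2: "\<And>i j. distr M borel (Y i j) = D"
begin

abbreviation "YY \<omega> \<equiv> (\<lambda>i j. Y i j \<omega>)"

lemma Y_meas [measurable]: "Y i j \<in> borel_measurable M"
  using indep2 by (auto simp: indep_vars_def)

lemma row_iid: "iid_seq D M (Y k)"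
proof
  have "indep_vars (\<lambda>j. PiM {(k, j)} (\<lambda>_. borel)) (\<lambda>j \<omega>. restrict (\<lambda>i. (case i of (i, j) \<Rightarrow> Y i j) \<omega>) {(k, j)}) UNIV"
    by (rule indep_vars_restrict[OF indep2]) (auto simp: disjoint_family_on_def)
  from indep_vars_compose2[OF this, of "\<lambda>j g. g (k, j)" "\<lambda>_. borel"]
  have "indep_vars (\<lambda>_. borel) (\<lambda>j. Y k j) UNIV" by simp
  then show "indep_vars (\<lambda>_. borel) (Y k) UNIV" .
qed (rule law2)

lemma YY_meas [measurable]: "(\<lambda>\<omega>. \<lambda>(i, j). Y i j \<omega>) \<in> measurable M array_space"
  by (rule measurable_PiM_single') (auto simp: split_beta)

lemma measurable_YY: 
  assumes "(\<lambda>g. F (arr g)) \<in> measurable array_space N" shows "(\<lambda>\<omega>. F (YY \<omega>)) \<in> measurable M N"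
  using measurable_compose[OF YY_meas assms] by simp

lemma mix_meas: 
  assumes "(\<lambda>g. F (arr g)) \<in> measurable array_space N"
  shows "(\<lambda>(\<omega>, \<omega>'). F (mix k (YY \<omega>) (YY \<omega>'))) \<in> measurable (M \<Otimes>\<^sub>M M) N"
proof -
  have "(\<lambda>p. \<lambda>(i, j). if i < k then Y i j (fst p) else Y i j (snd p)) \<in> measurable (M \<Otimes>\<^sub>M M) array_space"
    by (rule measurable_PiM_single') (auto simp: split_beta)
  from measurable_compose[OF this assms]
  have "(\<lambda>p. F (\<lambda>i j. if i < k then Y i j (fst p) else Y i j (snd p))) \<in> measurable (M \<Otimes>\<^sub>M M) N" by simp
  moreover have "(\<lambda>i j. if i < k then Y i j a else Y i j b) = mix k (YY a) (YY b)" for a b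
    by (auto simp: mix_def fun_eq_iff)
  ultimately show ?thesis by (simp only: case_prod_unfold)
qed

text \<open>The rows before k and the remaining ones are independent blocks, so the joint law is
  unchanged when the second block is read from another copy of the sample space. Fubini then takes
  the place of conditional expectation, and the one-step estimates apply to the inner integral,
  where the past is a fixed array.\<close>

lemma mix_integral:
  fixes F :: "(nat \<Rightarrow> nat \<Rightarrow> real) \<Rightarrow> 'b::{banach, second_countable_topology}"
  assumes F [measurable]: "(\<lambda>g. F (arr g)) \<in> borel_measurable array_space" and B: "\<And>y. norm (F y) \<le> B"
  shows "expectation (\<lambda>\<omega>. F (YY \<omega>)) = (\<integral>\<omega>. \<integral>\<omega>'. F (mix k (YY \<omega>) (YY \<omega>')) \<partial>M \<partial>M)"
    "integrable M (\<lambda>\<omega>. \<integral>\<omega>'. F (mix k (YY \<omega>) (YY \<omega>')) \<partial>M)"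
proof -
  let ?A = "{(i, j). i < k} :: (nat \<times> nat) set" and ?B = "- {(i, j). i < k} :: (nat \<times> nat) set"
  let ?X = "\<lambda>(i, j). Y i j"
  let ?U = "\<lambda>\<omega>. restrict (\<lambda>i. ?X i \<omega>) ?A" and ?W = "\<lambda>\<omega>. restrict (\<lambda>i. ?X i \<omega>) ?B"
  let ?PA = "PiM ?A (\<lambda>_. borel :: real measure)" and ?PB = "PiM ?B (\<lambda>_. borel :: real measure)"
  have ind: "indep_var ?PA ?U ?PB ?W"
    by (rule indep_var_restrict[OF indep2]) auto
  then have UW [measurable]: "?U \<in> measurable M ?PA" "?W \<in> measurable M ?PB"
    and eq: "distr M ?PA ?U \<Otimes>\<^sub>M distr M ?PB ?W = distr M (?PA \<Otimes>\<^sub>M ?PB) (\<lambda>\<omega>. (?U \<omega>, ?W \<omega>))"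
    unfolding indep_var_distribution_eq by auto
  define G where "G p = F (arr (merge ?A ?B p))" for p
  have UA: "?A \<union> ?B = UNIV" by auto
  have mg: "merge ?A ?B \<in> measurable (?PA \<Otimes>\<^sub>M ?PB) array_space"
    using measurable_merge[of ?A ?B "\<lambda>_. borel :: real measure"] unfolding UA .
  have G [measurable]: "G \<in> borel_measurable (?PA \<Otimes>\<^sub>M ?PB)"
    unfolding G_def[abs_def] by (rule measurable_compose[OF mg F])
  have GU: "G (?U \<omega>, ?W \<omega>') = F (mix k (YY \<omega>) (YY \<omega>'))" for \<omega> \<omega>'
  proof -
    have "arr (merge ?A ?B (?U \<omega>, ?W \<omega>')) = mix k (YY \<omega>) (YY \<omega>')" by (auto simp: fun_eq_iff merge_def mix_def)
    then show ?thesis by (simp add: G_def)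
  qed
  interpret U: prob_space "distr M ?PA ?U" by (rule prob_space_distr) simp
  interpret W: prob_space "distr M ?PB ?W" by (rule prob_space_distr) simp
  interpret UW: pair_prob_space "distr M ?PA ?U" "distr M ?PB ?W" ..
  interpret MM: pair_prob_space M M ..
  have iG: "integrable (distr M ?PA ?U \<Otimes>\<^sub>M distr M ?PB ?W) G"
    by (rule UW.P.integrable_const_bound[where B=B]) (auto simp: B G_def)
  have mm: "mix k y y = y" for y by (simp add: mix_def)
  have "expectation (\<lambda>\<omega>. F (YY \<omega>)) = expectation (\<lambda>\<omega>. G (?U \<omega>, ?W \<omega>))" by (simp only: GU mm)
  also have "\<dots> = integral\<^sup>L (distr M (?PA \<Otimes>\<^sub>M ?PB) (\<lambda>\<omega>. (?U \<omega>, ?W \<omega>))) G"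
    by (rule integral_distr[symmetric]) auto
  also have "\<dots> = integral\<^sup>L (distr M ?PA ?U \<Otimes>\<^sub>M distr M ?PB ?W) G" by (simp only: eq)
  also have "\<dots> = (\<integral>u. \<integral>w. G (u, w) \<partial>distr M ?PB ?W \<partial>distr M ?PA ?U)"
    by (rule UW.integral_fst'[symmetric, OF iG])
  also have "\<dots> = (\<integral>\<omega>. (\<integral>w. G (?U \<omega>, w) \<partial>distr M ?PB ?W) \<partial>M)"
    by (rule integral_distr) auto
  also have "\<dots> = (\<integral>\<omega>. \<integral>\<omega>'. G (?U \<omega>, ?W \<omega>') \<partial>M \<partial>M)"
  proof (rule Bochner_Integration.integral_cong[OF refl])
    fix \<omega> assume "\<omega> \<in> space M"
    then have "?U \<omega> \<in> space ?PA" using UW(1) by (rule measurable_space[rotated])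
    then have "(\<lambda>w. G (?U \<omega>, w)) \<in> borel_measurable ?PB" by measurable
    then show "(\<integral>w. G (?U \<omega>, w) \<partial>distr M ?PB ?W) = (\<integral>\<omega>'. G (?U \<omega>, ?W \<omega>') \<partial>M)"
      by (intro integral_distr) auto
  qed
  finally show "expectation (\<lambda>\<omega>. F (YY \<omega>)) = (\<integral>\<omega>. \<integral>\<omega>'. F (mix k (YY \<omega>) (YY \<omega>')) \<partial>M \<partial>M)" unfolding GU .
  have iM: "integrable (M \<Otimes>\<^sub>M M) (\<lambda>(\<omega>, \<omega>'). F (mix k (YY \<omega>) (YY \<omega>')))"
    by (rule MM.P.integrable_const_bound[where B=B]) (use mix_meas[OF F] B in auto)
  from MM.integrable_fst'[OF iM] show "integrable M (\<lambda>\<omega>. \<integral>\<omega>'. F (mix k (YY \<omega>) (YY \<omega>')) \<partial>M)" by simp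
qed

end

text \<open>The functionals are restricted to the event that all steps so far were regular. Each step then loses an event
  of probability $o(1/n)$, and these losses can be summed over the $p$ steps.\<close>

definition ochar :: "real \<Rightarrow> nat \<Rightarrow> real \<Rightarrow> nat \<Rightarrow> (nat \<Rightarrow> nat \<Rightarrow> real) \<Rightarrow> complex" where
  "ochar d n t k y = (if regular_upto d n y k then exp (\<i> * of_real (t * log_residual n y k)) else 0)"
definition opsi :: "real \<Rightarrow> nat \<Rightarrow> nat \<Rightarrow> (nat \<Rightarrow> nat \<Rightarrow> real) \<Rightarrow> real" where
  "opsi d n k y = (if regular_upto d n y k then quartic_norm n y k else 0)"
definition oind :: "real \<Rightarrow> nat \<Rightarrow> nat \<Rightarrow> (nat \<Rightarrow> nat \<Rightarrow> real) \<Rightarrow> real" where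
  "oind d n k y = (if regular_upto d n y k then 1 else 0)"

lemma o_meas [measurable]: "(\<lambda>g. ochar d n t k (arr g)) \<in> borel_measurable array_space" "(\<lambda>g. opsi d n k (arr g)) \<in> borel_measurable array_space"
  "(\<lambda>g. oind d n k (arr g)) \<in> borel_measurable array_space"
  unfolding ochar_def opsi_def oind_def by measurable

section \<open>One step, averaged over the earlier rows\<close>

locale array_step = iid_array D M Y for D and M :: "'a measure" and Y +
  fixes n k :: nat and d T :: real
  assumes kn: "Suc k < n" and d: "0 < d" "d \<le> 1/4" and T: "0 < T" and dT: "T + 2 \<le> d * sqrt (real n - real k)"
    and UI: "\<And>x A n. iid_seq D M x \<Longrightarrow> (\<Sum>i<n. \<Sum>j<n. (A i j)\<^sup>2) \<le> 1 \<Longrightarrow> (\<forall>i<n. \<forall>j<n. A i j = A j i) \<Longrightarrow>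
       expectation (\<lambda>\<omega>. (iid_seq.quad x A n \<omega>)\<^sup>2 * indicator {y. T < \<bar>y\<bar>} (iid_seq.quad x A n \<omega>)) \<le> d ^ 4"
begin

abbreviation "m \<equiv> real n - real k"

lemma m_pos: "1 < m" using kn by simp

lemma dm: "j \<le> k \<Longrightarrow> 2 \<le> d * sqrt (real n - real j)"
proof -
  assume "j \<le> k"
  then have "d * sqrt m \<le> d * sqrt (real n - real j)" using d by (intro mult_left_mono) auto
  then show ?thesis using dT T by linarith
qed

lemma regular_upto_residual: "regular_upto d n y k \<Longrightarrow> 0 < residual n y k"
  by (rule regular_upto_facts(1)[OF d]) (use kn dm in auto)

lemma row_step: assumes "regular_upto d n y k"
  shows "row_step D M (Y k) n (residual_proj n y k) (direction n y k) m d T"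
proof -
  interpret r: iid_seq D M "Y k" by (rule row_iid)
  have r: "0 < residual n y k" by (rule regular_upto_residual[OF assms])
  show ?thesis
  proof
    show "is_proj n (residual_proj n y k)" by (rule is_proj_residual_proj)
    show "trace n (residual_proj n y k) = m"
      by (rule trace_residual_proj, rule regular_upto_facts(2)[OF d]) (use kn dm assms in auto)
    show "dot n (direction n y k) (direction n y k) = 1" using direction_facts(1)[OF d _ _ r] kn dm by auto
    show "mv n (residual_proj n y k) (direction n y k) i = direction n y k i" if "i < n" for i
      using direction_facts(2)[OF d _ _ r, of i] kn dm that by auto
    show "expectation (\<lambda>\<omega>. (r.quad A n \<omega>)\<^sup>2 * indicator {y. T < \<bar>y\<bar>} (r.quad A n \<omega>)) \<le> d ^ 4"
      if "(\<Sum>i<n. \<Sum>j<n. (A i j)\<^sup>2) \<le> 1" "\<And>i j. i < n \<Longrightarrow> j < n \<Longrightarrow> A i j = A j i" for A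
      using UI[OF row_iid that(1)] that(2) by blast
  qed (use d T dT kn in auto)
qed

context
  fixes y assumes ok: "regular_upto d n y k"
begin

interpretation r: row_step D M "Y k" n "residual_proj n y k" "direction n y k" m d T
  by (rule row_step[OF ok])

lemma step_xi: "r.xi \<omega>' = dot n (direction n (mix k y (YY \<omega>')) k) (mix k y (YY \<omega>') k)"
  by (simp add: r.xi_def mix_simps)

lemma step_sc: "r.sc \<omega>' = pivot n (mix k y (YY \<omega>')) k / m"
  by (simp add: r.sc_def pivot_def mix_simps)

lemma step_good: "regular_upto d n (mix k y (YY \<omega>')) (Suc k) \<longleftrightarrow> r.good \<omega>'"
  using ok by (simp add: regular_upto_Suc regular_step_def r.good_def step_xi step_sc mix_simps(7))

lemma step_residual: "0 < residual n (mix k y z) k"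
  using regular_upto_residual[OF ok] by (simp add: mix_simps)

lemma ochar_step: "ochar d n t (Suc k) (mix k y (YY \<omega>')) = ochar d n t k y * (exp (\<i> * of_real (t * r.log_incr (real n) \<omega>')) * of_real (1 - r.bad \<omega>'))"
proof (cases "r.good \<omega>'")
  case True
  then have ok': "regular_upto d n (mix k y (YY \<omega>')) (Suc k)" by (simp add: step_good)
  then have g: "regular_step d n (mix k y (YY \<omega>')) k" by (simp add: regular_upto_Suc)
  have "log_residual n (mix k y (YY \<omega>')) (Suc k) = log_residual n y k + r.log_incr (real n) \<omega>'"
    using step_update(2)[OF d _ dm[OF order_refl] step_residual g kn] kn
    by (simp add: r.log_incr_def step_xi step_sc mix_simps(5))
  then show ?thesis using True ok ok'
    by (simp add: ochar_def r.bad_def distrib_left exp_add)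
qed (simp add: ochar_def step_good r.bad_def)

lemma opsi_step: "opsi d n (Suc k) (mix k y (YY \<omega>')) = r.newpsi \<omega>' * (1 - r.bad \<omega>')"
proof (cases "r.good \<omega>'")
  case True
  then have ok': "regular_upto d n (mix k y (YY \<omega>')) (Suc k)" by (simp add: step_good)
  then have g: "regular_step d n (mix k y (YY \<omega>')) k" by (simp add: regular_upto_Suc)
  have s: "m * r.sc \<omega>' = pivot n (mix k y (YY \<omega>')) k" using m_pos by (simp add: step_sc)
  have "quartic_norm n (mix k y (YY \<omega>')) (Suc k) = r.newpsi \<omega>'"
    unfolding r.newpsi_def s step_xi using step_update(3)[OF d _ dm[OF order_refl] step_residual g] kn
    by (simp add: mix_simps)
  then show ?thesis using True ok' by (simp add: opsi_def r.bad_def)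
qed (simp add: opsi_def step_good r.bad_def)

lemma oind_step: "oind d n (Suc k) (mix k y (YY \<omega>')) = 1 - r.bad \<omega>'"
  by (simp add: oind_def step_good r.bad_def)

lemma psi_eq: "r.psi = quartic_norm n y k" by (simp add: r.psi_def quartic_norm_def)

lemma inner_ochar:
  assumes K: "real n \<le> K * m"
  shows "cmod ((\<integral>\<omega>'. ochar d n t (Suc k) (mix k y (YY \<omega>')) \<partial>M) - of_real (1 - t\<^sup>2 * (sqrt (real n) / m)\<^sup>2) * ochar d n t k y)
    \<le> char_const (sqrt K) t * (d + quartic_norm n y k) / m"
proof -
  have "(\<integral>\<omega>'. ochar d n t (Suc k) (mix k y (YY \<omega>')) \<partial>M) - of_real (1 - t\<^sup>2 * (sqrt (real n) / m)\<^sup>2) * ochar d n t k y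
    = ochar d n t k y * (expectation (\<lambda>\<omega>'. exp (\<i> * of_real (t * r.log_incr (real n) \<omega>')) * of_real (1 - r.bad \<omega>')) - of_real (1 - t\<^sup>2 * (sqrt (real n) / m)\<^sup>2))"
    unfolding ochar_step by (simp add: right_diff_distrib mult.commute del: of_real_mult of_real_diff)
  moreover have "cmod (ochar d n t k y) = 1" using ok by (simp add: ochar_def)
  ultimately show ?thesis using r.char_step[of "real n" K t] K kn by (simp add: norm_mult psi_eq del: of_real_mult of_real_diff)
qed

lemma inner_opsi: "(\<integral>\<omega>'. opsi d n (Suc k) (mix k y (YY \<omega>')) \<partial>M) \<le> quartic_norm n y k * (1 + 96 / m) + (1296 * kurt + 18) * d / m"
  unfolding opsi_step using r.psi_step(2) by (simp add: psi_eq)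

lemma inner_oind: "1 - 5 * d\<^sup>2 / m \<le> (\<integral>\<omega>'. oind d n (Suc k) (mix k y (YY \<omega>')) \<partial>M)"
  unfolding oind_step using r.bad_le r.bad_integrable by (simp add: prob_space)

end

lemma ochar_bound: "cmod (ochar d n t j y) \<le> 1" by (simp add: ochar_def)
lemma oind_bound: "norm (oind d n j y) \<le> 1" by (simp add: oind_def)
lemma opsi_bound: "j \<le> Suc k \<Longrightarrow> norm (opsi d n j y) \<le> 1"
proof -
  assume j: "j \<le> Suc k"
  have "0 < residual n y j" if "regular_upto d n y j"
    by (rule regular_upto_facts(1)[OF d _ _ _ that]) (use kn dm j in auto)
  then show ?thesis using quartic_norm_bounds[of n y j] by (auto simp: opsi_def)
qed
lemma opsi_nonneg: "j \<le> Suc k \<Longrightarrow> 0 \<le> opsi d n j y"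
proof -
  assume j: "j \<le> Suc k"
  have "0 < residual n y j" if "regular_upto d n y j"
    by (rule regular_upto_facts(1)[OF d _ _ _ that]) (use kn dm j in auto)
  then show ?thesis using quartic_norm_bounds[of n y j] by (auto simp: opsi_def)
qed

lemma o_meas_M [measurable]: "(\<lambda>\<omega>. ochar d n t j (YY \<omega>)) \<in> borel_measurable M" "(\<lambda>\<omega>. opsi d n j (YY \<omega>)) \<in> borel_measurable M"
  "(\<lambda>\<omega>. oind d n j (YY \<omega>)) \<in> borel_measurable M"
  by (intro measurable_YY o_meas)+

lemma o_integrable: "integrable M (\<lambda>\<omega>. ochar d n t j (YY \<omega>))" "integrable M (\<lambda>\<omega>. oind d n j (YY \<omega>))"
  "j \<le> Suc k \<Longrightarrow> integrable M (\<lambda>\<omega>. opsi d n j (YY \<omega>))"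
  by (rule integrable_const_bound[where B=1]; use ochar_bound oind_bound opsi_bound in auto)+

text \<open>The conditional error bound is affine in the quartic norm of the current direction, so
  averaging over the past brings in nothing but the mean of \<open>opsi\<close>.\<close>

lemma expectation_ochar_step:
  assumes K: "real n \<le> K * m"
  shows "cmod (expectation (\<lambda>\<omega>. ochar d n t (Suc k) (YY \<omega>)) - of_real (1 - t\<^sup>2 * (sqrt (real n) / m)\<^sup>2) * expectation (\<lambda>\<omega>. ochar d n t k (YY \<omega>)))
    \<le> char_const (sqrt K) t * (d + expectation (\<lambda>\<omega>. opsi d n k (YY \<omega>))) / m"
proof -
  let ?c = "of_real (1 - t\<^sup>2 * (sqrt (real n) / m)\<^sup>2) :: complex"
  let ?I = "\<lambda>\<omega>. \<integral>\<omega>'. ochar d n t (Suc k) (mix k (YY \<omega>) (YY \<omega>')) \<partial>M"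
  note mi = mix_integral[of "ochar d n t (Suc k)" 1 k, OF o_meas(1) ochar_bound]
  have Kp: "0 \<le> K"
  proof -
    have "0 \<le> K * m" using K by linarith
    then show ?thesis using m_pos by (simp add: zero_le_mult_iff)
  qed
  have cc: "0 \<le> char_const (sqrt K) t" unfolding char_const_def using kurt_ge_1 Kp
    by (intro add_nonneg_nonneg mult_nonneg_nonneg) auto
  have pw: "cmod (?I \<omega> - ?c * ochar d n t k (YY \<omega>)) \<le> char_const (sqrt K) t * (d + opsi d n k (YY \<omega>)) / m" for \<omega>
  proof (cases "regular_upto d n (YY \<omega>) k")
    case True
    interpret r: row_step D M "Y k" n "residual_proj n (YY \<omega>) k" "direction n (YY \<omega>) k" m d T by (rule row_step[OF True])
    show ?thesis using inner_ochar[OF True K, of t] True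
      by (simp add: opsi_def del: of_real_mult of_real_diff)
  next
    case False
    \<comment> \<open>Regularity is hereditary: an irregular past makes the functional vanish at
      both k and k + 1.\<close>
    then have "regular_upto d n (mix k (YY \<omega>) z) (Suc k) = False" for z by (simp add: regular_upto_Suc mix_simps)
    then show ?thesis using False cc d m_pos by (simp add: ochar_def opsi_def)
  qed
  have "cmod (expectation (\<lambda>\<omega>. ochar d n t (Suc k) (YY \<omega>)) - ?c * expectation (\<lambda>\<omega>. ochar d n t k (YY \<omega>)))
     = cmod (\<integral>\<omega>. ?I \<omega> - ?c * ochar d n t k (YY \<omega>) \<partial>M)"
    using mi o_integrable(1) by (simp del: of_real_mult of_real_diff)
  also have "\<dots> \<le> (\<integral>\<omega>. cmod (?I \<omega> - ?c * ochar d n t k (YY \<omega>)) \<partial>M)" by (rule integral_norm_bound)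
  also have "\<dots> \<le> (\<integral>\<omega>. char_const (sqrt K) t * (d + opsi d n k (YY \<omega>)) / m \<partial>M)"
    using mi(2) o_integrable pw by (intro integral_mono) (auto simp del: of_real_mult of_real_diff)
  also have "\<dots> = char_const (sqrt K) t * (d + expectation (\<lambda>\<omega>. opsi d n k (YY \<omega>))) / m"
    using o_integrable(3)[of k] by (simp add: prob_space)
  finally show ?thesis .
qed

lemma expectation_opsi_step:
  "expectation (\<lambda>\<omega>. opsi d n (Suc k) (YY \<omega>)) \<le> expectation (\<lambda>\<omega>. opsi d n k (YY \<omega>)) * (1 + 96 / m) + (1296 * kurt + 18) * d / m"
proof -
  let ?I = "\<lambda>\<omega>. \<integral>\<omega>'. opsi d n (Suc k) (mix k (YY \<omega>) (YY \<omega>')) \<partial>M"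
  note mi = mix_integral[of "opsi d n (Suc k)" 1 k, OF o_meas(2) opsi_bound[OF order_refl]]
  have pw: "?I \<omega> \<le> opsi d n k (YY \<omega>) * (1 + 96 / m) + (1296 * kurt + 18) * d / m" for \<omega>
  proof (cases "regular_upto d n (YY \<omega>) k")
    case True
    then show ?thesis using inner_opsi[OF True] by (simp add: opsi_def)
  next
    case False
    then have "regular_upto d n (mix k (YY \<omega>) z) (Suc k) = False" for z by (simp add: regular_upto_Suc mix_simps)
    then show ?thesis using False d m_pos kurt_ge_1 by (simp add: opsi_def)
  qed
  have "expectation (\<lambda>\<omega>. opsi d n (Suc k) (YY \<omega>)) = (\<integral>\<omega>. ?I \<omega> \<partial>M)" by (rule mi)
  also have "\<dots> \<le> (\<integral>\<omega>. opsi d n k (YY \<omega>) * (1 + 96 / m) + (1296 * kurt + 18) * d / m \<partial>M)"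
    using mi(2) o_integrable(3)[of k] pw by (intro integral_mono) auto
  also have "\<dots> = expectation (\<lambda>\<omega>. opsi d n k (YY \<omega>)) * (1 + 96 / m) + (1296 * kurt + 18) * d / m"
    using o_integrable(3)[of k] by (simp add: prob_space)
  finally show ?thesis .
qed

lemma expectation_oind_step:
  "expectation (\<lambda>\<omega>. oind d n k (YY \<omega>)) - 5 * d\<^sup>2 / m \<le> expectation (\<lambda>\<omega>. oind d n (Suc k) (YY \<omega>))"
proof -
  let ?I = "\<lambda>\<omega>. \<integral>\<omega>'. oind d n (Suc k) (mix k (YY \<omega>) (YY \<omega>')) \<partial>M"
  note mi = mix_integral[of "oind d n (Suc k)" 1 k, OF o_meas(3) oind_bound]
  have pw: "oind d n k (YY \<omega>) - 5 * d\<^sup>2 / m \<le> ?I \<omega>" for \<omega>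
  proof (cases "regular_upto d n (YY \<omega>) k")
    case True
    then show ?thesis using inner_oind[OF True] by (simp add: oind_def)
  next
    case False
    have "0 \<le> ?I \<omega>" by (rule integral_nonneg_AE) (simp add: oind_def)
    moreover have "oind d n k (YY \<omega>) - 5 * d\<^sup>2 / m \<le> 0" using False m_pos by (simp add: oind_def)
    ultimately show ?thesis by linarith
  qed
  have "expectation (\<lambda>\<omega>. oind d n k (YY \<omega>)) - 5 * d\<^sup>2 / m = (\<integral>\<omega>. oind d n k (YY \<omega>) - 5 * d\<^sup>2 / m \<partial>M)"
    using o_integrable(2)[of k] by (simp add: prob_space)
  also have "\<dots> \<le> (\<integral>\<omega>. ?I \<omega> \<partial>M)" using mi(2) o_integrable(2)[of k] pw by (intro integral_mono) auto
  also have "\<dots> = expectation (\<lambda>\<omega>. oind d n (Suc k) (YY \<omega>))" by (rule mi(1)[symmetric])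
  finally show ?thesis .
qed

end

section \<open>Iterating the steps\<close>

definition charprod :: "real \<Rightarrow> nat \<Rightarrow> nat \<Rightarrow> real" where
  "charprod t n p = (\<Prod>k<p. 1 - t\<^sup>2 * (sqrt (real n) / (real n - real k))\<^sup>2)"

text \<open>Three recursions along the rows, for the means of \<open>opsi\<close>,
  \<open>oind\<close> and \<open>ochar\<close>. Each step costs a multiple of 1 / (n - k) <= K/n,
  and at most n steps are summed, which is why K appears in every bound.\<close>

lemma (in iid_array) main_bound:
  assumes d: "0 < d" "d \<le> 1/4" and T: "0 < T" and dT: "T + 2 \<le> d * sqrt (real n - real p)"
    and UI: "\<And>x A n. iid_seq D M x \<Longrightarrow> (\<Sum>i<n. \<Sum>j<n. (A i j)\<^sup>2) \<le> 1 \<Longrightarrow> (\<forall>i<n. \<forall>j<n. A i j = A j i) \<Longrightarrow>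
       expectation (\<lambda>\<omega>. (iid_seq.quad x A n \<omega>)\<^sup>2 * indicator {y. T < \<bar>y\<bar>} (iid_seq.quad x A n \<omega>)) \<le> d ^ 4"
    and pn: "p < n" and K: "real n \<le> K * (real n - real p)" and t: "t\<^sup>2 * K\<^sup>2 \<le> real n"
  shows "cmod (expectation (\<lambda>\<omega>. exp (\<i> * of_real (t * log_residual n (YY \<omega>) p))) - of_real (charprod t n p))
     \<le> char_const (sqrt K) t * K * (d + exp (96 * K) * (1 / real n + (1296 * kurt + 18) * K * d)) + 5 * d\<^sup>2 * K"
   "prob {\<omega> \<in> space M. \<not> ((\<forall>k<p. pivot n (YY \<omega>) k \<noteq> 0) \<and> 0 < residual n (YY \<omega>) p)} \<le> 5 * d\<^sup>2 * K"
proof -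
  define b where "b = (1296 * kurt + 18) * K * d"
  have n0: "0 < real n" using pn by simp
  have K0: "0 < K"
  proof -
    have "0 < K * (real n - real p)" using K n0 by linarith
    then show ?thesis using pn by (simp add: zero_less_mult_iff)
  qed
  have b0: "0 \<le> b" using kurt_ge_1 K0 d by (simp add: b_def)
  have step: "array_step D M Y n k d T" if "k < p" for k
  proof (intro array_step.intro array_step_axioms.intro)
    show "iid_array D M Y" by (rule iid_array_axioms)
    show "T + 2 \<le> d * sqrt (real n - real k)"
    proof -
      have "d * sqrt (real n - real p) \<le> d * sqrt (real n - real k)" using d that by (intro mult_left_mono) auto
      then show ?thesis using dT by linarith
    qed
    show "Suc k < n" using that pn by simp
  qed (use d T UI in auto)
  have mK: "real n \<le> K * (real n - real k)" "1 / (real n - real k) \<le> K / real n" if "k < p" for k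
  proof -
    have "K * (real n - real p) \<le> K * (real n - real k)" using K0 that by (intro mult_left_mono) auto
    then show 1: "real n \<le> K * (real n - real k)" using K by linarith
    show "1 / (real n - real k) \<le> K / real n" using 1 n0 that pn by (simp add: field_simps)
  qed
  define P where "P k = expectation (\<lambda>\<omega>. opsi d n k (YY \<omega>))" for k
  define R where "R k = expectation (\<lambda>\<omega>. ochar d n t k (YY \<omega>))" for k
  define Q where "Q k = expectation (\<lambda>\<omega>. oind d n k (YY \<omega>))" for k
  have P0: "0 \<le> P k" if "k < p" for k
    unfolding P_def using array_step.opsi_nonneg[OF step[OF that], of k] by (intro integral_nonneg_AE) auto
  \<comment> \<open>A discrete Gronwall inequality started at 1/n, the quartic norm of the constant
    unit vector. The growth factor stays below exp(96 K), so the quartic norm remains of order 1/n +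
    d on average.\<close>
  have Pk: "k \<le> p \<Longrightarrow> P k \<le> (1 + 96 * K / n) ^ k * (1 / n + k * (b / n))" for k
  proof (induction k)
    case 0
    then show ?case using n0 by (simp add: P_def opsi_def regular_upto_def quartic_norm_0 prob_space)
  next
    case (Suc k)
    then have k: "k < p" by simp
    let ?a = "1 + 96 * K / n"
    have a1: "1 \<le> ?a" using K0 n0 by simp
    have "P (Suc k) \<le> P k * (1 + 96 / (real n - real k)) + (1296 * kurt + 18) * d / (real n - real k)"
      unfolding P_def by (rule array_step.expectation_opsi_step[OF step[OF k]])
    also have "\<dots> \<le> P k * ?a + b / n"
    proof -
      have 1: "1 + 96 / (real n - real k) \<le> ?a" using mult_left_mono[OF mK(2)[OF k], of 96] by simp
      have "(1296 * kurt + 18) * d * (1 / (real n - real k)) \<le> (1296 * kurt + 18) * d * (K / n)"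
        using kurt_ge_1 d by (intro mult_left_mono mK k) auto
      then have 2: "(1296 * kurt + 18) * d / (real n - real k) \<le> b / n" by (simp add: b_def mult_ac)
      show ?thesis by (rule add_mono[OF mult_left_mono[OF 1 P0[OF k]] 2])
    qed
    also have "\<dots> \<le> (?a ^ k * (1 / n + k * (b / n))) * ?a + ?a ^ Suc k * (b / n)"
    proof (intro add_mono mult_right_mono)
      show "P k \<le> ?a ^ k * (1 / n + k * (b / n))" using Suc by simp
      have "1 \<le> ?a ^ Suc k" using a1 by (rule one_le_power)
      then show "b / n \<le> ?a ^ Suc k * (b / n)" using b0 n0 mult_right_mono[of 1 "?a ^ Suc k" "b / n"] by simp
    qed (use a1 in auto)
    also have "\<dots> = ?a ^ Suc k * (1 / n + Suc k * (b / n))"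
    proof -
      have gen: "(A * (u + y * v)) * a + a * A * v = a * A * (u + (1 + y) * v)" for A u y v a :: real by (simp add: algebra_simps)
      show ?thesis unfolding power_Suc of_nat_Suc by (rule gen)
    qed
    finally show ?case .
  qed
  have Pmax: "P k \<le> exp (96 * K) * (1 / n + b)" if k: "k \<le> p" for k
  proof -
    have kn: "real k \<le> real n" using k pn by simp
    have "(1 + 96 * K / n) ^ k \<le> exp (96 * K / n) ^ k" using K0 n0 by (intro power_mono exp_ge_add_one_self) auto
    also have "\<dots> = exp (real k * (96 * K / n))" by (rule exp_of_nat_mult[symmetric])
    also have "real k * (96 * K / n) \<le> real n * (96 * K / n)" using kn K0 n0 by (intro mult_right_mono) auto
    then have "exp (real k * (96 * K / n)) \<le> exp (96 * K)" using n0 by simp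
    finally have 1: "(1 + 96 * K / n) ^ k \<le> exp (96 * K)" .
    have "k * (b / n) \<le> n * (b / n)" using kn b0 n0 by (intro mult_right_mono) auto
    then have 2: "1 / n + k * (b / n) \<le> 1 / n + b" using n0 by simp
    have "P k \<le> (1 + 96 * K / n) ^ k * (1 / n + k * (b / n))" by (rule Pk[OF k])
    also have "\<dots> \<le> exp (96 * K) * (1 / n + b)" using 1 2 b0 n0 by (intro mult_mono) auto
    finally show ?thesis .
  qed
  have Qk: "k \<le> p \<Longrightarrow> 1 - k * (5 * d\<^sup>2 * K / n) \<le> Q k" for k
  proof (induction k)
    case 0 show ?case by (simp add: Q_def oind_def regular_upto_def prob_space)
  next
    case (Suc k)
    then have k: "k < p" by simp
    have "5 * d\<^sup>2 * (1 / (real n - real k)) \<le> 5 * d\<^sup>2 * (K / n)" by (intro mult_left_mono mK k) auto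
    then have "5 * d\<^sup>2 / (real n - real k) \<le> 5 * d\<^sup>2 * K / n" by simp
    moreover have "Q k - 5 * d\<^sup>2 / (real n - real k) \<le> Q (Suc k)"
      unfolding Q_def by (rule array_step.expectation_oind_step[OF step[OF k]])
    moreover have "1 - k * (5 * d\<^sup>2 * K / n) \<le> Q k" using Suc by simp
    moreover have e: "real (Suc k) * g = k * g + g" for g :: real by (simp add: algebra_simps)
    ultimately show ?case unfolding e by linarith
  qed
  have Qp: "1 - 5 * d\<^sup>2 * K \<le> Q p"
  proof -
    have "p * (5 * d\<^sup>2 * K / n) \<le> n * (5 * d\<^sup>2 * K / n)" using pn K0 n0 by (intro mult_right_mono) auto
    then show ?thesis using Qk[of p] n0 by simp
  qed
  let ?c = "\<lambda>k. 1 - t\<^sup>2 * (sqrt (real n) / (real n - real k))\<^sup>2"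
  \<comment> \<open>With factors in [0,1] the errors of earlier steps are not amplified. This is the
    use of t^2 K^2 <= n.\<close>
  have c01: "0 \<le> ?c k \<and> ?c k \<le> 1" if k: "k < p" for k
  proof -
    have "sqrt n / (real n - real k) = sqrt n * (1 / (real n - real k))" by simp
    also have "\<dots> \<le> sqrt n * (K / n)" by (intro mult_left_mono mK k) auto
    finally have "(sqrt n / (real n - real k))\<^sup>2 \<le> (sqrt n * (K / n))\<^sup>2" using k pn by (intro power_mono) auto
    also have "\<dots> = n * (K\<^sup>2 / n\<^sup>2)" by (simp add: power_mult_distrib power_divide)
    also have "\<dots> = K\<^sup>2 / n" using n0 by (simp add: power2_eq_square)
    finally have "t\<^sup>2 * (sqrt n / (real n - real k))\<^sup>2 \<le> t\<^sup>2 * (K\<^sup>2 / n)" by (intro mult_left_mono) auto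
    also have "\<dots> \<le> 1" using t n0 by (simp add: pos_divide_le_eq)
    finally show ?thesis by simp
  qed
  define B where "B = char_const (sqrt K) t * (d + exp (96 * K) * (1 / n + b)) * (K / n)"
  have cc: "0 \<le> char_const (sqrt K) t" unfolding char_const_def using kurt_ge_1 K0
    by (intro add_nonneg_nonneg mult_nonneg_nonneg) auto
  have Rk: "k \<le> p \<Longrightarrow> cmod (R k - of_real (charprod t n k)) \<le> k * B" for k
  proof (induction k)
    case 0
    then show ?case using n0 by (simp add: R_def ochar_def regular_upto_def charprod_def log_residual_0 prob_space)
  next
    case (Suc k)
    then have k: "k < p" by simp
    have "cmod (R (Suc k) - of_real (?c k) * R k) \<le> char_const (sqrt K) t * (d + P k) / (real n - real k)"
      unfolding R_def P_def by (rule array_step.expectation_ochar_step[OF step[OF k] mK(1)[OF k]])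
    also have "\<dots> = char_const (sqrt K) t * (d + P k) * (1 / (real n - real k))" by simp
    also have "\<dots> \<le> B" unfolding B_def
      using Pmax[of k] P0[of k] k cc d K0 n0 pn by (intro mult_mono mK mult_left_mono) auto
    finally have 1: "cmod (R (Suc k) - of_real (?c k) * R k) \<le> B" .
    have "cmod (of_real (?c k) * R k - of_real (?c k) * of_real (charprod t n k)) = \<bar>?c k\<bar> * cmod (R k - of_real (charprod t n k))"
      by (simp only: right_diff_distrib[symmetric] norm_mult norm_of_real)
    also have "\<dots> \<le> 1 * (k * B)" using c01[OF k] Suc by (intro mult_mono) auto
    finally have 2: "cmod (of_real (?c k) * R k - of_real (charprod t n (Suc k))) \<le> k * B"
      by (simp add: charprod_def mult.commute)
    have "R (Suc k) - of_real (charprod t n (Suc k)) = (R (Suc k) - of_real (?c k) * R k) + (of_real (?c k) * R k - of_real (charprod t n (Suc k)))" by simp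
    also have "cmod \<dots> \<le> B + k * B" by (rule norm_triangle_mono[OF 1 2])
    finally show ?case by (simp add: algebra_simps)
  qed
  have [measurable]: "Measurable.pred M (\<lambda>\<omega>. regular_upto d n (YY \<omega>) p)"
    using measurable_YY[OF regular_upto_meas] .
  have [measurable]: "(\<lambda>\<omega>. log_residual n (YY \<omega>) p) \<in> borel_measurable M" using measurable_YY[OF log_residual_meas] .
  have [measurable]: "(\<lambda>\<omega>. pivot n (YY \<omega>) k) \<in> borel_measurable M" "(\<lambda>\<omega>. residual n (YY \<omega>) k) \<in> borel_measurable M" for k
    using measurable_YY[OF pivot_meas] measurable_YY[OF residual_meas] by auto
  have nQ: "1 - Q p = expectation (\<lambda>\<omega>. 1 - oind d n p (YY \<omega>))" "integrable M (\<lambda>\<omega>. 1 - oind d n p (YY \<omega>))"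
  proof -
    have "integrable M (\<lambda>\<omega>. oind d n p (YY \<omega>))"
      by (rule integrable_const_bound[where B=1]) (auto simp: oind_def)
    then show "1 - Q p = expectation (\<lambda>\<omega>. 1 - oind d n p (YY \<omega>))" "integrable M (\<lambda>\<omega>. 1 - oind d n p (YY \<omega>))"
      by (simp_all add: Q_def prob_space)
  qed
  \<comment> \<open>The two integrands agree on the regular event; off it one has modulus 1 and the
    other is 0.\<close>
  have "cmod (expectation (\<lambda>\<omega>. exp (\<i> * of_real (t * log_residual n (YY \<omega>) p))) - R p) \<le> 1 - Q p"
  proof -
    have i: "integrable M (\<lambda>\<omega>. exp (\<i> * of_real (t * log_residual n (YY \<omega>) p)))" "integrable M (\<lambda>\<omega>. ochar d n t p (YY \<omega>))"
      by (rule integrable_const_bound[where B=1]; auto simp: ochar_def)+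
    have "cmod (expectation (\<lambda>\<omega>. exp (\<i> * of_real (t * log_residual n (YY \<omega>) p))) - R p)
      = cmod (expectation (\<lambda>\<omega>. exp (\<i> * of_real (t * log_residual n (YY \<omega>) p)) - ochar d n t p (YY \<omega>)))"
      using i by (simp add: R_def)
    also have "\<dots> \<le> expectation (\<lambda>\<omega>. cmod (exp (\<i> * of_real (t * log_residual n (YY \<omega>) p)) - ochar d n t p (YY \<omega>)))"
      by (rule integral_norm_bound)
    also have "\<dots> = 1 - Q p" unfolding nQ
      by (intro Bochner_Integration.integral_cong refl) (simp add: ochar_def oind_def)
    finally show ?thesis .
  qed
  then have 1: "cmod (expectation (\<lambda>\<omega>. exp (\<i> * of_real (t * log_residual n (YY \<omega>) p))) - R p) \<le> 5 * d\<^sup>2 * K" using Qp by linarith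
  have "real p * B \<le> real n * B"
    using pn cc d K0 n0 b0 by (intro mult_right_mono) (auto simp: B_def)
  also have "\<dots> = char_const (sqrt K) t * K * (d + exp (96 * K) * (1 / n + b))" using n0 by (simp add: B_def)
  finally have 2: "cmod (R p - of_real (charprod t n p)) \<le> char_const (sqrt K) t * K * (d + exp (96 * K) * (1 / n + b))"
    using Rk[of p] by linarith
  have "x - z = (x - y) + (y - z)" for x y z :: complex by simp
  then have "cmod (expectation (\<lambda>\<omega>. exp (\<i> * of_real (t * log_residual n (YY \<omega>) p))) - of_real (charprod t n p)) \<le> 5 * d\<^sup>2 * K + char_const (sqrt K) t * K * (d + exp (96 * K) * (1 / n + b))"
    using norm_triangle_mono[OF 1 2] by metis
  then show "cmod (expectation (\<lambda>\<omega>. exp (\<i> * of_real (t * log_residual n (YY \<omega>) p))) - of_real (charprod t n p))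
     \<le> char_const (sqrt K) t * K * (d + exp (96 * K) * (1 / real n + (1296 * kurt + 18) * K * d)) + 5 * d\<^sup>2 * K"
    by (simp add: b_def add.commute)
  have of: "0 < residual n y p \<and> (\<forall>k<p. pivot n y k \<noteq> 0)" if "regular_upto d n y p" for y
  proof -
    have "2 \<le> d * sqrt (real n - real j)" if "j < p" for j
      using array_step.dm[OF step[OF that] order_refl] .
    then show ?thesis using regular_upto_facts[OF d _ _ _ that] pn by auto
  qed
  let ?E = "{\<omega> \<in> space M. \<not> ((\<forall>k<p. pivot n (YY \<omega>) k \<noteq> 0) \<and> 0 < residual n (YY \<omega>) p)}"
  have E: "?E \<in> events" by measurable
  have "prob ?E = expectation (indicator ?E)" using E by simp
  also have "\<dots> \<le> expectation (\<lambda>\<omega>. 1 - oind d n p (YY \<omega>))"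
  proof (rule integral_mono[OF _ nQ(2)])
    show "integrable M (indicator ?E :: 'a \<Rightarrow> real)" by (rule integrable_const_bound[where B=1]) (use E in \<open>auto simp: indicator_def\<close>)
    show "indicator ?E \<omega> \<le> 1 - oind d n p (YY \<omega>)" for \<omega>
      using of[of "YY \<omega>"] by (cases "regular_upto d n (YY \<omega>) p") (auto simp: oind_def indicator_def)
  qed
  also have "\<dots> = 1 - Q p" using nQ(1) by simp
  finally show "prob ?E \<le> 5 * d\<^sup>2 * K" using Qp by linarith
qed

section \<open>Limit of the product of one-step factors\<close>

lemma sum_inverse_squares:
  assumes "p < n"
  shows "1 / (real n - real p + 1) - 1 / (real n + 1) \<le> (\<Sum>k<p. 1 / (real n - real k)\<^sup>2)"
    "(\<Sum>k<p. 1 / (real n - real k)\<^sup>2) \<le> 1 / (real n - real p) - 1 / real n"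
proof -
  have "(1 / (real n - real p + 1) - 1 / (real n + 1) \<le> (\<Sum>k<p. 1 / (real n - real k)\<^sup>2)) \<and>
    (\<Sum>k<p. 1 / (real n - real k)\<^sup>2) \<le> 1 / (real n - real p) - 1 / real n"
    using assms
  proof (induction p)
    case (Suc p)
    define m where "m = real n - real p"
    have m: "1 < m" using Suc by (simp add: m_def)
    have e: "real n - real (Suc p) + 1 = m" "real n - real (Suc p) = m - 1" "real n - real p + 1 = m + 1" by (simp_all add: m_def)
    \<comment> \<open>Telescoping: 1/m^2 lies between the differences of reciprocals at m, m + 1 and
      at m - 1, m.\<close>
    have "1 / m - 1 / (m + 1) = 1 / (m * (m + 1))" "1 / (m - 1) - 1 / m = 1 / (m * (m - 1))" using m by (simp_all add: field_simps)
    moreover have "1 / (m * (m + 1)) \<le> 1 / m\<^sup>2" "1 / m\<^sup>2 \<le> 1 / (m * (m - 1))"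
      using m by (auto simp: power2_eq_square intro!: divide_left_mono mult_left_mono mult_pos_pos)
    ultimately show ?case using Suc unfolding e by (simp add: m_def[symmetric])
  qed simp
  then show "1 / (real n - real p + 1) - 1 / (real n + 1) \<le> (\<Sum>k<p. 1 / (real n - real k)\<^sup>2)"
    "(\<Sum>k<p. 1 / (real n - real k)\<^sup>2) \<le> 1 / (real n - real p) - 1 / real n" by auto
qed

lemma exp_minus_bounds: "0 \<le> a \<Longrightarrow> \<bar>(1 - a) - exp (- a)\<bar> \<le> a\<^sup>2" for a :: real
proof -
  assume a: "0 \<le> a"
  have 1: "1 - a \<le> exp (- a)" using exp_ge_add_one_self[of "- a"] by simp
  have "exp (- a) \<le> 1 / (1 + a)" using exp_ge_add_one_self[of a] a by (simp add: exp_minus divide_inverse le_imp_inverse_le)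
  also have "\<dots> \<le> 1 - a + a\<^sup>2" 
  proof -
    have "(1 - a + a\<^sup>2) * (1 + a) = 1 + a ^ 3" by (simp add: power2_eq_square power3_eq_cube algebra_simps)
    then show ?thesis using a by (simp add: pos_divide_le_eq)
  qed
  finally show ?thesis using 1 by simp
qed

context
  fixes p :: "nat \<Rightarrow> nat" and c :: real
  assumes p_le: "\<And>n. p n \<le> n" and c_lim: "(\<lambda>n. real (p n) / real n) \<longlonglongrightarrow> c" and c: "0 < c" "c < 1"
begin

text \<open>Eventually p/n < (1 + c)/2, leaving at least the fraction (1 - c)/2 of the dimensions.
  This is the source of K = 2/(1 - c).\<close>

lemma eventually_ratio: "\<forall>\<^sub>F n in sequentially. p n < n \<and> real n \<le> 2 / (1 - c) * (real n - real (p n))"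
proof -
  have "\<forall>\<^sub>F n in sequentially. real (p n) / real n < (1 + c) / 2" using order_tendstoD(2)[OF c_lim, of "(1 + c) / 2"] c by simp
  then show ?thesis using eventually_gt_at_top[of 0]
  proof eventually_elim
    case (elim n)
    have "real (p n) < (1 + c) / 2 * real n" using elim by (simp add: pos_divide_less_eq)
    then have 1: "(1 - c) / 2 * real n \<le> real n - real (p n)" by (simp add: field_simps)
    then have "2 / (1 - c) * ((1 - c) / 2 * real n) \<le> 2 / (1 - c) * (real n - real (p n))" using c by (intro mult_left_mono) auto
    moreover have "0 < (1 - c) / 2 * real n" using c elim by simp
    ultimately show ?case using 1 c by auto
  qed
qed

lemma sum_lim: "(\<lambda>n. \<Sum>k<p n. (sqrt (real n) / (real n - real k))\<^sup>2) \<longlonglongrightarrow> c / (1 - c)"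
proof -
  have e: "(\<Sum>k<p n. (sqrt (real n) / (real n - real k))\<^sup>2) = real n * (\<Sum>k<p n. 1 / (real n - real k)\<^sup>2)" for n
    by (simp add: power_divide sum_distrib_left)
  have i0: "(\<lambda>n. 1 / real n) \<longlonglongrightarrow> 0" by (rule lim_1_over_n)
  have "(\<lambda>n. 1 / (1 - real (p n) / real n) - 1) \<longlonglongrightarrow> 1 / (1 - c) - 1"
    using c by (intro tendsto_intros c_lim) auto
  moreover have "1 / (1 - c) - 1 = c / (1 - c)" using c by (simp add: field_simps)
  ultimately have U: "(\<lambda>n. 1 / (1 - real (p n) / real n) - 1) \<longlonglongrightarrow> c / (1 - c)" by simp
  have "(\<lambda>n. 1 / (1 - real (p n) / real n + 1 / real n) - 1 / (1 + 1 / real n)) \<longlonglongrightarrow> 1 / (1 - c + 0) - 1 / (1 + 0)"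
    using c by (intro tendsto_intros c_lim i0) auto
  moreover have "1 / (1 - c + 0) - 1 / (1 + 0) = c / (1 - c)" using c by (simp add: field_simps)
  ultimately have L: "(\<lambda>n. 1 / (1 - real (p n) / real n + 1 / real n) - 1 / (1 + 1 / real n)) \<longlonglongrightarrow> c / (1 - c)" by simp
  show ?thesis unfolding e
  proof (rule tendsto_sandwich[OF _ _ L U])
    show "\<forall>\<^sub>F n in sequentially. 1 / (1 - real (p n) / real n + 1 / real n) - 1 / (1 + 1 / real n) \<le> real n * (\<Sum>k<p n. 1 / (real n - real k)\<^sup>2)"
      using eventually_ratio
    proof eventually_elim
      case (elim n)
      then have n: "0 < real n" by simp
      have "1 / (1 - real (p n) / real n + 1 / real n) = real n * (1 / (real n - real (p n) + 1))"
        "1 / (1 + 1 / real n) = real n * (1 / (real n + 1))" using n elim by (simp_all add: field_simps)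
      then show ?case using mult_left_mono[OF sum_inverse_squares(1)[of "p n" n], of "real n"] elim n
        by (simp only: right_diff_distrib[symmetric])
    qed
    show "\<forall>\<^sub>F n in sequentially. real n * (\<Sum>k<p n. 1 / (real n - real k)\<^sup>2) \<le> 1 / (1 - real (p n) / real n) - 1"
      using eventually_ratio
    proof eventually_elim
      case (elim n)
      then have n: "0 < real n" by simp
      have "1 / (1 - real (p n) / real n) - 1 = real n * (1 / (real n - real (p n)) - 1 / real n)"
        using n elim by (simp add: field_simps)
      then show ?case using mult_left_mono[OF sum_inverse_squares(2)[of "p n" n], of "real n"] elim n
        by (simp only:)
    qed
  qed
qed

lemma charprod_lim: "(\<lambda>n. charprod t n (p n)) \<longlonglongrightarrow> exp (- (t\<^sup>2 * (c / (1 - c))))"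
proof -
  define K where "K = 2 / (1 - c)"
  have K: "0 < K" using c by (simp add: K_def)
  let ?a = "\<lambda>n k. t\<^sup>2 * (sqrt (real n) / (real n - real k))\<^sup>2"
  let ?E = "\<lambda>n. exp (- (t\<^sup>2 * (\<Sum>k<p n. (sqrt (real n) / (real n - real k))\<^sup>2)))"
  have E: "?E \<longlonglongrightarrow> exp (- (t\<^sup>2 * (c / (1 - c))))" by (intro tendsto_intros sum_lim)
  have "(\<lambda>n. charprod t n (p n) - ?E n) \<longlonglongrightarrow> 0"
  proof (rule Lim_null_comparison)
    have "(\<lambda>n. (t\<^sup>2 * K\<^sup>2)\<^sup>2 * (1 / real n)) \<longlonglongrightarrow> (t\<^sup>2 * K\<^sup>2)\<^sup>2 * 0" by (intro tendsto_intros lim_1_over_n)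
    then show "(\<lambda>n. (t\<^sup>2 * K\<^sup>2)\<^sup>2 * (1 / real n)) \<longlonglongrightarrow> 0" by simp
    obtain N where N: "t\<^sup>2 * K\<^sup>2 \<le> real N" using real_arch_simple by blast
    show "\<forall>\<^sub>F n in sequentially. norm (charprod t n (p n) - ?E n) \<le> (t\<^sup>2 * K\<^sup>2)\<^sup>2 * (1 / real n)"
      using eventually_ratio eventually_ge_at_top[of N]
    proof eventually_elim
      case (elim n)
      have n: "0 < real n" and tn: "t\<^sup>2 * K\<^sup>2 \<le> real n" using elim N by auto
      have a: "0 \<le> ?a n k \<and> ?a n k \<le> t\<^sup>2 * K\<^sup>2 / n" if k: "k < p n" for k
      proof -
        have "K * (real n - real (p n)) \<le> K * (real n - real k)" using K k by (intro mult_left_mono) auto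
        then have "real n \<le> K * (real n - real k)" using elim by (simp add: K_def)
        then have "1 / (real n - real k) \<le> K / n" using n k elim by (simp add: field_simps)
        then have "sqrt n * (1 / (real n - real k)) \<le> sqrt n * (K / n)" by (intro mult_left_mono) auto
        then have "(sqrt n / (real n - real k))\<^sup>2 \<le> (sqrt n * (K / n))\<^sup>2" using k elim by (intro power_mono) auto
        also have "\<dots> = n * (K\<^sup>2 / n\<^sup>2)" by (simp add: power_mult_distrib power_divide)
        also have "\<dots> = K\<^sup>2 / n" using n by (simp add: power2_eq_square)
        finally have "t\<^sup>2 * (sqrt n / (real n - real k))\<^sup>2 \<le> t\<^sup>2 * (K\<^sup>2 / n)" by (intro mult_left_mono) auto
        then show ?thesis by simp
      qed
      have a1: "t\<^sup>2 * K\<^sup>2 / n \<le> 1" using tn n by (simp add: pos_divide_le_eq)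
      have "?E n = (\<Prod>k<p n. exp (- ?a n k))" by (simp add: exp_sum[symmetric] sum_negf sum_distrib_left)
      then have "norm (charprod t n (p n) - ?E n) = norm ((\<Prod>k<p n. 1 - ?a n k) - (\<Prod>k<p n. exp (- ?a n k)))" by (simp add: charprod_def)
      \<comment> \<open>Products of numbers of modulus at most 1 differ by at most the sum of the
        differences of their factors. Each difference is O(1/n^2), and there are at most n of
        them.\<close>
      also have "\<dots> \<le> (\<Sum>k<p n. norm ((1 - ?a n k) - exp (- ?a n k)))"
      proof (rule norm_prod_diff)
        fix k assume "k \<in> {..<p n}"
        then have a01: "0 \<le> ?a n k" "?a n k \<le> 1" using a[of k] a1 by auto
        then show "norm (1 - ?a n k) \<le> 1" unfolding real_norm_def abs_le_iff by linarith
        show "norm (exp (- ?a n k)) \<le> 1" using a01(1) by simp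
      qed
      also have "\<dots> \<le> (\<Sum>k<p n. (t\<^sup>2 * K\<^sup>2 / n)\<^sup>2)"
      proof (rule sum_mono)
        fix k assume "k \<in> {..<p n}"
        then have k: "0 \<le> ?a n k" "?a n k \<le> t\<^sup>2 * K\<^sup>2 / n" using a[of k] by auto
        have "norm ((1 - ?a n k) - exp (- ?a n k)) \<le> (?a n k)\<^sup>2" using exp_minus_bounds[OF k(1)] by simp
        also have "\<dots> \<le> (t\<^sup>2 * K\<^sup>2 / n)\<^sup>2" using k by (intro power_mono) auto
        finally show "norm ((1 - ?a n k) - exp (- ?a n k)) \<le> (t\<^sup>2 * K\<^sup>2 / n)\<^sup>2" .
      qed
      also have "\<dots> = real (p n) * (t\<^sup>2 * K\<^sup>2 / n)\<^sup>2" by simp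
      also have "\<dots> \<le> real n * (t\<^sup>2 * K\<^sup>2 / n)\<^sup>2" using elim by (intro mult_right_mono) auto
      also have "\<dots> = (t\<^sup>2 * K\<^sup>2)\<^sup>2 * (1 / real n)" using n by (simp add: power_divide power2_eq_square)
      finally show ?case .
    qed
  qed
  from tendsto_add[OF this E] show ?thesis by simp
qed

section \<open>Passage to the limit\<close>

context
  fixes D and M :: "'a measure" and Y :: "nat \<Rightarrow> nat \<Rightarrow> nat \<Rightarrow> 'a \<Rightarrow> real"
  assumes arr: "\<And>n. iid_array D M (Y n)"
begin

text \<open>C and C' are fixed before d, while the threshold T and the size that n must reach depend
  on d. This order of quantifiers allows n to tend to infinity first and d to 0 afterwards.\<close>

lemma clt_bounds:
  "\<exists>C>0. \<exists>C'. \<forall>d. 0 < d \<longrightarrow> d \<le> 1/4 \<longrightarrow> (\<forall>\<^sub>F n in sequentially.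
     cmod ((\<integral>\<omega>. exp (\<i> * of_real (t * log_residual n (\<lambda>i j. Y n i j \<omega>) (p n))) \<partial>M) - of_real (charprod t n (p n))) \<le> C * d + C' * (1 / real n) \<and>
     measure M {\<omega> \<in> space M. \<not> ((\<forall>k<p n. pivot n (\<lambda>i j. Y n i j \<omega>) k \<noteq> 0) \<and> 0 < residual n (\<lambda>i j. Y n i j \<omega>) (p n))} \<le> C * d)"
proof -
  interpret A0: iid_array D M "Y 0" by (rule arr)
  define K where "K = 2 / (1 - c)"
  have K: "0 < K" using c by (simp add: K_def)
  define G where "G = A0.char_const (sqrt K) t * K"
  define C where "C = G * (1 + exp (96 * K) * ((1296 * A0.kurt + 18) * K)) + 5 * K"
  define C' where "C' = G * exp (96 * K)"
  have cc: "0 \<le> A0.char_const (sqrt K) t" unfolding A0.char_const_def using A0.kurt_ge_1 K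
    by (intro add_nonneg_nonneg mult_nonneg_nonneg) auto
  have G: "0 \<le> G" using cc K by (simp add: G_def)
  have C5: "5 * K \<le> C" using G A0.kurt_ge_1 K by (simp add: C_def)
  have C0: "0 < C" using C5 K by linarith
  show ?thesis
  proof (rule exI[of _ C], rule conjI[OF C0], rule exI[of _ C'], intro allI impI)
    fix d :: real assume d: "0 < d" "d \<le> 1/4"
    have "0 < d ^ 4" using d by simp
    from A0.quad_uniformly_integrable[OF this, where ?'a='a] obtain T where T: "0 < T"
      and UI: "\<forall>(M::'a measure) x A n. iid_seq D M x \<longrightarrow> (\<Sum>i<n. \<Sum>j<n. (A i j)\<^sup>2) \<le> 1 \<longrightarrow>
        (\<forall>i<n. \<forall>j<n. A i j = A j i) \<longrightarrow>
        (\<integral>\<omega>. (iid_seq.quad x A n \<omega>)\<^sup>2 * indicator {y. T < \<bar>y\<bar>} (iid_seq.quad x A n \<omega>) \<partial>M) \<le> d ^ 4" by blast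
    \<comment> \<open>Beyond N both hypotheses of \<open>main_bound\<close> hold: t^2 K^2 <= n and,
      since n <= K (n - p), T + 2 <= d sqrt(n - p).\<close>
    obtain N where N: "max (t\<^sup>2 * K\<^sup>2) (((T + 2) / d)\<^sup>2 * K) \<le> real N" using real_arch_simple by blast
    show "\<forall>\<^sub>F n in sequentially.
       cmod ((\<integral>\<omega>. exp (\<i> * of_real (t * log_residual n (\<lambda>i j. Y n i j \<omega>) (p n))) \<partial>M) - of_real (charprod t n (p n))) \<le> C * d + C' * (1 / real n) \<and>
       measure M {\<omega> \<in> space M. \<not> ((\<forall>k<p n. pivot n (\<lambda>i j. Y n i j \<omega>) k \<noteq> 0) \<and> 0 < residual n (\<lambda>i j. Y n i j \<omega>) (p n))} \<le> C * d"
      using eventually_ratio eventually_ge_at_top[of N]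
    proof eventually_elim
      case (elim n)
      interpret iid_array D M "Y n" by (rule arr)
      have Kn: "real n \<le> K * (real n - real (p n))" and pn: "p n < n" using elim by (auto simp: K_def)
      have t: "t\<^sup>2 * K\<^sup>2 \<le> real n" and tt: "((T + 2) / d)\<^sup>2 * K \<le> real n" using elim N by auto
      have "((T + 2) / d)\<^sup>2 * K \<le> (real n - real (p n)) * K" using tt Kn by (simp add: mult.commute)
      then have "((T + 2) / d)\<^sup>2 \<le> real n - real (p n)" using K by simp
      then have "(T + 2) / d \<le> sqrt (real n - real (p n))" by (rule real_le_rsqrt)
      then have dT: "T + 2 \<le> d * sqrt (real n - real (p n))" using d by (simp add: pos_divide_le_eq mult.commute)
      note mb = main_bound[OF d T dT UI[rule_format] pn Kn t]
      have d2: "5 * d\<^sup>2 * K \<le> 5 * K * d"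
      proof -
        have "d\<^sup>2 \<le> d" using d by (simp add: power2_eq_square mult_le_cancel_left1)
        then have "5 * K * d\<^sup>2 \<le> 5 * K * d" using K by (intro mult_left_mono) auto
        then show ?thesis by (simp add: mult_ac)
      qed
      have "A0.char_const (sqrt K) t * K * (d + exp (96 * K) * (1 / real n + (1296 * A0.kurt + 18) * K * d)) + 5 * d\<^sup>2 * K \<le> C * d + C' * (1 / real n)"
      proof -
        have gen: "g * (d + E * (N + B * K * d)) + 5 * K * d = (g * (1 + E * (B * K)) + 5 * K) * d + (g * E) * N" for g E B N
          by (simp add: algebra_simps)
        show ?thesis unfolding C_def C'_def G_def gen[symmetric] by (rule add_left_mono[OF d2])
      qed
      moreover have "5 * d\<^sup>2 * K \<le> C * d" using d2 mult_right_mono[OF C5, of d] d by linarith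
      ultimately show ?case using mb by (meson order_trans)
    qed
  qed
qed

lemma char_log_residual_lim: "(\<lambda>n. \<integral>\<omega>. exp (\<i> * of_real (t * log_residual n (\<lambda>i j. Y n i j \<omega>) (p n))) \<partial>M) \<longlonglongrightarrow> of_real (exp (- (t\<^sup>2 * (c / (1 - c)))))"
proof -
  let ?f = "\<lambda>n. (\<integral>\<omega>. exp (\<i> * of_real (t * log_residual n (\<lambda>i j. Y n i j \<omega>) (p n))) \<partial>M)"
  from clt_bounds[of t] obtain C C' where C: "0 < C" and H: "\<forall>d. 0 < d \<longrightarrow> d \<le> 1/4 \<longrightarrow> (\<forall>\<^sub>F n in sequentially.
     cmod (?f n - of_real (charprod t n (p n))) \<le> C * d + C' * (1 / real n) \<and>
     measure M {\<omega> \<in> space M. \<not> ((\<forall>k<p n. pivot n (\<lambda>i j. Y n i j \<omega>) k \<noteq> 0) \<and> 0 < residual n (\<lambda>i j. Y n i j \<omega>) (p n))} \<le> C * d)"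
    by blast
  have B: "\<forall>\<^sub>F n in sequentially. cmod (?f n - of_real (charprod t n (p n))) \<le> C * d + C' * (1 / real n)" if "0 < d" "d \<le> 1/4" for d
    using H[rule_format, OF that] by (rule eventually_mono) (rule conjunct1)
  have "(\<lambda>n. ?f n - of_real (charprod t n (p n))) \<longlonglongrightarrow> 0"
  proof (rule tendstoI)
    fix e :: real assume e: "0 < e"
    define d where "d = min (1/4) (e / (4 * C))"
    have d: "0 < d" "d \<le> 1/4" using e C by (auto simp: d_def)
    have "C * d \<le> C * (e / (4 * C))" using C by (intro mult_left_mono) (auto simp: d_def)
    then have Cd: "C * d \<le> e / 4" using C by simp
    have "(\<lambda>n. C' * (1 / real n)) \<longlonglongrightarrow> C' * 0" by (intro tendsto_intros lim_1_over_n)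
    then have "\<forall>\<^sub>F n in sequentially. C' * (1 / real n) < e / 4" using e by (intro order_tendstoD(2)) auto
    with B[OF d] show "\<forall>\<^sub>F n in sequentially. dist (?f n - of_real (charprod t n (p n))) 0 < e"
    proof eventually_elim
      case (elim n)
      then have "cmod (?f n - of_real (charprod t n (p n))) < e" using Cd e by linarith
      then show ?case by (simp only: dist_norm diff_zero)
    qed
  qed
  from tendsto_add[OF this tendsto_of_real[OF charprod_lim[of t]]] show ?thesis by (simp only: diff_add_cancel add_0_left)
qed

lemma degenerate_lim: "(\<lambda>n. measure M {\<omega> \<in> space M. \<not> ((\<forall>k<p n. pivot n (\<lambda>i j. Y n i j \<omega>) k \<noteq> 0) \<and> 0 < residual n (\<lambda>i j. Y n i j \<omega>) (p n))}) \<longlonglongrightarrow> 0"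
  (is "?f \<longlonglongrightarrow> 0")
proof -
  \<comment> \<open>The event in the second conjunct does not involve t, so any value may be
    taken.\<close>
  from clt_bounds[of 0] obtain C C' where C: "0 < C" and H: "\<forall>d. 0 < d \<longrightarrow> d \<le> 1/4 \<longrightarrow> (\<forall>\<^sub>F n in sequentially.
     cmod ((\<integral>\<omega>. exp (\<i> * of_real (0 * log_residual n (\<lambda>i j. Y n i j \<omega>) (p n))) \<partial>M) - of_real (charprod 0 n (p n))) \<le> C * d + C' * (1 / real n) \<and> ?f n \<le> C * d)"
    by blast
  have B: "\<forall>\<^sub>F n in sequentially. ?f n \<le> C * d" if "0 < d" "d \<le> 1/4" for d
    using H[rule_format, OF that] by (auto elim!: eventually_mono)
  show ?thesis
  proof (rule tendstoI)
    fix e :: real assume e: "0 < e"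
    define d where "d = min (1/4) (e / (4 * C))"
    have d: "0 < d" "d \<le> 1/4" using e C by (auto simp: d_def)
    have "C * d \<le> C * (e / (4 * C))" using C by (intro mult_left_mono) (auto simp: d_def)
    then have Cd: "C * d \<le> e / 4" using C by simp
    from B[OF d] show "\<forall>\<^sub>F n in sequentially. dist (?f n) 0 < e"
    proof eventually_elim
      case (elim n)
      then have "?f n < e" using Cd e by linarith
      then show ?case by (simp add: measure_nonneg)
    qed
  qed
qed

end

end

section \<open>The central limit theorem\<close>

lemma hotelling_eq:
  assumes n: "0 < n" and \<sigma>: "\<sigma> \<noteq> 0" and X: "\<And>i j. X i j = \<mu> + \<sigma> * x i j"
  shows "hotelling_T2 p n X (\<lambda>_. \<mu>) / real n = (if (\<forall>k<p. pivot n x k \<noteq> 0) \<and> residual n x p \<noteq> 0 then 1 / residual n x p - 1 else 0)"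
  using n inv_quad_form_eq[OF n \<sigma>, of p X \<mu> x] X by (simp add: hotelling_T2_def)

lemma std_normal_char: "(\<integral>x. exp (\<i> * of_real (t * x)) \<partial>std_normal_distribution) = of_real (exp (- t\<^sup>2 / 2))"
  using fun_cong[OF char_std_normal_distribution, of t] by (simp add: char_def)

theorem theorem1p1:
  fixes M :: "'a measure"
    and X :: "nat \<Rightarrow> nat \<Rightarrow> nat \<Rightarrow> 'a \<Rightarrow> real"
    and p :: "nat \<Rightarrow> nat"
    and \<mu> c :: real
  assumes "prob_space M"
    and rv: "\<And>n i j. X n i j \<in> borel_measurable M"
    and indep: "\<And>n. prob_space.indep_vars M (\<lambda>_. borel) (\<lambda>(i, j). X n i j) UNIV"
    and ident: "\<And>n i j. distr M borel (X n i j) = distr M borel (X 0 0 0)"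
    and mean: "prob_space.expectation M (X 0 0 0) = \<mu>"
    and second: "prob_space.expectation M (\<lambda>\<omega>. (X 0 0 0 \<omega>)^2) = 1"
    and fourth: "integrable M (\<lambda>\<omega>. (X 0 0 0 \<omega>)^4)"
    and nondeg: "\<mu>^2 < 1"
    and p_le: "\<And>n. p n \<le> n"
    and c_lim: "(\<lambda>n. real (p n) / real n) \<longlonglongrightarrow> c"
    and "0 < c" and "c < 1"
  shows "weak_conv_m
     (\<lambda>n. distr M borel (\<lambda>\<omega>.
        let cn = real (p n) / real n;
            T2 = hotelling_T2 (p n) n (\<lambda>i j. X n i j \<omega>) (\<lambda>_. \<mu>)
        in sqrt (real n) / sqrt (2 * cn * integral\<^sup>L (marchenko_pastur cn) (\<lambda>x. 1 / x^2))
           * (T2 / real n - cn * integral\<^sup>L (marchenko_pastur cn) (\<lambda>x. 1 / x))))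
     std_normal_distribution"
proof -
  interpret prob_space M by fact
  note [measurable] = rv
  have c: "0 < c" "c < 1" by fact+
  \<comment> \<open>The second moment is 1, so 1 - \<mu>^2 is the variance of an entry; its
    positivity allows standardisation.\<close>
  define \<sigma> where "\<sigma> = sqrt (1 - \<mu>\<^sup>2)"
  have \<sigma>: "0 < \<sigma>" "\<sigma>\<^sup>2 = 1 - \<mu>\<^sup>2" using nondeg by (auto simp: \<sigma>_def)
  define Y where "Y n i j \<omega> = (X n i j \<omega> - \<mu>) / \<sigma>" for n i j \<omega>
  have [measurable]: "Y n i j \<in> borel_measurable M" for n i j unfolding Y_def[abs_def] by measurable
  have XY: "X n i j \<omega> = \<mu> + \<sigma> * Y n i j \<omega>" for n i j \<omega> using \<sigma> by (simp add: Y_def)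
  define D where "D = distr M borel (Y 0 0 0)"
  have Yd: "distr M borel (Y n i j) = D" for n i j
  proof -
    have "distr M borel (Y n i j) = distr (distr M borel (X n i j)) borel (\<lambda>x. (x - \<mu>) / \<sigma>)" for n i j
      by (subst distr_distr) (auto simp: comp_def Y_def[abs_def])
    then show ?thesis using ident[of n i j] by (simp add: D_def)
  qed
  have X4: "integrable M (\<lambda>\<omega>. (X 0 0 0 \<omega>)^4)" by (rule fourth)
  have X2: "integrable M (\<lambda>\<omega>. (X 0 0 0 \<omega>)\<^sup>2)" by (rule integrable_power2_of_power4[OF rv X4])
  have X1: "integrable M (X 0 0 0)" by (rule integrable_of_power2[OF rv X2])
  have sd: "std_law D"
  proof (rule std_law.intro)
    show "prob_space D" unfolding D_def by (rule prob_space_distr) simp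
    show "sets D = sets borel" by (simp add: D_def)
    have "integrable M (\<lambda>\<omega>. (X 0 0 0 \<omega> + (- \<mu>)) ^ 4)" using X4 by (intro integrable_power4_add) auto
    then have "integrable M (\<lambda>\<omega>. Y 0 0 0 \<omega> ^ 4)" by (simp add: Y_def power_divide)
    then show "integrable D (\<lambda>x. x ^ 4)" by (simp add: D_def integrable_distr_eq)
    have "(\<integral>x. x \<partial>D) = expectation (\<lambda>\<omega>. (X 0 0 0 \<omega> - \<mu>) / \<sigma>)" by (simp add: D_def integral_distr Y_def)
    also have "\<dots> = 0" using X1 mean by (simp add: prob_space)
    finally show "(\<integral>x. x \<partial>D) = 0" .
    have "(\<integral>x. x\<^sup>2 \<partial>D) = expectation (\<lambda>\<omega>. ((X 0 0 0 \<omega>)\<^sup>2 - 2 * \<mu> * X 0 0 0 \<omega> + \<mu>\<^sup>2) / \<sigma>\<^sup>2)"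
      by (simp add: D_def integral_distr Y_def power_divide) (simp add: power2_diff algebra_simps)
    also have "\<dots> = (1 - 2 * \<mu> * \<mu> + \<mu>\<^sup>2) / \<sigma>\<^sup>2" using X1 X2 mean second by (simp add: prob_space)
    also have "\<dots> = 1" using \<sigma> nondeg by (simp add: power2_eq_square)
    finally show "(\<integral>x. x\<^sup>2 \<partial>D) = 1" .
  qed
  have arr: "iid_array D M (Y n)" for n
  proof (intro iid_array.intro sd prob_space_axioms iid_array_axioms.intro)
    have "indep_vars (\<lambda>_. borel) (\<lambda>k \<omega>. ((case k of (i, j) \<Rightarrow> X n i j) \<omega> - \<mu>) / \<sigma>) UNIV"
      by (rule indep_vars_compose2[OF indep]) auto
    moreover have "(\<lambda>k \<omega>. ((case k of (i, j) \<Rightarrow> X n i j) \<omega> - \<mu>) / \<sigma>) = (\<lambda>(i, j). Y n i j)"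
      by (auto simp: fun_eq_iff Y_def)
    ultimately show "indep_vars (\<lambda>_. borel) (\<lambda>(i, j). Y n i j) UNIV" by simp
  qed (rule Yd)
  define y where "y n \<omega> = (\<lambda>i j. Y n i j \<omega>)" for n \<omega>
  have measY: "(\<lambda>\<omega>. F (y n \<omega>)) \<in> measurable M N" if "(\<lambda>g. F (arr g)) \<in> measurable array_space N" for F n N
    unfolding y_def by (rule iid_array.measurable_YY[OF arr that])
  have [measurable]: "(\<lambda>\<omega>. log_residual n (y n \<omega>) k) \<in> borel_measurable M" "(\<lambda>\<omega>. pivot n (y n \<omega>) k) \<in> borel_measurable M"
    "(\<lambda>\<omega>. residual n (y n \<omega>) k) \<in> borel_measurable M" for n k
    by (intro measY log_residual_meas pivot_meas residual_meas)+
  define V where "V n \<omega> = log_residual n (y n \<omega>) (p n)" for n \<omega>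
  have [measurable]: "V n \<in> borel_measurable M" for n unfolding V_def[abs_def] by measurable
  define W where "W n \<omega> = (let cn = real (p n) / real n;
            T2 = hotelling_T2 (p n) n (\<lambda>i j. X n i j \<omega>) (\<lambda>_. \<mu>)
        in sqrt (real n) / sqrt (2 * cn * integral\<^sup>L (marchenko_pastur cn) (\<lambda>x. 1 / x^2))
           * (T2 / real n - cn * integral\<^sup>L (marchenko_pastur cn) (\<lambda>x. 1 / x)))" for n \<omega>
  define nd where "nd n \<omega> \<longleftrightarrow> (\<forall>k<p n. pivot n (y n \<omega>) k \<noteq> 0) \<and> residual n (y n \<omega>) (p n) \<noteq> 0" for n \<omega>
  have [measurable]: "Measurable.pred M (nd n)" for n unfolding nd_def[abs_def] by measurable
  have T2: "hotelling_T2 (p n) n (\<lambda>i j. X n i j \<omega>) (\<lambda>_. \<mu>) / real n = (if nd n \<omega> then 1 / residual n (y n \<omega>) (p n) - 1 else 0)" if "0 < n" for n \<omega>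
    unfolding nd_def using that \<sigma> by (intro hotelling_eq[of n \<sigma>]) (auto simp: XY y_def)
  have W_meas [measurable]: "W n \<in> borel_measurable M" for n
  proof (cases "n = 0")
    case True
    \<comment> \<open>At n = 0 the prefactor sqrt 0 annihilates the expression.\<close>
    then have "W n = (\<lambda>_. 0)" by (auto simp: W_def fun_eq_iff)
    then show ?thesis by simp
  next
    case False
    then show ?thesis unfolding W_def[abs_def] Let_def by (simp only: T2 neq0_conv) measurable
  qed
  \<comment> \<open>The limiting standard deviation of \<open>log_residual\<close>: exp(-t^2 c / (1
    - c)) is the characteristic function of a centred normal law of variance 2 c / (1 - c).\<close>
  define s where "s = sqrt (2 * (c / (1 - c)))"
  have s: "0 < s" "s\<^sup>2 = 2 * (c / (1 - c))" using c by (auto simp: s_def)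
  define N' where "N' = distr std_normal_distribution borel (\<lambda>x. s * x)"
  interpret SN: real_distribution std_normal_distribution by (rule real_dist_normal_dist)
  have N'rd: "real_distribution N'" unfolding N'_def by (rule SN.real_distribution_distr) simp
  have log_residualrd: "real_distribution (distr M borel (V n))" for n by (rule real_distribution_distr) simp
  have V_conv: "weak_conv_m (\<lambda>n. distr M borel (V n)) N'"
  proof (rule levy_continuity[OF log_residualrd N'rd])
    fix t
    have "char (distr M borel (V n)) t = expectation (\<lambda>\<omega>. exp (\<i> * of_real (t * V n \<omega>)))" for n
      unfolding char_def by (subst integral_distr) auto
    moreover have "char N' t = of_real (exp (- (t\<^sup>2 * (c / (1 - c)))))"
    proof -
      have "char N' t = (\<integral>x. exp (\<i> * of_real (t * s * x)) \<partial>std_normal_distribution)"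
        unfolding char_def N'_def by (subst integral_distr) (auto simp: mult_ac)
      also have "\<dots> = of_real (exp (- (t * s)\<^sup>2 / 2))" by (rule std_normal_char)
      also have "- (t * s)\<^sup>2 / 2 = - (t\<^sup>2 * (c / (1 - c)))" 
      proof -
        have gen: "- (x * (2 * y)) / 2 = - (x * y)" for x y :: real by simp
        show ?thesis unfolding power_mult_distrib s(2) by (rule gen)
      qed
      finally show ?thesis .
    qed
    ultimately show "(\<lambda>n. char (distr M borel (V n)) t) \<longlonglongrightarrow> char N' t"
      using char_log_residual_lim[OF p_le c_lim c arr, of t] by (simp only: V_def y_def)
  qed
  \<comment> \<open>The target statistic as a function of the logarithmic residual v, with both
    Marchenko-Pastur integrals evaluated at c_n.\<close>
  define f where "f n v = sqrt (real n) / sqrt (2 * (real (p n) / real n) * (1 / (1 - real (p n) / real n) ^ 3))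
     / (1 - real (p n) / real n) * (exp (- (v / sqrt (real n))) - 1)" for n v
  have [measurable]: "f n \<in> borel_measurable borel" for n unfolding f_def[abs_def] by measurable
  \<comment> \<open>With r the residual, 1/r - 1 - c_n / (1 - c_n) equals ((1 - c_n)/r - 1) / (1 -
    c_n), and (1 - c_n)/r is exp(-V / sqrt n).\<close>
  have Wf: "\<forall>\<^sub>F n in sequentially. \<forall>\<omega>. (\<forall>k<p n. pivot n (y n \<omega>) k \<noteq> 0) \<and> 0 < residual n (y n \<omega>) (p n) \<longrightarrow> W n \<omega> = f n (V n \<omega>)"
    using eventually_ratio[OF p_le c_lim c] order_tendstoD(1)[OF c_lim c(1)]
  proof eventually_elim
    case (elim n)
    define cn where "cn = real (p n) / real n"
    have n: "0 < n" and cn: "0 < cn" "cn < 1" using elim by (auto simp: cn_def)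
    show ?case
    proof (intro allI impI)
      fix \<omega> assume a: "(\<forall>k<p n. pivot n (y n \<omega>) k \<noteq> 0) \<and> 0 < residual n (y n \<omega>) (p n)"
      let ?r = "residual n (y n \<omega>) (p n)"
      have nd: "nd n \<omega>" using a by (auto simp: nd_def)
      have pn: "0 < real n - real (p n)" using elim by simp
      have pos: "0 < ?r * real n / (real n - real (p n))" using a n pn by simp
      have "V n \<omega> / sqrt (real n) = ln (?r * real n / (real n - real (p n)))" using n by (simp add: V_def log_residual_def)
      then have "exp (- (V n \<omega> / sqrt (real n))) = (real n - real (p n)) / (?r * real n)"
        using pos by (simp add: exp_minus)
      also have "\<dots> = (1 - cn) / ?r" using n by (simp add: cn_def field_simps)
      finally have e: "exp (- (V n \<omega> / sqrt (real n))) = (1 - cn) / ?r" .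
      have "W n \<omega> = sqrt (real n) / sqrt (2 * cn * (1 / (1 - cn) ^ 3)) * ((1 / ?r - 1) - cn * (1 / (1 - cn)))"
        unfolding W_def Let_def T2[OF n] if_P[OF nd] cn_def[symmetric] mp_moments[OF cn] ..
      also have "(1 / ?r - 1) - cn * (1 / (1 - cn)) = 1 / (1 - cn) * ((1 - cn) / ?r - 1)"
        using cn a by (simp add: field_simps)
      finally show "W n \<omega> = f n (V n \<omega>)" unfolding f_def cn_def[symmetric] e by simp
    qed
  qed
  \<comment> \<open>The transformation \<open>f n\<close> varies with n. On a space where the
    logarithmic residuals converge pointwise, its limit can be taken along each path.\<close>
  obtain \<Omega> :: "real measure" and Z :: "nat \<Rightarrow> real \<Rightarrow> real" and Z0 :: "real \<Rightarrow> real" where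
    \<Omega>: "prob_space \<Omega>" and Zm: "\<And>n. Z n \<in> measurable \<Omega> borel" and Zd: "\<And>n. distr \<Omega> borel (Z n) = distr M borel (V n)"
    and Z0m: "Z0 \<in> measurable \<Omega> lborel" and Z0d: "distr \<Omega> borel Z0 = N'" and Zlim: "\<And>x. x \<in> space \<Omega> \<Longrightarrow> (\<lambda>n. Z n x) \<longlonglongrightarrow> Z0 x"
    using Skorohod[OF log_residualrd N'rd V_conv] by blast
  interpret \<Omega>: prob_space \<Omega> by fact
  have Z0b: "Z0 \<in> borel_measurable \<Omega>" using Z0m by simp
  note [measurable] = Zm Z0b
  \<comment> \<open>The delta method: sqrt n (exp(-v_n / sqrt n) - 1) tends to -w, with error at
    most v_n^2 / sqrt n, and the deterministic prefactors tend to 1/s.\<close>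
  have flim: "(\<lambda>n. f n (v n)) \<longlonglongrightarrow> - (w / s)" if v: "v \<longlonglongrightarrow> w" for v w
  proof -
    have sn: "(\<lambda>n. v n / sqrt (real n)) \<longlonglongrightarrow> 0"
    proof -
      have "(\<lambda>n. v n * inverse (sqrt (real n))) \<longlonglongrightarrow> w * 0"
        by (intro tendsto_mult v tendsto_inverse_0_at_top filterlim_compose[OF sqrt_at_top filterlim_real_sequentially])
      then show ?thesis by (simp add: divide_inverse)
    qed
    have g: "(\<lambda>n. sqrt (real n) * (exp (- (v n / sqrt (real n))) - 1)) \<longlonglongrightarrow> - w"
    proof (rule Lim_transform)
      show "(\<lambda>n. - v n) \<longlonglongrightarrow> - w" by (intro tendsto_minus v)
      show "(\<lambda>n. sqrt (real n) * (exp (- (v n / sqrt (real n))) - 1) - - v n) \<longlonglongrightarrow> 0"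
      proof (rule Lim_null_comparison)
        have "(\<lambda>n. \<bar>v n\<bar> * \<bar>v n / sqrt (real n)\<bar>) \<longlonglongrightarrow> \<bar>w\<bar> * \<bar>0\<bar>" by (intro tendsto_intros v sn)
        then show "(\<lambda>n. \<bar>v n\<bar> * \<bar>v n / sqrt (real n)\<bar>) \<longlonglongrightarrow> 0" by simp
        have "(\<lambda>n. \<bar>v n / sqrt (real n)\<bar>) \<longlonglongrightarrow> \<bar>0\<bar>" by (intro tendsto_intros sn)
        then have "\<forall>\<^sub>F n in sequentially. \<bar>v n / sqrt (real n)\<bar> < 1" by (intro order_tendstoD(2)) auto
        then show "\<forall>\<^sub>F n in sequentially. norm (sqrt (real n) * (exp (- (v n / sqrt (real n))) - 1) - - v n) \<le> \<bar>v n\<bar> * \<bar>v n / sqrt (real n)\<bar>"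
          using eventually_gt_at_top[of 0]
        proof eventually_elim
          case (elim n)
          let ?x = "- (v n / sqrt (real n))"
          have q: "0 < sqrt (real n)" using elim by simp
          have "\<bar>exp ?x - 1 - ?x\<bar> \<le> ?x\<^sup>2"
          proof (cases "0 \<le> ?x")
            case True
            then have "?x \<le> 1" using elim(1) by linarith
            with True have "exp ?x \<le> 1 + ?x + ?x\<^sup>2" by (rule exp_bound)
            then show ?thesis using exp_ge_add_one_self[of ?x] by simp
          next
            case False
            then show ?thesis using exp_minus_bounds[of "- ?x"] by (simp add: abs_minus_commute algebra_simps)
          qed
          then have "sqrt (real n) * \<bar>exp ?x - 1 - ?x\<bar> \<le> sqrt (real n) * ?x\<^sup>2" using q by (intro mult_left_mono) auto
          moreover have "sqrt (real n) * \<bar>exp ?x - 1 - ?x\<bar> = \<bar>sqrt (real n) * (exp ?x - 1 - ?x)\<bar>" using q by (simp add: abs_mult)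
          moreover have "sqrt (real n) * (exp ?x - 1 - ?x) = sqrt (real n) * (exp ?x - 1) - - v n" using q by (simp add: right_diff_distrib distrib_left)
          moreover have "sqrt (real n) * ?x\<^sup>2 = \<bar>v n\<bar> * \<bar>v n / sqrt (real n)\<bar>"
          proof -
            have gen: "q * (- (a / q))\<^sup>2 = \<bar>a\<bar> * \<bar>a / q\<bar>" if "0 < q" for a q :: real
              using that by (simp add: power2_eq_square abs_divide abs_mult[symmetric])
            show ?thesis by (rule gen[OF q])
          qed
          ultimately show ?case by simp
        qed
      qed
    qed
    have "(\<lambda>n. 1 / sqrt (2 * (real (p n) / real n) * (1 / (1 - real (p n) / real n) ^ 3)) / (1 - real (p n) / real n))
       \<longlonglongrightarrow> 1 / sqrt (2 * c * (1 / (1 - c) ^ 3)) / (1 - c)"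
      using c by (intro tendsto_intros c_lim) auto
    also have "1 / sqrt (2 * c * (1 / (1 - c) ^ 3)) / (1 - c) = 1 / s"
    proof -
      \<comment> \<open>The standardisation is consistent: sqrt(2 c / (1 - c)^3) is s/(1 - c), so it
        cancels the factor 1/(1 - c) of the delta method down to 1/s.\<close>
      have e: "2 * c * (1 / (1 - c) ^ 3) = (s / (1 - c))\<^sup>2"
        unfolding power_divide s(2) using c by (simp add: power2_eq_square power3_eq_cube)
      have "0 \<le> s / (1 - c)" using s c by simp
      then have "sqrt (2 * c * (1 / (1 - c) ^ 3)) = s / (1 - c)" unfolding e by (simp only: real_sqrt_abs abs_of_nonneg)
      then show ?thesis using c s by simp
    qed
    finally have "(\<lambda>n. 1 / sqrt (2 * (real (p n) / real n) * (1 / (1 - real (p n) / real n) ^ 3)) / (1 - real (p n) / real n)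
        * (sqrt (real n) * (exp (- (v n / sqrt (real n))) - 1))) \<longlonglongrightarrow> 1 / s * - w"
      by (rule tendsto_mult[OF _ g])
    then show ?thesis by (simp add: f_def[abs_def] mult_ac)
  qed
  have Wrd: "real_distribution (distr M borel (W n))" for n by (rule real_distribution_distr) simp
  have "weak_conv_m (\<lambda>n. distr M borel (W n)) std_normal_distribution"
  proof (rule levy_continuity[OF Wrd real_dist_normal_dist])
    fix t
    let ?B = "\<lambda>n. {\<omega> \<in> space M. \<not> ((\<forall>k<p n. pivot n (y n \<omega>) k \<noteq> 0) \<and> 0 < residual n (y n \<omega>) (p n))}"
    have cW: "char (distr M borel (W n)) t = expectation (\<lambda>\<omega>. exp (\<i> * of_real (t * W n \<omega>)))" for n
      unfolding char_def by (subst integral_distr) auto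
    have cV: "expectation (\<lambda>\<omega>. exp (\<i> * of_real (t * f n (V n \<omega>)))) = (\<integral>x. exp (\<i> * of_real (t * f n (Z n x))) \<partial>\<Omega>)" for n
    proof -
      have "expectation (\<lambda>\<omega>. exp (\<i> * of_real (t * f n (V n \<omega>)))) = (\<integral>v. exp (\<i> * of_real (t * f n v)) \<partial>distr M borel (V n))"
        by (subst integral_distr) auto
      also have "\<dots> = (\<integral>v. exp (\<i> * of_real (t * f n v)) \<partial>distr \<Omega> borel (Z n))" by (simp only: Zd)
      also have "\<dots> = (\<integral>x. exp (\<i> * of_real (t * f n (Z n x))) \<partial>\<Omega>)" by (subst integral_distr) auto
      finally show ?thesis .
    qed
    have "(\<lambda>n. \<integral>x. exp (\<i> * of_real (t * f n (Z n x))) \<partial>\<Omega>) \<longlonglongrightarrow> (\<integral>x. exp (\<i> * of_real (t * - (Z0 x / s))) \<partial>\<Omega>)"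
    proof (rule integral_dominated_convergence[where w="\<lambda>_. 1"])
      show "AE x in \<Omega>. (\<lambda>n. exp (\<i> * of_real (t * f n (Z n x)))) \<longlonglongrightarrow> exp (\<i> * of_real (t * - (Z0 x / s)))"
        by (rule AE_I2) (intro tendsto_intros flim Zlim)
    qed auto
    also have "(\<integral>x. exp (\<i> * of_real (t * - (Z0 x / s))) \<partial>\<Omega>) = (\<integral>v. exp (\<i> * of_real (t * - (v / s))) \<partial>N')"
      unfolding Z0d[symmetric] by (subst integral_distr) auto
    \<comment> \<open>The statistic decreases in the residual, hence the sign; the standard normal
      law is symmetric.\<close>
    also have "\<dots> = (\<integral>v. exp (\<i> * of_real ((- t) * v)) \<partial>std_normal_distribution)"
      unfolding N'_def using s by (subst integral_distr) auto
    also have "\<dots> = of_real (exp (- t\<^sup>2 / 2))" unfolding std_normal_char by simp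
    finally have 1: "(\<lambda>n. expectation (\<lambda>\<omega>. exp (\<i> * of_real (t * f n (V n \<omega>))))) \<longlonglongrightarrow> of_real (exp (- t\<^sup>2 / 2))"
      unfolding cV .
    have 2: "(\<lambda>n. char (distr M borel (W n)) t - expectation (\<lambda>\<omega>. exp (\<i> * of_real (t * f n (V n \<omega>))))) \<longlonglongrightarrow> 0"
    proof (rule Lim_null_comparison)
      \<comment> \<open>W and f(V) coincide off the degenerate event, and on it two numbers of
        modulus 1 differ by at most 2. This also disposes of the default value 0 for singular
        covariances.\<close>
      have "(\<lambda>n. 2 * prob (?B n)) \<longlonglongrightarrow> 2 * 0" unfolding y_def
        by (intro tendsto_intros degenerate_lim[OF p_le c_lim c arr])
      then show "(\<lambda>n. 2 * prob (?B n)) \<longlonglongrightarrow> 0" by simp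
      show "\<forall>\<^sub>F n in sequentially. norm (char (distr M borel (W n)) t - expectation (\<lambda>\<omega>. exp (\<i> * of_real (t * f n (V n \<omega>))))) \<le> 2 * prob (?B n)"
        using Wf
      proof eventually_elim
        case (elim n)
        have i: "integrable M (\<lambda>\<omega>. exp (\<i> * of_real (t * W n \<omega>)))" "integrable M (\<lambda>\<omega>. exp (\<i> * of_real (t * f n (V n \<omega>))))"
          by (rule integrable_const_bound[where B=1]; auto)+
        have B: "?B n \<in> events" by measurable
        have iB: "integrable M (\<lambda>\<omega>. 2 * indicator (?B n) \<omega> :: real)"
          by (intro integrable_mult_right integrable_real_indicator B) (simp add: less_top[symmetric])
        have "norm (char (distr M borel (W n)) t - expectation (\<lambda>\<omega>. exp (\<i> * of_real (t * f n (V n \<omega>)))))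
          = norm (expectation (\<lambda>\<omega>. exp (\<i> * of_real (t * W n \<omega>)) - exp (\<i> * of_real (t * f n (V n \<omega>)))))"
          unfolding cW using i by simp
        also have "\<dots> \<le> expectation (\<lambda>\<omega>. norm (exp (\<i> * of_real (t * W n \<omega>)) - exp (\<i> * of_real (t * f n (V n \<omega>)))))"
          by (rule integral_norm_bound)
        also have "\<dots> \<le> expectation (\<lambda>\<omega>. 2 * indicator (?B n) \<omega>)"
        proof (rule integral_mono)
          fix \<omega> assume \<omega>: "\<omega> \<in> space M"
          show "norm (exp (\<i> * of_real (t * W n \<omega>)) - exp (\<i> * of_real (t * f n (V n \<omega>)))) \<le> 2 * indicator (?B n) \<omega>"
          proof (cases "\<omega> \<in> ?B n")
            case True
            have "norm (exp (\<i> * of_real (t * W n \<omega>)) - exp (\<i> * of_real (t * f n (V n \<omega>)))) \<le> norm (exp (\<i> * of_real (t * W n \<omega>))) + norm (exp (\<i> * of_real (t * f n (V n \<omega>))))"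
              by (rule norm_triangle_ineq4)
            then show ?thesis using True by simp
          next
            case False
            then have "W n \<omega> = f n (V n \<omega>)" using elim \<omega> by blast
            then show ?thesis by simp
          qed
        qed (rule iB | rule integrable_norm Bochner_Integration.integrable_diff i)+
        also have "\<dots> = 2 * prob (?B n)" using B by simp
        finally show ?case .
      qed
    qed
    have "(\<lambda>n. char (distr M borel (W n)) t) \<longlonglongrightarrow> of_real (exp (- t\<^sup>2 / 2))" using tendsto_add[OF 2 1] by simp
    then show "(\<lambda>n. char (distr M borel (W n)) t) \<longlonglongrightarrow> char std_normal_distribution t"
      by (simp add: char_std_normal_distribution)
  qed
  then show ?thesis unfolding W_def[abs_def] .
qed

end
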